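(* There is an absolute constant $C>0$ such that for any integer $d\ge1$ and $\varepsilon>0$ there exists an $\varepsilon$-differentially private mechanism $\mathcal{M}$ for the workload $\mathcal{Q}_{2,d}$ of 2-way marginals with \[ \mathrm{sc}(\mathcal{M},\mathcal{Q}_{2,d},\alpha)\le C\min\left\{\frac{d^{1.5}}{\alpha\varepsilon},\frac{d}{\alpha^2\varepsilon}\right\} \] for every $\alpha>0$. Moreover, the mechanism runs in time polynomial in $d,n,\frac1\varepsilon$.
   Context: The universe is $\mathcal{X}=\{0,1\}^d$; a dataset $X\in\mathcal{X}^n$ is a sequence of $n$ elements. The workload $\mathcal{Q}_{2,d}$ consists of the $\binom d2$ queries $q_{\{i,j\}}(x)=x_ix_j$ for $i\neq j\in[d]$, evaluated on datasets as $q(X)=\frac1n\sum_{x\in X}q(x)$; $\mathcal{Q}(X)$ is the vector of all these answers ($k=\binom d2$). A mechanism maps datasets to random vectors in $\mathbb{R}^k$; it is $\varepsilon$-differentially private if for all $X,X'\in\mathcal{X}^n$ differing in at most one element and all measurable $S$, $\Pr(\mathcal{M}(X)\in S)\le e^\varepsilon\Pr(\mathcal{M}(X')\in S)$. $\mathrm{err}(\mathcal{M},\mathcal{Q},n)=\max_{X\in\mathcal{X}^n}\mathbb{E}[\frac1{\sqrt k}\|\mathcal{M}(X)-\mathcal{Q}(X)\|_2]$; $\mathrm{sc}(\mathcal{M},\mathcal{Q},\alpha)=\inf\{n:\mathrm{err}(\mathcal{M},\mathcal{Q},n)\le\alpha\}$.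
   Formalization: The bound is read as max{1, C·min{…}} with sample sizes n ≥ 1: q(X) is undefined for n = 0, so sc ≥ 1 always, and the printed inequality fails once C·min{…} < 1 (for instance for large α). *)

theory Defs
  imports "HOL-Probability.Probability"
begin

section \<open>Query workloads and differential privacy\<close>

text \<open>
  A workload is a finite index set \<open>I\<close> with a family of queries \<open>q :: 'i \<Rightarrow> 'x \<Rightarrow> real\<close>.
  The space \<open>\<real>\<^sup>k\<close> with \<open>k = card I\<close> is the product \<open>\<Pi>\<^sub>M i\<in>I. borel\<close>.
  A mechanism is given by the family of its output distributions.
\<close>

type_synonym ('x, 'i) mechanism = "'x list \<Rightarrow> ('i \<Rightarrow> real) measure"

definition datasets :: "'x set \<Rightarrow> nat \<Rightarrow> 'x list set" where
  "datasets U n = {X. length X = n \<and> set X \<subseteq> U}"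

definition answer :: "('x \<Rightarrow> real) \<Rightarrow> 'x list \<Rightarrow> real" where
  "answer q X = (1 / real (length X)) * (\<Sum>x\<leftarrow>X. q x)"

abbreviation answer_space :: "'i set \<Rightarrow> ('i \<Rightarrow> real) measure" where
  "answer_space I \<equiv> PiM I (\<lambda>_. borel)"

definition is_mechanism :: "'x set \<Rightarrow> 'i set \<Rightarrow> ('x, 'i) mechanism \<Rightarrow> bool" where
  "is_mechanism U I M \<longleftrightarrow>
     (\<forall>n. \<forall>X\<in>datasets U n. prob_space (M X) \<and> sets (M X) = sets (answer_space I))"

definition neighbours :: "'x list \<Rightarrow> 'x list \<Rightarrow> bool" where
  "neighbours X Y \<longleftrightarrow> length X = length Y \<and> card {i. i < length X \<and> X ! i \<noteq> Y ! i} \<le> 1"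

definition diff_private :: "real \<Rightarrow> 'x set \<Rightarrow> 'i set \<Rightarrow> ('x, 'i) mechanism \<Rightarrow> bool" where
  "diff_private \<epsilon> U I M \<longleftrightarrow>
     (\<forall>n. \<forall>X\<in>datasets U n. \<forall>Y\<in>datasets U n. neighbours X Y \<longrightarrow>
        (\<forall>S\<in>sets (answer_space I). emeasure (M X) S \<le> ennreal (exp \<epsilon>) * emeasure (M Y) S))"

text \<open>
  The expectation is taken in \<open>ennreal\<close>, so that an error without finite mean is infinite
  (the Bochner integral would be \<open>0\<close>).
\<close>

definition err ::
    "'x set \<Rightarrow> 'i set \<Rightarrow> ('i \<Rightarrow> 'x \<Rightarrow> real) \<Rightarrow> ('x, 'i) mechanism \<Rightarrow> nat \<Rightarrow> ennreal" where
  "err U I q M n = (SUP X\<in>datasets U n.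
     \<integral>\<^sup>+ y. ennreal ((1 / sqrt (real (card I))) * sqrt (\<Sum>i\<in>I. (y i - answer (q i) X)\<^sup>2)) \<partial>M X)"

text \<open>
  The infimum of the empty set is \<open>\<infinity>\<close> here. Only nonempty datasets count: for \<open>n = 0\<close> the
  average over \<open>X\<close> is meaningless, and a mechanism could match its HOL value \<open>0\<close> exactly.
  Hence the sample complexity is at least \<open>1\<close>, and asymptotic upper bounds that drop below \<open>1\<close>
  (large \<open>\<alpha>\<close> or \<open>\<epsilon>\<close>) have to be read as the bound \<open>1\<close>.
\<close>

definition sample_complexity ::
    "'x set \<Rightarrow> 'i set \<Rightarrow> ('i \<Rightarrow> 'x \<Rightarrow> real) \<Rightarrow> ('x, 'i) mechanism \<Rightarrow> real \<Rightarrow> ennreal" where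
  "sample_complexity U I q M \<alpha> =
     (INF n\<in>{n. n \<ge> 1 \<and> err U I q M n \<le> ennreal \<alpha>}. of_nat n)"


section \<open>Two-way marginals\<close>

definition cube :: "nat \<Rightarrow> bool list set" where
  "cube d = {x. length x = d}"

text \<open>The unordered pair \<open>{i, j}\<close> is represented by \<open>(i, j)\<close> with \<open>i < j\<close>; coordinates are
  numbered from \<open>0\<close>.\<close>

definition pairs :: "nat \<Rightarrow> (nat \<times> nat) set" where
  "pairs d = {(i, j). i < j \<and> j < d}"

definition marginal :: "nat \<times> nat \<Rightarrow> bool list \<Rightarrow> real" where
  "marginal p x = of_bool (x ! fst p) * of_bool (x ! snd p)"

lemma card_pairs: "card (pairs d) = d choose 2"
proof -
  have inj: "inj_on (\<lambda>(i, j). {i, j}) (pairs d)"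
    by (auto simp: inj_on_def pairs_def doubleton_eq_iff)
  have "(\<lambda>(i, j). {i, j}) ` pairs d = {S. S \<subseteq> {..<d} \<and> card S = 2}" (is "?L = ?R")
  proof
    show "?L \<subseteq> ?R" by (auto simp: pairs_def)
    show "?R \<subseteq> ?L"
    proof
      fix S assume "S \<in> ?R"
      then obtain a b where S: "S = {a, b}" "a \<noteq> b" "a < d" "b < d"
        by (auto simp: card_2_iff)
      have "S = (\<lambda>(i, j). {i, j}) (min a b, max a b)" "(min a b, max a b) \<in> pairs d"
        using S by (auto simp: pairs_def min_def max_def)
      then show "S \<in> ?L" by blast
    qed
  qed
  then show ?thesis
    using card_image[OF inj] n_subsets[of "{..<d}" 2] by simp
qed


section \<open>A randomised real-number machine\<close>

text \<open>
  Running time is measured on a random access machine over the reals with unit-cost arithmetic: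
  index registers hold natural numbers and only support addition and truncated subtraction;
  memory cells hold real numbers, are addressed by index expressions and support the field
  operations (with \<open>x / 0 = 0\<close>) and comparison. There is no rounding and no conversion
  between reals and indices. Fresh independent samples from the uniform distribution
  on \<open>[0, 1]\<close> and from the standard normal distribution can be drawn at unit cost.

  Each assignment, draw and test costs one step, whatever the size of the expressions in it:
  that size is bounded by the program text, which does not depend on the input.
\<close>

datatype iexp =
    INum nat
  | IReg nat
  | IPlus iexp iexp
  | IMinus iexp iexp

datatype rexp =
    RNum int
  | RCell iexp
  | RPlus rexp rexp
  | RMinus rexp rexp
  | RTimes rexp rexp
  | RDivide rexp rexp

datatype test =
    ILess iexp iexp
  | RLess rexp rexp

datatype com =
    Nop
  | SetReg nat iexp
  | SetCell iexp rexp
  | DrawUniform iexp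
  | DrawNormal iexp
  | Seq com com
  | Cond test com com
  | Loop test com

text \<open>The counter \<open>drawn\<close> is the number of samples consumed so far.\<close>

record state =
  reg :: "nat \<Rightarrow> nat"
  cell :: "nat \<Rightarrow> real"
  drawn :: nat

primrec ival :: "state \<Rightarrow> iexp \<Rightarrow> nat" where
  "ival s (INum k) = k"
| "ival s (IReg r) = reg s r"
| "ival s (IPlus a b) = ival s a + ival s b"
| "ival s (IMinus a b) = ival s a - ival s b"

primrec rval :: "state \<Rightarrow> rexp \<Rightarrow> real" where
  "rval s (RNum k) = of_int k"
| "rval s (RCell a) = cell s (ival s a)"
| "rval s (RPlus a b) = rval s a + rval s b"
| "rval s (RMinus a b) = rval s a - rval s b"
| "rval s (RTimes a b) = rval s a * rval s b"
| "rval s (RDivide a b) = rval s a / rval s b"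

primrec holds :: "state \<Rightarrow> test \<Rightarrow> bool" where
  "holds s (ILess a b) \<longleftrightarrow> ival s a < ival s b"
| "holds s (RLess a b) \<longleftrightarrow> rval s a < rval s b"

definition set_reg :: "nat \<Rightarrow> nat \<Rightarrow> state \<Rightarrow> state" where
  "set_reg r k s = s\<lparr>reg := (reg s)(r := k)\<rparr>"

definition set_cell :: "nat \<Rightarrow> real \<Rightarrow> state \<Rightarrow> state" where
  "set_cell a v s = s\<lparr>cell := (cell s)(a := v)\<rparr>"

definition tick_drawn :: "state \<Rightarrow> state" where
  "tick_drawn s = s\<lparr>drawn := Suc (drawn s)\<rparr>"

text \<open>A tape holds a sequence of uniform and a sequence of normal samples; a draw reads the
  relevant sequence at position \<open>drawn\<close>, hence never reads the same sample twice.\<close>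

type_synonym tape = "(nat \<Rightarrow> real) \<times> (nat \<Rightarrow> real)"

definition tape_measure :: "tape measure" where
  "tape_measure =
     PiM UNIV (\<lambda>_. uniform_measure lborel {0..1}) \<Otimes>\<^sub>M
     PiM UNIV (\<lambda>_. density lborel (\<lambda>x. ennreal (std_normal_density x)))"

text \<open>\<open>exec \<omega> c s t s'\<close>: started in \<open>s\<close> with tape \<open>\<omega>\<close>, the program \<open>c\<close> halts in \<open>s'\<close> after
  \<open>t\<close> steps.\<close>

inductive exec :: "tape \<Rightarrow> com \<Rightarrow> state \<Rightarrow> nat \<Rightarrow> state \<Rightarrow> bool" for \<omega> :: tape where
  Nop: "exec \<omega> Nop s 1 s"
| SetReg: "exec \<omega> (SetReg r a) s 1 (set_reg r (ival s a) s)"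
| SetCell: "exec \<omega> (SetCell a e) s 1 (set_cell (ival s a) (rval s e) s)"
| DrawUniform: "exec \<omega> (DrawUniform a) s 1
    (tick_drawn (set_cell (ival s a) (fst \<omega> (drawn s)) s))"
| DrawNormal: "exec \<omega> (DrawNormal a) s 1
    (tick_drawn (set_cell (ival s a) (snd \<omega> (drawn s)) s))"
| Seq: "exec \<omega> c1 s t1 s1 \<Longrightarrow> exec \<omega> c2 s1 t2 s2 \<Longrightarrow> exec \<omega> (Seq c1 c2) s (t1 + t2) s2"
| CondTrue: "holds s b \<Longrightarrow> exec \<omega> c1 s t s' \<Longrightarrow> exec \<omega> (Cond b c1 c2) s (Suc t) s'"
| CondFalse: "\<not> holds s b \<Longrightarrow> exec \<omega> c2 s t s' \<Longrightarrow> exec \<omega> (Cond b c1 c2) s (Suc t) s'"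
| LoopFalse: "\<not> holds s b \<Longrightarrow> exec \<omega> (Loop b c) s 1 s"
| LoopTrue: "holds s b \<Longrightarrow> exec \<omega> c s t1 s1 \<Longrightarrow> exec \<omega> (Loop b c) s1 t2 s2
    \<Longrightarrow> exec \<omega> (Loop b c) s (Suc (t1 + t2)) s2"

lemma exec_deterministic:
  "exec \<omega> c s t s' \<Longrightarrow> exec \<omega> c s u s'' \<Longrightarrow> u = t \<and> s'' = s'"
proof (induction arbitrary: u s'' rule: exec.induct)
  case (Seq c1 s t1 s1 c2 t2 s2)
  from Seq.prems show ?case by cases (use Seq.IH in blast)
next
  case (CondTrue s b c1 t s' c2)
  from CondTrue.prems show ?case by cases (use CondTrue.hyps CondTrue.IH in blast)+
next
  case (CondFalse s b c2 t s' c1)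
  from CondFalse.prems show ?case by cases (use CondFalse.hyps CondFalse.IH in blast)+
next
  case (LoopTrue s b c t1 s1 t2 s2)
  from LoopTrue.prems show ?case by cases (use LoopTrue.hyps LoopTrue.IH in blast)+
qed (auto elim: exec.cases)

text \<open>
  Input: registers \<open>0\<close> and \<open>1\<close> hold \<open>d\<close> and \<open>n\<close>, cell \<open>0\<close> holds \<open>\<epsilon>\<close>, and cell \<open>1 + i * d + j\<close>
  holds bit \<open>j\<close> of the \<open>i\<close>-th element of the dataset; everything else is \<open>0\<close>.
  Output: the answer to the query \<open>(i, j)\<close> is left in cell \<open>i * d + j\<close>.
\<close>

definition input_state :: "nat \<Rightarrow> real \<Rightarrow> bool list list \<Rightarrow> state" where
  "input_state d \<epsilon> X =
     \<lparr>reg = (\<lambda>r. if r = 0 then d else if r = 1 then length X else 0),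
      cell = (\<lambda>a. if a = 0 then \<epsilon>
                  else if a \<le> length X * d then of_bool (X ! ((a - 1) div d) ! ((a - 1) mod d))
                  else 0),
      drawn = 0\<rparr>"

definition output_vector :: "nat \<Rightarrow> state \<Rightarrow> nat \<times> nat \<Rightarrow> real" where
  "output_vector d s = (\<lambda>p\<in>pairs d. cell s (fst p * d + snd p))"

text \<open>
  For every input dataset of size \<open>n\<close> and every tape, the program halts within \<open>T n\<close> steps, and
  its output is a random vector with the distribution prescribed by \<open>M\<close>.
\<close>

definition computes_within ::
    "com \<Rightarrow> nat \<Rightarrow> real \<Rightarrow> (bool list, nat \<times> nat) mechanism \<Rightarrow> (nat \<Rightarrow> real) \<Rightarrow> bool" where
  "computes_within c d \<epsilon> M T \<longleftrightarrow>
     (\<forall>n. \<forall>X\<in>datasets (cube d) n. \<exists>F.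
        (\<forall>\<omega>. \<exists>t. exec \<omega> c (input_state d \<epsilon> X) t (F \<omega>) \<and> real t \<le> T n) \<and>
        (\<lambda>\<omega>. output_vector d (F \<omega>)) \<in> measurable tape_measure (answer_space (pairs d)) \<and>
        M X = distr tape_measure (answer_space (pairs d)) (\<lambda>\<omega>. output_vector d (F \<omega>)))"

end

theory Submission
  imports Defs
begin

text \<open>
  Write \<open>Q\<close> for the matrix of marginals, the average of the \<open>x x\<^sup>T\<close>. The mechanism adds \<open>s (W - W')\<close>
  to it, where \<open>s = 2 d / (n \<epsilon>)\<close> and \<open>W\<close>, \<open>W'\<close> are independent Wishart matrices with \<open>d + 1\<close> degrees
  of freedom, i.e. half the sum of \<open>g g\<^sup>T\<close> over \<open>d + 1\<close> standard normal vectors. The density of \<open>W\<close>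
  is proportional to \<open>exp (- tr W)\<close> on the positive semidefinite cone, so a shift by \<open>b b\<^sup>T\<close> costs
  at most a factor \<open>exp (|b|\<^sup>2)\<close>; shifts of \<open>W\<close> and of \<open>W'\<close> together allow both signs, and this is
  the privacy proof. The shift bound is obtained without densities: a rotation makes \<open>b\<close> a multiple
  of the first coordinate vector; then only half the squared length of the first column of \<open>d + 1\<close>
  normal variables moves, and given its inner products with the other \<open>d - 1\<close> columns this
  length still contains an independent exponential variable.

  The noise has operator norm of order \<open>d\<^sup>2 / (n \<epsilon>)\<close>, hence Frobenius norm of order
  \<open>d\<^sup>2 sqrt d / (n \<epsilon>)\<close>, which is the first bound. If \<open>n \<epsilon> < d\<^sup>2\<close>, the noisy matrix is projected
  approximately onto the positive semidefinite matrices of trace \<open>d\<close>; by duality of trace and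
  operator norm the squared distance to \<open>Q\<close> becomes of order \<open>d\<close> times the operator norm, which is
  the second bound. The projection is a Frank-Wolfe iteration. A high power of the shifted
  residual, scaled to trace \<open>1\<close>, solves its linear problems up to a negligible error, so field
  operations suffice.
\<close>


section \<open>Rotation invariance of the normal distribution\<close>

text \<open>\<open>d + 1\<close> is the least number of degrees of freedom that serves. With
  \<open>m\<close> of them the density of \<open>W\<close> carries the factor
  \<open>det W ^ ((m - d - 1) / 2)\<close>: for \<open>m \<le> d\<close> a shift changes it by an
  unbounded ratio near the boundary of the cone. Without densities the same number reappears as
  \<open>d - 1\<close> inner products plus two spare directions, two being what an exponential
  variable needs.

  A shift costs its trace \<open>|b|\<^sup>2\<close>, not its Frobenius norm. One element
  contributes \<open>x x^T / n\<close>, of trace at most \<open>d / n\<close>, and a replacement is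
  two shifts; this fixes the noise level. What is paid for trace is received back in operator norm,
  the dual norm, and so the error bound is stated for operator norms first.

  The error is an expectation, so a tail bound on the operator norm is not the form wanted. Instead
  an explicit random variable dominates the norm pointwise and has a mean of order \<open>d\<close>;
  every later error estimate is made affine in it before integrating.\<close>

abbreviation std_normal :: "real measure" where
  "std_normal \<equiv> density lborel (\<lambda>x. ennreal (std_normal_density x))"

lemma prob_space_std_normal: "prob_space std_normal"
  by (rule prob_space_normal_density) simp

lemma lborel_shear:
  fixes F :: "real \<Rightarrow> real \<Rightarrow> ennreal"
  assumes [measurable]: "case_prod F \<in> borel_measurable (borel \<Otimes>\<^sub>M borel)"
  shows "(\<integral>\<^sup>+y. \<integral>\<^sup>+x. F (x + t * y) y \<partial>lborel \<partial>lborel) = (\<integral>\<^sup>+y. \<integral>\<^sup>+x. F x y \<partial>lborel \<partial>lborel)"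
proof (rule nn_integral_cong)
  fix y :: real
  have "(\<integral>\<^sup>+x. F x y \<partial>lborel) = ennreal \<bar>1\<bar> * (\<integral>\<^sup>+x. F (t * y + 1 * x) y \<partial>lborel)"
    by (rule nn_integral_real_affine) auto
  then show "(\<integral>\<^sup>+x. F (x + t * y) y \<partial>lborel) = (\<integral>\<^sup>+x. F x y \<partial>lborel)"
    by (simp add: add.commute)
qed

lemma lborel_swap:
  fixes F :: "real \<Rightarrow> real \<Rightarrow> ennreal"
  assumes [measurable]: "case_prod F \<in> borel_measurable (borel \<Otimes>\<^sub>M borel)"
  shows "(\<integral>\<^sup>+y. \<integral>\<^sup>+x. F x y \<partial>lborel \<partial>lborel) = (\<integral>\<^sup>+x. \<integral>\<^sup>+y. F x y \<partial>lborel \<partial>lborel)"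
  by (rule lborel_pair.Fubini') simp

text \<open>A rotation is a product of three shears.\<close>

lemma lborel_rotate:
  fixes F :: "real \<Rightarrow> real \<Rightarrow> ennreal"
  assumes F[measurable]: "case_prod F \<in> borel_measurable (borel \<Otimes>\<^sub>M borel)"
    and cs: "c\<^sup>2 + s\<^sup>2 = 1" "c \<ge> 0"
  shows "(\<integral>\<^sup>+y. \<integral>\<^sup>+x. F (c * x - s * y) (s * x + c * y) \<partial>lborel \<partial>lborel)
    = (\<integral>\<^sup>+y. \<integral>\<^sup>+x. F x y \<partial>lborel \<partial>lborel)"
proof -
  \<comment> \<open>\<open>t\<close> is the tangent of half the angle, and the shears have slopes
    \<open>-t\<close>, \<open>s\<close>, \<open>-t\<close>. The assumption \<open>c \<ge> 0\<close>
    keeps \<open>1 + c\<close> away from \<open>0\<close>.\<close>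
  define t where "t = s / (1 + c)"
  have ss: "s * s = (1 - c) * (1 + c)"
    using cs(1) by (simp add: power2_eq_square algebra_simps)
  then have st: "s * t = 1 - c"
    using cs(2) by (simp add: t_def field_simps)
  have tc: "t * (1 + c) = s" using cs(2) by (simp add: t_def)
  have "(\<integral>\<^sup>+y. \<integral>\<^sup>+x. F x y \<partial>lborel \<partial>lborel)
      = (\<integral>\<^sup>+y. \<integral>\<^sup>+x. F (x + (-t) * y) y \<partial>lborel \<partial>lborel)"
    by (subst lborel_shear[where t="-t"]) auto
  also have "\<dots> = (\<integral>\<^sup>+x. \<integral>\<^sup>+y. F (x + (-t) * y) y \<partial>lborel \<partial>lborel)"
    by (rule lborel_swap) simp
  also have "\<dots> = (\<integral>\<^sup>+x. \<integral>\<^sup>+y. F (x + (-t) * (y + s * x)) (y + s * x) \<partial>lborel \<partial>lborel)"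
    by (subst lborel_shear[where t=s and F="\<lambda>y x. F (x + (-t) * y) y"]) auto
  also have "\<dots> = (\<integral>\<^sup>+y. \<integral>\<^sup>+x. F (x + (-t) * (y + s * x)) (y + s * x) \<partial>lborel \<partial>lborel)"
    by (rule lborel_swap[symmetric]) simp
  also have "\<dots> = (\<integral>\<^sup>+y. \<integral>\<^sup>+x. F ((x + (-t) * y) + (-t) * (y + s * (x + (-t) * y))) (y + s * (x + (-t) * y)) \<partial>lborel \<partial>lborel)"
    by (subst lborel_shear[where t="-t" and F="\<lambda>x y. F (x + (-t) * (y + s * x)) (y + s * x)"]) auto
  also have "\<dots> = (\<integral>\<^sup>+y. \<integral>\<^sup>+x. F (c * x - s * y) (s * x + c * y) \<partial>lborel \<partial>lborel)"
  proof -
    have a: "y + s * (x + (-t) * y) = s * x + c * y" for x y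
    proof -
      have "y + s * (x + (-t) * y) = s * x + y - (s * t) * y" by (simp add: algebra_simps)
      then show ?thesis unfolding st by (simp add: algebra_simps)
    qed
    have b: "(x + (-t) * y) + (-t) * (s * x + c * y) = c * x - s * y" for x y
    proof -
      have "(x + (-t) * y) + (-t) * (s * x + c * y) = x - (s * t) * x - (t * (1 + c)) * y"
        by (simp add: algebra_simps)
      then show ?thesis unfolding st tc by (simp add: algebra_simps)
    qed
    show ?thesis by (simp only: a b)
  qed
  finally show ?thesis ..
qed

lemma nn_integral_std_normal2:
  fixes F :: "real \<Rightarrow> real \<Rightarrow> ennreal"
  assumes F[measurable]: "case_prod F \<in> borel_measurable (borel \<Otimes>\<^sub>M borel)"
  shows "(\<integral>\<^sup>+y. \<integral>\<^sup>+x. F x y \<partial>std_normal \<partial>std_normal) =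
     (\<integral>\<^sup>+y. \<integral>\<^sup>+x. ennreal (exp (- ((x\<^sup>2 + y\<^sup>2) / 2)) / (2 * pi)) * F x y \<partial>lborel \<partial>lborel)"
proof -
  have *: "std_normal_density y * std_normal_density x = exp (- ((x\<^sup>2 + y\<^sup>2) / 2)) / (2 * pi)" for x y :: real
    by (simp add: normal_density_def mult_exp_exp field_simps)
  have "(\<integral>\<^sup>+y. \<integral>\<^sup>+x. F x y \<partial>std_normal \<partial>std_normal) =
     (\<integral>\<^sup>+y. ennreal (std_normal_density y) * (\<integral>\<^sup>+x. ennreal (std_normal_density x) * F x y \<partial>lborel) \<partial>lborel)"
    by (simp add: nn_integral_density)
  also have "\<dots> = (\<integral>\<^sup>+y. \<integral>\<^sup>+x. ennreal (std_normal_density y) * (ennreal (std_normal_density x) * F x y) \<partial>lborel \<partial>lborel)"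
    by (simp add: nn_integral_cmult)
  also have "\<dots> = (\<integral>\<^sup>+y. \<integral>\<^sup>+x. ennreal (exp (- ((x\<^sup>2 + y\<^sup>2) / 2)) / (2 * pi)) * F x y \<partial>lborel \<partial>lborel)"
    by (intro nn_integral_cong) (simp add: mult.assoc[symmetric] ennreal_mult[symmetric] *)
  finally show ?thesis .
qed

text \<open>The joint density depends only on \<open>x\<^sup>2 + y\<^sup>2\<close>, which the
  rotation preserves, so it can be absorbed into the function to which \<open>lborel_rotate\<close>
  is applied.\<close>

lemma std_normal_rotate:
  fixes F :: "real \<Rightarrow> real \<Rightarrow> ennreal"
  assumes F[measurable]: "case_prod F \<in> borel_measurable (borel \<Otimes>\<^sub>M borel)"
    and cs: "c\<^sup>2 + s\<^sup>2 = 1" "c \<ge> 0"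
  shows "(\<integral>\<^sup>+y. \<integral>\<^sup>+x. F (c * x - s * y) (s * x + c * y) \<partial>std_normal \<partial>std_normal)
    = (\<integral>\<^sup>+y. \<integral>\<^sup>+x. F x y \<partial>std_normal \<partial>std_normal)"
proof -
  have *: "(c * x - s * y)\<^sup>2 + (s * x + c * y)\<^sup>2 = x\<^sup>2 + y\<^sup>2" for x y
  proof -
    have "(c * x - s * y)\<^sup>2 + (s * x + c * y)\<^sup>2 = (c\<^sup>2 + s\<^sup>2) * (x\<^sup>2 + y\<^sup>2)"
      by (simp add: power2_eq_square algebra_simps)
    then show ?thesis by (simp add: cs)
  qed
  show ?thesis
    using lborel_rotate[OF _ cs, of "\<lambda>x y. ennreal (exp (- ((x\<^sup>2 + y\<^sup>2) / 2)) / (2 * pi)) * F x y"]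
    by (simp add: nn_integral_std_normal2 *)
qed

text \<open>The substitution \<open>r = a * y\<^sup>2 / 2\<close> with
  \<open>dr = a * y * dy\<close>. It is made on compact intervals, and monotone convergence then
  exhausts both half lines.\<close>

lemma nn_integral_half_square:
  fixes f :: "real \<Rightarrow> ennreal"
  assumes [measurable]: "f \<in> borel_measurable borel" and a: "a > 0"
  shows "(\<integral>\<^sup>+y. f (a * y\<^sup>2 / 2) * ennreal (a * y) * indicator {0..} y \<partial>lborel)
    = (\<integral>\<^sup>+r. f r * indicator {0..} r \<partial>lborel)"
proof -
  have step: "(\<integral>\<^sup>+r. f r * indicator {0..a * (real n)\<^sup>2 / 2} r \<partial>lborel) =
    (\<integral>\<^sup>+y. f (a * y\<^sup>2 / 2) * ennreal (a * y) * indicator {0..real n} y \<partial>lborel)" if "n > 0" for n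
  proof -
    have d: "((\<lambda>y. a * y\<^sup>2 / 2) has_real_derivative a * x) (at x)" for x
      by (auto intro!: derivative_eq_intros)
    show ?thesis
      using nn_integral_substitution_aux[of f 0 "real n" "\<lambda>y. a * y\<^sup>2 / 2" "\<lambda>y. a * y"] that a d
      by (auto intro!: continuous_intros)
  qed
  have 1: "(\<integral>\<^sup>+y. f (a * y\<^sup>2 / 2) * ennreal (a * y) * indicator {0..} y \<partial>lborel) =
     (SUP n. \<integral>\<^sup>+y. f (a * y\<^sup>2 / 2) * ennreal (a * y) * indicator {0..real (Suc n)} y \<partial>lborel)"
  proof (subst nn_integral_monotone_convergence_SUP[symmetric])
    show "incseq (\<lambda>n y. f (a * y\<^sup>2 / 2) * ennreal (a * y) * indicator {0..real (Suc n)} y)"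
      by (auto simp: incseq_def le_fun_def split: split_indicator)
    show "(\<integral>\<^sup>+y. f (a * y\<^sup>2 / 2) * ennreal (a * y) * indicator {0..} y \<partial>lborel) =
      (\<integral>\<^sup>+y. (SUP n. f (a * y\<^sup>2 / 2) * ennreal (a * y) * indicator {0..real (Suc n)} y) \<partial>lborel)"
    proof (rule nn_integral_cong)
      fix y :: real
      obtain n where n: "y \<le> real (Suc n)" by (metis real_arch_simple lessI less_imp_le of_nat_mono order_trans)
      show "f (a * y\<^sup>2 / 2) * ennreal (a * y) * indicator {0..} y =
        (SUP n. f (a * y\<^sup>2 / 2) * ennreal (a * y) * indicator {0..real (Suc n)} y)"
        by (rule antisym) (use n in \<open>auto intro!: SUP_upper2[of n] SUP_least split: split_indicator\<close>)
    qed
  qed auto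
  have 2: "(\<integral>\<^sup>+r. f r * indicator {0..} r \<partial>lborel) =
     (SUP n. \<integral>\<^sup>+r. f r * indicator {0..a * (real (Suc n))\<^sup>2 / 2} r \<partial>lborel)"
  proof (subst nn_integral_monotone_convergence_SUP[symmetric])
    show "incseq (\<lambda>n r. f r * indicator {0..a * (real (Suc n))\<^sup>2 / 2} r)"
    proof (intro monoI le_funI)
      fix m n :: nat and r :: real assume mn: "m \<le> n"
      have "a * (real (Suc m))\<^sup>2 \<le> a * (real (Suc n))\<^sup>2"
        using a mn by (intro mult_left_mono power_mono) auto
      then show "f r * indicator {0..a * (real (Suc m))\<^sup>2 / 2} r \<le> f r * indicator {0..a * (real (Suc n))\<^sup>2 / 2} r"
        by (auto split: split_indicator)
    qed
    show "(\<integral>\<^sup>+r. f r * indicator {0..} r \<partial>lborel) =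
      (\<integral>\<^sup>+r. (SUP n. f r * indicator {0..a * (real (Suc n))\<^sup>2 / 2} r) \<partial>lborel)"
    proof (rule nn_integral_cong)
      fix r :: real
      obtain n where n: "2 * r / a \<le> real n" by (metis real_arch_simple)
      also have "real n \<le> real (Suc n) * real (Suc n)"
        by (simp add: algebra_simps)
      finally have "r \<le> a * (real (Suc n))\<^sup>2 / 2" 
        using a by (simp add: pos_divide_le_eq power2_eq_square mult.commute)
      then show "f r * indicator {0..} r = (SUP n. f r * indicator {0..a * (real (Suc n))\<^sup>2 / 2} r)"
        by (intro antisym) (auto intro!: SUP_upper2[of n] SUP_least split: split_indicator)
    qed
  qed auto
  show ?thesis unfolding 1 2 using step[of "Suc _"] by (intro SUP_cong) auto
qed

text \<open>Translating the exponential density to \<open>{b..}\<close> multiplies it by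
  \<open>exp b\<close> there, and enlarging the domain to \<open>{0..}\<close> can only increase the
  integral. This is the one place where a privacy factor arises.\<close>

lemma exponential_shift:
  fixes \<psi> :: "real \<Rightarrow> ennreal"
  assumes [measurable]: "\<psi> \<in> borel_measurable borel" and b: "b \<ge> 0"
  shows "(\<integral>\<^sup>+r. \<psi> (r + b) * ennreal (exp (- r)) * indicator {0..} r \<partial>lborel)
    \<le> ennreal (exp b) * (\<integral>\<^sup>+r. \<psi> r * ennreal (exp (- r)) * indicator {0..} r \<partial>lborel)"
proof -
  have "(\<integral>\<^sup>+r. \<psi> (r + b) * ennreal (exp (- r)) * indicator {0..} r \<partial>lborel)
    = (\<integral>\<^sup>+r. \<psi> r * ennreal (exp (- (r - b))) * indicator {b..} r \<partial>lborel)"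
    by (subst nn_integral_real_affine[where t=b and c=1 and f="\<lambda>r. \<psi> r * ennreal (exp (- (r - b))) * indicator {b..} r"])
       (auto simp: add.commute intro!: nn_integral_cong split: split_indicator)
  also have "\<dots> \<le> (\<integral>\<^sup>+r. ennreal (exp b) * (\<psi> r * ennreal (exp (- r)) * indicator {0..} r) \<partial>lborel)"
    using b
    by (intro nn_integral_mono)
       (auto split: split_indicator simp: exp_diff exp_minus ennreal_mult[symmetric] divide_inverse ac_simps)
  also have "\<dots> = ennreal (exp b) * (\<integral>\<^sup>+r. \<psi> r * ennreal (exp (- r)) * indicator {0..} r \<partial>lborel)"
    by (rule nn_integral_cmult) auto
  finally show ?thesis .
qed

text \<open>Half the squared length of a standard normal vector in the plane is exponentially
  distributed; the substitution \<open>x = y u\<close> shows this for every slope \<open>u\<close> separately.\<close>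

lemma std_normal_plane_shift:
  fixes \<psi> :: "real \<Rightarrow> ennreal"
  assumes [measurable]: "\<psi> \<in> borel_measurable borel" and b: "b \<ge> 0"
  shows "(\<integral>\<^sup>+y. \<integral>\<^sup>+x. \<psi> ((x\<^sup>2 + y\<^sup>2) / 2 + b) \<partial>std_normal \<partial>std_normal)
    \<le> ennreal (exp b) * (\<integral>\<^sup>+y. \<integral>\<^sup>+x. \<psi> ((x\<^sup>2 + y\<^sup>2) / 2) \<partial>std_normal \<partial>std_normal)"
proof -
  \<comment> \<open>Polar coordinates in the form slope and energy: the slope
    \<open>u = x / y\<close> has the Cauchy density, and half the squared length is exponential
    whatever \<open>u\<close> is.\<close>
  have polar: "(\<integral>\<^sup>+y. \<integral>\<^sup>+x. f ((x\<^sup>2 + y\<^sup>2) / 2) \<partial>std_normal \<partial>std_normal) =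
     (\<integral>\<^sup>+u. ennreal (1 / (pi * (1 + u\<^sup>2))) * (\<integral>\<^sup>+r. f r * ennreal (exp (- r)) * indicator {0..} r \<partial>lborel) \<partial>lborel)"
    if [measurable]: "f \<in> borel_measurable borel" for f :: "real \<Rightarrow> ennreal"
  proof -
    let ?g = "\<lambda>r. ennreal (exp (- r) / (2 * pi)) * f r"
    have "(\<integral>\<^sup>+y. \<integral>\<^sup>+x. f ((x\<^sup>2 + y\<^sup>2) / 2) \<partial>std_normal \<partial>std_normal) =
       (\<integral>\<^sup>+y. \<integral>\<^sup>+x. ?g ((x\<^sup>2 + y\<^sup>2) / 2) \<partial>lborel \<partial>lborel)"
      by (rule nn_integral_std_normal2) measurable
    also have "\<dots> = (\<integral>\<^sup>+y. \<integral>\<^sup>+u. ennreal \<bar>y\<bar> * ?g ((1 + u\<^sup>2) * y\<^sup>2 / 2) \<partial>lborel \<partial>lborel)"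
    proof (rule nn_integral_cong_AE)
      have "AE y in lborel. y \<noteq> (0::real)"
        by (rule AE_lborel_singleton)
      then show "AE y in lborel. (\<integral>\<^sup>+x. ?g ((x\<^sup>2 + y\<^sup>2) / 2) \<partial>lborel) =
          (\<integral>\<^sup>+u. ennreal \<bar>y\<bar> * ?g ((1 + u\<^sup>2) * y\<^sup>2 / 2) \<partial>lborel)"
      proof eventually_elim
        case (elim y)
        have "(\<integral>\<^sup>+x. ?g ((x\<^sup>2 + y\<^sup>2) / 2) \<partial>lborel) =
            ennreal \<bar>y\<bar> * (\<integral>\<^sup>+u. ?g (((0 + y * u)\<^sup>2 + y\<^sup>2) / 2) \<partial>lborel)"
          by (rule nn_integral_real_affine) (use elim in auto)
        also have "\<dots> = (\<integral>\<^sup>+u. ennreal \<bar>y\<bar> * ?g (((0 + y * u)\<^sup>2 + y\<^sup>2) / 2) \<partial>lborel)"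
          by (rule nn_integral_cmult[symmetric]) simp
        also have "\<dots> = (\<integral>\<^sup>+u. ennreal \<bar>y\<bar> * ?g ((1 + u\<^sup>2) * y\<^sup>2 / 2) \<partial>lborel)"
          by (intro nn_integral_cong) (simp add: power_mult_distrib algebra_simps)
        finally show ?case .
      qed
    qed
    also have "\<dots> = (\<integral>\<^sup>+u. \<integral>\<^sup>+y. ennreal \<bar>y\<bar> * ?g ((1 + u\<^sup>2) * y\<^sup>2 / 2) \<partial>lborel \<partial>lborel)"
      by (rule lborel_pair.Fubini') simp
    also have "\<dots> = (\<integral>\<^sup>+u. ennreal (1 / (pi * (1 + u\<^sup>2))) * (\<integral>\<^sup>+r. f r * ennreal (exp (- r)) * indicator {0..} r \<partial>lborel) \<partial>lborel)"
    proof (rule nn_integral_cong)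
      fix u :: real
      let ?a = "1 + u\<^sup>2"
      have a: "?a > 0" by (simp add: add_pos_nonneg)
      let ?h = "\<lambda>y. ?g (?a * y\<^sup>2 / 2) * ennreal (?a * y) * indicator {0..} y"
      let ?k = "\<lambda>y. ennreal \<bar>y\<bar> * ?g (?a * y\<^sup>2 / 2) * indicator {0..} y"
      \<comment> \<open>The integrand is even, so both half lines contribute equally; the point
        \<open>0\<close>, counted twice, carries the factor
        \<open>\<bar>y\<bar> = 0\<close>.\<close>
      have neg: "(\<integral>\<^sup>+y. ?k y \<partial>lborel) = (\<integral>\<^sup>+y. ennreal \<bar>y\<bar> * ?g (?a * y\<^sup>2 / 2) * indicator {..0} y \<partial>lborel)"
        by (subst nn_integral_real_affine[where t=0 and c="-1"])
           (auto intro!: nn_integral_cong split: split_indicator)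
      have "(\<integral>\<^sup>+y. ennreal \<bar>y\<bar> * ?g (?a * y\<^sup>2 / 2) \<partial>lborel) =
          (\<integral>\<^sup>+y. ?k y + ennreal \<bar>y\<bar> * ?g (?a * y\<^sup>2 / 2) * indicator {..0} y \<partial>lborel)"
        by (intro nn_integral_cong) (auto split: split_indicator)
      also have "\<dots> = 2 * (\<integral>\<^sup>+y. ?k y \<partial>lborel)"
        by (subst nn_integral_add) (measurable, simp only: neg mult_2[of "integral\<^sup>N _ _"])
      also have "\<dots> = 2 * (\<integral>\<^sup>+y. ennreal (1 / ?a) * ?h y \<partial>lborel)"
      proof -
        have "?k y = ennreal (1 / ?a) * ?h y" for y
        proof (cases "y \<ge> 0")
          case True
          have "ennreal (1 / ?a) * ennreal (?a * y) = ennreal y"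
            using a True by (subst ennreal_mult[symmetric]) auto
          moreover have "A * (G * E) = (A * E) * G" for A G E :: ennreal
            by (simp only: mult_ac)
          ultimately have "ennreal (1 / ?a) * (?g (?a * y\<^sup>2 / 2) * ennreal (?a * y)) = ennreal y * ?g (?a * y\<^sup>2 / 2)"
            by (simp only:)
          with True show ?thesis by simp
        qed simp
        then show ?thesis by simp
      qed
      also have "\<dots> = ennreal (2 / ?a) * (\<integral>\<^sup>+y. ?h y \<partial>lborel)"
      proof -
        have "2 * ennreal (1 / ?a) = ennreal (2 / ?a)"
          using a by (subst ennreal_numeral[symmetric], subst ennreal_mult[symmetric]) auto
        then show ?thesis by (subst nn_integral_cmult) (auto simp: mult.assoc[symmetric])
      qed
      also have "(\<integral>\<^sup>+y. ?h y \<partial>lborel) = (\<integral>\<^sup>+r. ?g r * indicator {0..} r \<partial>lborel)"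
        by (rule nn_integral_half_square) (use a in auto)
      also have "\<dots> = (\<integral>\<^sup>+r. ennreal (1 / (2 * pi)) * (f r * ennreal (exp (- r)) * indicator {0..} r) \<partial>lborel)"
      proof (rule nn_integral_cong)
        fix r :: real
        have "ennreal (exp (- r) / (2 * pi)) = ennreal (1 / (2 * pi)) * ennreal (exp (- r))"
          by (simp add: ennreal_mult[symmetric])
        then show "?g r * indicator {0..} r = ennreal (1 / (2 * pi)) * (f r * ennreal (exp (- r)) * indicator {0..} r)"
          by (simp add: ac_simps)
      qed
      also have "\<dots> = ennreal (1 / (2 * pi)) * (\<integral>\<^sup>+r. f r * ennreal (exp (- r)) * indicator {0..} r \<partial>lborel)"
        by (rule nn_integral_cmult) auto
      also have "ennreal (2 / ?a) * \<dots> = ennreal (1 / (pi * ?a)) * (\<integral>\<^sup>+r. f r * ennreal (exp (- r)) * indicator {0..} r \<partial>lborel)"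
      proof -
        have "ennreal (2 / ?a) * ennreal (1 / (2 * pi)) = ennreal (1 / (pi * ?a))"
          using a by (subst ennreal_mult[symmetric]) (auto simp: field_simps)
        then show ?thesis by (simp add: mult.assoc[symmetric])
      qed
      finally show "(\<integral>\<^sup>+y. ennreal \<bar>y\<bar> * ?g (?a * y\<^sup>2 / 2) \<partial>lborel) =
         ennreal (1 / (pi * (1 + u\<^sup>2))) * (\<integral>\<^sup>+r. f r * ennreal (exp (- r)) * indicator {0..} r \<partial>lborel)" .
    qed
    finally show ?thesis .
  qed
  have "(\<integral>\<^sup>+y. \<integral>\<^sup>+x. \<psi> ((x\<^sup>2 + y\<^sup>2) / 2 + b) \<partial>std_normal \<partial>std_normal) \<le>
     (\<integral>\<^sup>+u. ennreal (1 / (pi * (1 + u\<^sup>2))) *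
        (ennreal (exp b) * (\<integral>\<^sup>+r. \<psi> r * ennreal (exp (- r)) * indicator {0..} r \<partial>lborel)) \<partial>lborel)"
    by (subst polar[of "\<lambda>r. \<psi> (r + b)"])
       (auto intro!: nn_integral_mono mult_left_mono exponential_shift b)
  also have "\<dots> = ennreal (exp b) * (\<integral>\<^sup>+y. \<integral>\<^sup>+x. \<psi> ((x\<^sup>2 + y\<^sup>2) / 2) \<partial>std_normal \<partial>std_normal)"
    by (subst polar, simp, subst nn_integral_cmult[symmetric])
       (auto simp: ac_simps)
  finally show ?thesis .
qed

section \<open>Finite families of independent normal variables and plane rotations of them\<close>

abbreviation gauss :: "'i set \<Rightarrow> ('i \<Rightarrow> real) measure" where
  "gauss I \<equiv> PiM I (\<lambda>_. std_normal)"

interpretation gauss: product_prob_space "\<lambda>_::'i. std_normal" "UNIV :: 'i set"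
  by (intro product_prob_spaceI prob_space_std_normal)

lemma sets_gauss[measurable_cong]: "sets (gauss I) = sets (PiM I (\<lambda>_. borel))"
  by (intro sets_PiM_cong) auto

lemma space_gauss: "space (gauss I) = PiE I (\<lambda>_. UNIV)"
  by (simp add: space_PiM)

lemma prob_space_gauss: "prob_space (gauss I)"
  by (intro prob_space_PiM prob_space_std_normal)

definition rot :: "'i \<Rightarrow> 'i \<Rightarrow> real \<Rightarrow> real \<Rightarrow> ('i \<Rightarrow> real) \<Rightarrow> 'i \<Rightarrow> real" where
  "rot p q c s v = v(p := c * v p - s * v q, q := s * v p + c * v q)"

lemma measurable_rot[measurable]:
  assumes "p \<in> I" "q \<in> I"
  shows "rot p q c s \<in> measurable (gauss I) (PiM I (\<lambda>_. borel))"
proof -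
  have "(\<lambda>v. \<lambda>i\<in>I. if i = q then s * v p + c * v q else if i = p then c * v p - s * v q else v i)
      \<in> measurable (gauss I) (PiM I (\<lambda>_. borel))"
    using assms by measurable
  also have "?this \<longleftrightarrow> ?thesis"
    using assms
    by (intro measurable_cong) (auto simp: rot_def fun_eq_iff space_PiM PiE_def extensional_def)
  finally show ?thesis .
qed

lemma nn_integral_gauss_insert2:
  assumes "finite I" "p \<notin> I" "q \<notin> I" "p \<noteq> q"
    and F: "F \<in> borel_measurable (gauss (insert p (insert q I)))"
  shows "integral\<^sup>N (gauss (insert p (insert q I))) F =
    (\<integral>\<^sup>+w. \<integral>\<^sup>+y. \<integral>\<^sup>+x. F (w(q := y, p := x)) \<partial>std_normal \<partial>std_normal \<partial>gauss I)"
proof -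
  note [measurable] = F
  have "integral\<^sup>N (gauss (insert p (insert q I))) F =
      (\<integral>\<^sup>+w. \<integral>\<^sup>+x. F (w(p := x)) \<partial>std_normal \<partial>gauss (insert q I))"
    by (rule gauss.product_nn_integral_insert) (use assms in auto)
  also have "\<dots> = (\<integral>\<^sup>+w. \<integral>\<^sup>+y. \<integral>\<^sup>+x. F (w(q := y, p := x)) \<partial>std_normal \<partial>std_normal \<partial>gauss I)"
    by (rule gauss.product_nn_integral_insert) (use assms in auto)
  finally show ?thesis .
qed

lemma measurable_upd2:
  assumes F: "F \<in> borel_measurable (gauss (insert p (insert q I)))" and w: "w \<in> space (gauss I)"
  shows "(\<lambda>(x, y). F (w(q := y, p := x))) \<in> borel_measurable (borel \<Otimes>\<^sub>M borel)"
proof -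
  have "(\<lambda>(x, y). w(q := y, p := x)) \<in> measurable (borel \<Otimes>\<^sub>M borel) (gauss (insert p (insert q I)))"
    using w unfolding split_beta' 
    by (intro measurable_fun_upd[where J="insert q I"] measurable_fun_upd[where J=I]) auto
  from measurable_comp[OF this F] show ?thesis by (simp add: comp_def split_beta')
qed

text \<open>Fubini isolates the two coordinates that move, and the planar invariance is applied for
  each fixed choice of the others.\<close>

lemma gauss_rot:
  assumes I: "finite I" "p \<in> I" "q \<in> I" "p \<noteq> q" and cs: "c\<^sup>2 + s\<^sup>2 = 1" "c \<ge> 0"
    and F[measurable]: "F \<in> borel_measurable (gauss I)"
  shows "(\<integral>\<^sup>+v. F (rot p q c s v) \<partial>gauss I) = integral\<^sup>N (gauss I) F"
proof -
  define J where "J = I - {p, q}"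
  have IJ: "I = insert p (insert q J)" and J: "finite J" "p \<notin> J" "q \<notin> J"
    using I by (auto simp: J_def)
  have r: "rot p q c s (w(q := y, p := x)) = w(q := s * x + c * y, p := c * x - s * y)" for w x y
    using I(4) by (auto simp: rot_def fun_eq_iff)
  have "(\<lambda>v. F (rot p q c s v)) \<in> borel_measurable (gauss I)"
    using I by measurable
  then have "(\<integral>\<^sup>+v. F (rot p q c s v) \<partial>gauss I) =
     (\<integral>\<^sup>+w. \<integral>\<^sup>+y. \<integral>\<^sup>+x. F (rot p q c s (w(q := y, p := x))) \<partial>std_normal \<partial>std_normal \<partial>gauss J)"
    unfolding IJ by (intro nn_integral_gauss_insert2 J I) auto
  also have "\<dots> = (\<integral>\<^sup>+w. \<integral>\<^sup>+y. \<integral>\<^sup>+x. F (w(q := y, p := x)) \<partial>std_normal \<partial>std_normal \<partial>gauss J)"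
    unfolding r
    by (intro nn_integral_cong std_normal_rotate[where F="\<lambda>x y. F (_(q := y, p := x))"] cs measurable_upd2)
       (use F in \<open>auto simp: IJ\<close>)
  also have "\<dots> = integral\<^sup>N (gauss I) F"
    unfolding IJ by (intro nn_integral_gauss_insert2[symmetric] J I) (use F IJ in auto)
  finally show ?thesis .
qed

text \<open>Every vector is reached from a multiple of a coordinate vector by plane rotations,
  each of which creates one more nonzero coordinate.\<close>

lemma rot_induct:
  fixes P :: "('i \<Rightarrow> real) \<Rightarrow> bool"
  assumes C: "finite C" "e \<in> C"
    and rot: "\<And>v p q c s. p \<in> C \<Longrightarrow> q \<in> C \<Longrightarrow> p \<noteq> q \<Longrightarrow> c\<^sup>2 + s\<^sup>2 = 1 \<Longrightarrow> c \<ge> 0 \<Longrightarrow> P v \<Longrightarrow> P (rot p q c s v)"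
    and base: "\<And>v. (\<And>i. i \<in> C - {e} \<Longrightarrow> v i = 0) \<Longrightarrow> P v"
  shows "P v"
proof (induction "card {i\<in>C - {e}. v i \<noteq> 0}" arbitrary: v rule: less_induct)
  case less
  show ?case
  proof (cases "\<exists>q\<in>C - {e}. v q \<noteq> 0")
    case False
    then show ?thesis by (intro base) auto
  next
    case True
    then obtain q where q: "q \<in> C" "q \<noteq> e" "v q \<noteq> 0" by auto
    define r where "r = sqrt ((v e)\<^sup>2 + (v q)\<^sup>2)"
    have r: "r > 0" "r\<^sup>2 = (v e)\<^sup>2 + (v q)\<^sup>2"
      using q by (auto simp: r_def intro!: add_nonneg_pos sum_power2_gt_zero_iff[THEN iffD2])
    \<comment> \<open>The sign makes the cosine nonnegative, as the rotation lemmas demand. The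
      vector \<open>w\<close> is \<open>v\<close> rotated back so that coordinate \<open>q\<close>
      vanishes and its length moves into \<open>e\<close>.\<close>
    define \<sigma> where "\<sigma> = (if v e \<ge> 0 then 1 else -1 :: real)"
    have \<sigma>: "\<sigma> * \<sigma> = 1" "\<bar>v e\<bar> = \<sigma> * v e" by (auto simp: \<sigma>_def)
    define c where "c = \<sigma> * v e / r"
    define s where "s = \<sigma> * v q / r"
    define w where "w = v(e := \<sigma> * r, q := 0)"
    have "c\<^sup>2 + s\<^sup>2 = (\<sigma> * \<sigma>) * ((v e)\<^sup>2 + (v q)\<^sup>2) / r\<^sup>2"
      by (simp add: c_def s_def power2_eq_square field_simps add_divide_distrib)
    then have cs: "c\<^sup>2 + s\<^sup>2 = 1" unfolding \<sigma>(1) r(2)[symmetric] using r(1) by simp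
    have c: "c \<ge> 0" using r \<sigma>(2) by (simp add: c_def flip: \<sigma>(2))
    have "{i\<in>C - {e}. w i \<noteq> 0} \<subset> {i\<in>C - {e}. v i \<noteq> 0}"
      using q by (auto simp: w_def)
    then have "card {i\<in>C - {e}. w i \<noteq> 0} < card {i\<in>C - {e}. v i \<noteq> 0}"
      using C by (intro psubset_card_mono) auto
    from less[OF this] have "P (rot e q c s w)"
      by (intro rot cs c) (use q C in auto)
    also have "rot e q c s w = v"
      using q r \<sigma> by (auto simp: rot_def w_def fun_eq_iff c_def s_def)
    finally show ?thesis .
  qed
qed

lemma rot_inner:
  assumes "finite I" "p \<in> I" "q \<in> I" "p \<noteq> q" "c\<^sup>2 + s\<^sup>2 = 1"
  shows "(\<Sum>i\<in>I. rot p q c s v i * rot p q c s w i) = (\<Sum>i\<in>I. v i * w i)"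
proof -
  define J where "J = I - {p, q}"
  have IJ: "I = insert p (insert q J)" and J: "finite J" "p \<notin> J" "q \<notin> J"
    using assms by (auto simp: J_def)
  have "(c * v p - s * v q) * (c * w p - s * w q) + (s * v p + c * v q) * (s * w p + c * w q)
     = (c\<^sup>2 + s\<^sup>2) * (v p * w p + v q * w q)"
    by (simp add: power2_eq_square algebra_simps)
  moreover have "(\<Sum>i\<in>J. rot p q c s v i * rot p q c s w i) = (\<Sum>i\<in>J. v i * w i)"
    using J by (intro sum.cong) (auto simp: rot_def)
  ultimately show ?thesis
    using J assms(4,5) by (simp add: IJ) (simp add: rot_def)
qed

lemma rot_rot:
  assumes "p \<noteq> q" "c\<^sup>2 + s\<^sup>2 = 1"
  shows "rot p q c s (rot p q c (-s) v) = v"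
proof -
  have "c * (c * v p + s * v q) - s * (c * v q - s * v p) = (c\<^sup>2 + s\<^sup>2) * v p"
    "s * (c * v p + s * v q) + c * (c * v q - s * v p) = (c\<^sup>2 + s\<^sup>2) * v q"
    by (simp_all add: power2_eq_square algebra_simps)
  then show ?thesis using assms by (auto simp: rot_def fun_eq_iff)
qed

text \<open>Here \<open>F v r\<close> sees \<open>v\<close> only through the linear forms in \<open>ls\<close>, and \<open>r\<close> stands for half the
  squared length of \<open>v\<close>. The forms leave at least two directions free, along which the
  half squared length is at least exponentially distributed.\<close>

lemma gauss_half_norm_shift:
  fixes F :: "('i \<Rightarrow> real) \<Rightarrow> real \<Rightarrow> ennreal"
  assumes "finite I" "length ls + 2 \<le> card I" "b \<ge> 0"
    and "case_prod F \<in> borel_measurable (gauss I \<Otimes>\<^sub>M borel)"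
    and "\<And>v w r. v \<in> space (gauss I) \<Longrightarrow> w \<in> space (gauss I) \<Longrightarrow>
      \<forall>l\<in>set ls. (\<Sum>i\<in>I. l i * v i) = (\<Sum>i\<in>I. l i * w i) \<Longrightarrow> F v r = F w r"
  shows "(\<integral>\<^sup>+v. F v ((\<Sum>i\<in>I. (v i)\<^sup>2) / 2 + b) \<partial>gauss I)
    \<le> ennreal (exp b) * (\<integral>\<^sup>+v. F v ((\<Sum>i\<in>I. (v i)\<^sup>2) / 2) \<partial>gauss I)"
  using assms
proof (induction "length ls" arbitrary: ls I F)
  case (0 ls I F)
  then have ls: "ls = []" by simp
  note prems = "0.prems"[unfolded ls]
  note [measurable] = prems(4)
  obtain p q J where IJ: "I = insert p (insert q J)" and J: "finite J" "p \<notin> J" "q \<notin> J" "p \<noteq> q"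
  proof -
    from prems(2) obtain p where p: "p \<in> I" by fastforce
    with prems have "card (I - {p}) \<ge> 1" by (simp add: card_Diff_singleton)
    then obtain q where q: "q \<in> I - {p}" by (metis card.empty ex_in_conv not_one_le_zero)
    show ?thesis using p q prems(1) by (intro that[of p q "I - {p, q}"]) auto
  qed
  \<comment> \<open>Without linear forms \<open>F\<close> cannot depend on its vector argument at
    all, so it may be evaluated at \<open>0\<close>.\<close>
  define \<psi> where "\<psi> r = F (\<lambda>i\<in>I. 0) r" for r
  have z: "(\<lambda>i\<in>I. 0) \<in> space (gauss I)" by (simp add: space_gauss)
  have \<psi>[measurable]: "\<psi> \<in> borel_measurable borel"
    unfolding \<psi>_def using z by measurable
  have F: "(\<integral>\<^sup>+v. F v ((\<Sum>i\<in>I. (v i)\<^sup>2) / 2 + t) \<partial>gauss I) =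
     (\<integral>\<^sup>+w. \<integral>\<^sup>+y. \<integral>\<^sup>+x. \<psi> ((x\<^sup>2 + y\<^sup>2) / 2 + t + (\<Sum>i\<in>J. (w i)\<^sup>2) / 2) \<partial>std_normal \<partial>std_normal \<partial>gauss J)" for t
  proof -
    have upd: "(\<Sum>i\<in>I. ((w(q := y, p := x)) i)\<^sup>2) / 2 + t = (x\<^sup>2 + y\<^sup>2) / 2 + t + (\<Sum>i\<in>J. (w i)\<^sup>2) / 2"
      for w and x y :: real
    proof -
      have "(\<Sum>i\<in>J. ((w(q := y, p := x)) i)\<^sup>2) = (\<Sum>i\<in>J. (w i)\<^sup>2)"
        using J by (intro sum.cong) auto
      then show ?thesis using J by (simp add: IJ)
    qed
    have "(\<integral>\<^sup>+v. F v ((\<Sum>i\<in>I. (v i)\<^sup>2) / 2 + t) \<partial>gauss I) = (\<integral>\<^sup>+v. \<psi> ((\<Sum>i\<in>I. (v i)\<^sup>2) / 2 + t) \<partial>gauss I)"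
      unfolding \<psi>_def by (intro nn_integral_cong prems(5) z) auto
    also have "\<dots> = (\<integral>\<^sup>+w. \<integral>\<^sup>+y. \<integral>\<^sup>+x. \<psi> ((\<Sum>i\<in>I. ((w(q := y, p := x)) i)\<^sup>2) / 2 + t) \<partial>std_normal \<partial>std_normal \<partial>gauss J)"
      unfolding IJ by (rule nn_integral_gauss_insert2) (use J in auto)
    finally show ?thesis by (simp only: upd)
  qed
  have "(\<integral>\<^sup>+v. F v ((\<Sum>i\<in>I. (v i)\<^sup>2) / 2 + b) \<partial>gauss I) \<le>
     (\<integral>\<^sup>+w. ennreal (exp b) * (\<integral>\<^sup>+y. \<integral>\<^sup>+x. \<psi> ((x\<^sup>2 + y\<^sup>2) / 2 + (\<Sum>i\<in>J. (w i)\<^sup>2) / 2) \<partial>std_normal \<partial>std_normal) \<partial>gauss J)"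
    unfolding F
    by (intro nn_integral_mono std_normal_plane_shift[where \<psi>="\<lambda>r. \<psi> (r + _)"] prems) measurable
  also have "\<dots> = ennreal (exp b) * (\<integral>\<^sup>+v. F v ((\<Sum>i\<in>I. (v i)\<^sup>2) / 2) \<partial>gauss I)"
    using F[of 0] by (subst nn_integral_cmult) auto
  finally show ?case .
next
  case (Suc n ls I F)
  then obtain l0 ls0 where ls: "ls = l0 # ls0" by (cases ls) auto
  note prems = Suc.prems[unfolded ls]
  \<comment> \<open>The claim for a fixed first form, but for all remaining forms and all
    \<open>F\<close>: rotating the sample space alters these as well, so the induction along
    rotations needs them quantified.\<close>
  define P where "P l \<longleftrightarrow> (\<forall>ls (F::('i \<Rightarrow> real) \<Rightarrow> real \<Rightarrow> ennreal). length ls = length ls0 \<longrightarrow>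
      case_prod F \<in> borel_measurable (gauss I \<Otimes>\<^sub>M borel) \<longrightarrow>
      (\<forall>v w r. v \<in> space (gauss I) \<longrightarrow> w \<in> space (gauss I) \<longrightarrow>
        (\<forall>l\<in>set (l # ls). (\<Sum>i\<in>I. l i * v i) = (\<Sum>i\<in>I. l i * w i)) \<longrightarrow> F v r = F w r) \<longrightarrow>
      (\<integral>\<^sup>+v. F v ((\<Sum>i\<in>I. (v i)\<^sup>2) / 2 + b) \<partial>gauss I)
        \<le> ennreal (exp b) * (\<integral>\<^sup>+v. F v ((\<Sum>i\<in>I. (v i)\<^sup>2) / 2) \<partial>gauss I))" for l
  have fin: "finite I" by fact
  obtain e where e: "e \<in> I" using prems(2) by fastforce
  have "P l0"
  proof (rule rot_induct[where C=I and e=e])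
    fix l p q c s
    assume pq: "p \<in> I" "q \<in> I" "p \<noteq> q" and cs: "c\<^sup>2 + s\<^sup>2 = 1" "c \<ge> (0::real)" and Pl: "P l"
    show "P (rot p q c s l)"
      unfolding P_def
    proof (intro allI impI)
      fix ls and F :: "('i \<Rightarrow> real) \<Rightarrow> real \<Rightarrow> ennreal"
      assume len: "length ls = length ls0"
        and [measurable]: "case_prod F \<in> borel_measurable (gauss I \<Otimes>\<^sub>M borel)"
        and inv: "\<forall>v w r. v \<in> space (gauss I) \<longrightarrow> w \<in> space (gauss I) \<longrightarrow>
          (\<forall>l\<in>set (rot p q c s l # ls). (\<Sum>i\<in>I. l i * v i) = (\<Sum>i\<in>I. l i * w i)) \<longrightarrow> F v r = F w r"
      let ?R = "rot p q c s" and ?R' = "rot p q c (-s)"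
      note R[measurable] = measurable_rot[OF pq(1,2), of c s]
      have Rsp: "?R v \<in> space (gauss I)" if "v \<in> space (gauss I)" for v
        using measurable_space[OF R that] by (simp add: space_PiM)
      have nrm: "(\<Sum>i\<in>I. (?R v i)\<^sup>2) = (\<Sum>i\<in>I. (v i)\<^sup>2)" for v
        using rot_inner[OF fin pq cs(1), of v v] by (simp add: power2_eq_square)
      have inn: "(\<Sum>i\<in>I. ?R' l' i * v i) = (\<Sum>i\<in>I. l' i * ?R v i)" for l' v
        using rot_inner[OF fin pq cs(1), of "?R' l'" v] rot_rot[OF pq(3) cs(1), of l'] by simp
      have inn2: "(\<Sum>i\<in>I. l i * v i) = (\<Sum>i\<in>I. ?R l i * ?R v i)" for v
        using rot_inner[OF fin pq cs(1), of l v] by simp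
      have int: "(\<integral>\<^sup>+v. F v ((\<Sum>i\<in>I. (v i)\<^sup>2) / 2 + t) \<partial>gauss I) =
          (\<integral>\<^sup>+v. F (?R v) ((\<Sum>i\<in>I. (v i)\<^sup>2) / 2 + t) \<partial>gauss I)" for t
        using gauss_rot[OF fin pq cs, of "\<lambda>v. F v ((\<Sum>i\<in>I. (v i)\<^sup>2) / 2 + t)"] by (simp add: nrm)
      \<comment> \<open>After rotating the sample, the first form is \<open>l\<close> again and the
        remaining forms are pulled back by the inverse rotation \<open>?R'\<close>; the squared
        length is unchanged.\<close>
      have "(\<integral>\<^sup>+v. F (?R v) ((\<Sum>i\<in>I. (v i)\<^sup>2) / 2 + b) \<partial>gauss I)
        \<le> ennreal (exp b) * (\<integral>\<^sup>+v. F (?R v) ((\<Sum>i\<in>I. (v i)\<^sup>2) / 2) \<partial>gauss I)"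
      proof (rule Pl[unfolded P_def, rule_format, of "map ?R' ls" "\<lambda>v. F (?R v)"])
        fix v w r
        assume vw: "v \<in> space (gauss I)" "w \<in> space (gauss I)"
          and eq: "\<And>l'. l' \<in> set (l # map ?R' ls) \<Longrightarrow> (\<Sum>i\<in>I. l' i * v i) = (\<Sum>i\<in>I. l' i * w i)"
        show "F (?R v) r = F (?R w) r"
        proof (rule inv[rule_format])
          fix l' assume "l' \<in> set (?R l # ls)"
          then show "(\<Sum>i\<in>I. l' i * ?R v i) = (\<Sum>i\<in>I. l' i * ?R w i)"
            using eq[of l] eq[of "?R' l'"] by (auto simp: inn inn2)
        qed (use vw Rsp in auto)
      qed (use len in auto)
      then show "(\<integral>\<^sup>+v. F v ((\<Sum>i\<in>I. (v i)\<^sup>2) / 2 + b) \<partial>gauss I)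
        \<le> ennreal (exp b) * (\<integral>\<^sup>+v. F v ((\<Sum>i\<in>I. (v i)\<^sup>2) / 2) \<partial>gauss I)"
        using int[of b] int[of 0] by simp
    qed
  next
    fix l :: "'i \<Rightarrow> real" assume l: "\<And>i. i \<in> I - {e} \<Longrightarrow> l i = 0"
    \<comment> \<open>Here \<open>l\<close> reads only coordinate \<open>e\<close>. Fixing that
      coordinate as \<open>x\<close> removes one form and one dimension together, so the two spare
      directions survive; \<open>x\<^sup>2 / 2\<close> becomes part of the argument
      \<open>r\<close>.\<close>
    define J where "J = I - {e}"
    have IJ: "I = insert e J" and J: "finite J" "e \<notin> J" using e fin by (auto simp: J_def)
    show "P l"
      unfolding P_def
    proof (intro allI impI)
      fix ls and F :: "('i \<Rightarrow> real) \<Rightarrow> real \<Rightarrow> ennreal"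
      assume len: "length ls = length ls0"
        and F[measurable]: "case_prod F \<in> borel_measurable (gauss I \<Otimes>\<^sub>M borel)"
        and inv: "\<forall>v w r. v \<in> space (gauss I) \<longrightarrow> w \<in> space (gauss I) \<longrightarrow>
          (\<forall>l\<in>set (l # ls). (\<Sum>i\<in>I. l i * v i) = (\<Sum>i\<in>I. l i * w i)) \<longrightarrow> F v r = F w r"
      have F': "case_prod F \<in> borel_measurable (gauss (insert e J) \<Otimes>\<^sub>M borel)"
        using F IJ by simp
      have m: "(\<lambda>v. F v ((\<Sum>i\<in>I. (v i)\<^sup>2) / 2 + t)) \<in> borel_measurable (gauss (insert e J))" for t
        using F' unfolding IJ by measurable
      have upd: "(\<Sum>i\<in>I. l' i * (w(e := x)) i) = l' e * x + (\<Sum>i\<in>J. l' i * w i)" for l' w x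
      proof -
        have "(\<Sum>i\<in>J. l' i * (w(e := x)) i) = (\<Sum>i\<in>J. l' i * w i)"
          using J by (intro sum.cong) auto
        then show ?thesis using J by (simp add: IJ)
      qed
      have upd2: "(\<Sum>i\<in>I. ((w(e := x)) i)\<^sup>2) / 2 + t = (\<Sum>i\<in>J. (w i)\<^sup>2) / 2 + t + x\<^sup>2 / 2"
        for w and x t :: real
      proof -
        have "(\<Sum>i\<in>J. ((w(e := x)) i)\<^sup>2) = (\<Sum>i\<in>J. (w i)\<^sup>2)"
          using J by (intro sum.cong) auto
        then show ?thesis using J by (simp add: IJ field_simps)
      qed
      have int: "(\<integral>\<^sup>+v. F v ((\<Sum>i\<in>I. (v i)\<^sup>2) / 2 + t) \<partial>gauss I) =
         (\<integral>\<^sup>+x. \<integral>\<^sup>+w. F (w(e := x)) ((\<Sum>i\<in>J. (w i)\<^sup>2) / 2 + t + x\<^sup>2 / 2) \<partial>gauss J \<partial>std_normal)" for t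
      proof -
        have "(\<integral>\<^sup>+v. F v ((\<Sum>i\<in>I. (v i)\<^sup>2) / 2 + t) \<partial>gauss I) =
         (\<integral>\<^sup>+v. F v ((\<Sum>i\<in>I. (v i)\<^sup>2) / 2 + t) \<partial>gauss (insert e J))" by (simp only: IJ)
        also have "\<dots> = (\<integral>\<^sup>+x. \<integral>\<^sup>+w. F (w(e := x)) ((\<Sum>i\<in>I. ((w(e := x)) i)\<^sup>2) / 2 + t) \<partial>gauss J \<partial>std_normal)"
          by (rule gauss.product_nn_integral_insert_rev[OF J m])
        finally show ?thesis by (simp only: upd2)
      qed
      have meas: "(\<lambda>(w, r). F (w(e := x)) (r + x\<^sup>2 / 2)) \<in> borel_measurable (gauss J \<Otimes>\<^sub>M borel)" for x
      proof -
        have "(\<lambda>z. (fst z)(e := x)) \<in> measurable (gauss J \<Otimes>\<^sub>M borel) (gauss (insert e J))"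
          by (rule measurable_fun_upd[where J=J]) auto
        then have "(\<lambda>z. ((fst z)(e := x), snd z + x\<^sup>2 / 2)) \<in> measurable (gauss J \<Otimes>\<^sub>M borel) (gauss (insert e J) \<Otimes>\<^sub>M borel)"
          by measurable
        from measurable_comp[OF this F'] show ?thesis by (simp add: comp_def split_beta')
      qed
      have "(\<integral>\<^sup>+w. F (w(e := x)) ((\<Sum>i\<in>J. (w i)\<^sup>2) / 2 + b + x\<^sup>2 / 2) \<partial>gauss J)
        \<le> ennreal (exp b) * (\<integral>\<^sup>+w. F (w(e := x)) ((\<Sum>i\<in>J. (w i)\<^sup>2) / 2 + x\<^sup>2 / 2) \<partial>gauss J)" for x
      proof (rule Suc.hyps(1)[where F="\<lambda>w r. F (w(e := x)) (r + x\<^sup>2 / 2)" and ls=ls and I=J])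
        show "length ls + 2 \<le> card J"
          using prems(2) len J by (simp add: IJ)
        fix v w r
        assume vw: "v \<in> space (gauss J)" "w \<in> space (gauss J)"
          and eq: "\<forall>l\<in>set ls. (\<Sum>i\<in>J. l i * v i) = (\<Sum>i\<in>J. l i * w i)"
        have "(\<Sum>i\<in>J. l i * v' i) = 0" for v'
          using l by (intro sum.neutral) (auto simp: J_def)
        then show "F (v(e := x)) (r + x\<^sup>2 / 2) = F (w(e := x)) (r + x\<^sup>2 / 2)"
        proof (intro inv[rule_format])
          show "v(e := x) \<in> space (gauss I)" "w(e := x) \<in> space (gauss I)"
            using vw by (auto simp: space_gauss IJ PiE_def extensional_def)
          show "(\<Sum>i\<in>I. l' i * (v(e := x)) i) = (\<Sum>i\<in>I. l' i * (w(e := x)) i)" if "l' \<in> set (l # ls)" for l'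
            using that eq \<open>\<And>v'. (\<Sum>i\<in>J. l i * v' i) = 0\<close> by (auto simp only: upd set_simps insert_iff)
        qed
      qed (use J meas prems len Suc.hyps(2) ls in auto)
      then have "(\<integral>\<^sup>+x. \<integral>\<^sup>+w. F (w(e := x)) ((\<Sum>i\<in>J. (w i)\<^sup>2) / 2 + b + x\<^sup>2 / 2) \<partial>gauss J \<partial>std_normal) \<le>
        (\<integral>\<^sup>+x. ennreal (exp b) * (\<integral>\<^sup>+w. F (w(e := x)) ((\<Sum>i\<in>J. (w i)\<^sup>2) / 2 + x\<^sup>2 / 2) \<partial>gauss J) \<partial>std_normal)"
        by (intro nn_integral_mono)
      also have "\<dots> = ennreal (exp b) * (\<integral>\<^sup>+x. \<integral>\<^sup>+w. F (w(e := x)) ((\<Sum>i\<in>J. (w i)\<^sup>2) / 2 + x\<^sup>2 / 2) \<partial>gauss J \<partial>std_normal)"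
      proof (rule nn_integral_cmult)
        have "(\<lambda>z. (snd z)(e := fst z)) \<in> measurable (std_normal \<Otimes>\<^sub>M gauss J) (gauss (insert e J))"
          by (rule measurable_fun_upd[where J=J]) auto
        then have "(\<lambda>z. ((snd z)(e := fst z), (\<Sum>i\<in>J. (snd z i)\<^sup>2) / 2 + (fst z)\<^sup>2 / 2))
            \<in> measurable (std_normal \<Otimes>\<^sub>M gauss J) (gauss (insert e J) \<Otimes>\<^sub>M borel)"
          by measurable
        from measurable_comp[OF this F']
        have [measurable]: "(\<lambda>(x, w). F (w(e := x)) ((\<Sum>i\<in>J. (w i)\<^sup>2) / 2 + x\<^sup>2 / 2)) \<in> borel_measurable (std_normal \<Otimes>\<^sub>M gauss J)"
          by (simp add: comp_def split_beta')
        interpret sigma_finite_measure "gauss J"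
          using prob_space_gauss by (rule prob_space_imp_sigma_finite)
        show "(\<lambda>x. \<integral>\<^sup>+w. F (w(e := x)) ((\<Sum>i\<in>J. (w i)\<^sup>2) / 2 + x\<^sup>2 / 2) \<partial>gauss J) \<in> borel_measurable std_normal"
          by (rule borel_measurable_nn_integral) simp
      qed
      finally show "(\<integral>\<^sup>+v. F v ((\<Sum>i\<in>I. (v i)\<^sup>2) / 2 + b) \<partial>gauss I)
        \<le> ennreal (exp b) * (\<integral>\<^sup>+v. F v ((\<Sum>i\<in>I. (v i)\<^sup>2) / 2) \<partial>gauss I)"
        using int[of b] int[of 0] by simp
    qed
  qed (use e fin in auto)
  then show ?case
    unfolding P_def ls using prems by blast
qed


section \<open>Wishart noise\<close>

text \<open>The row set is a parameter so that two disjoint sets of rows of one Gaussian array yield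
  the independent matrices \<open>W\<close> and \<open>W'\<close>.\<close>

definition wishart :: "nat set \<Rightarrow> nat \<Rightarrow> (nat \<times> nat \<Rightarrow> real) \<Rightarrow> nat \<times> nat \<Rightarrow> real" where
  "wishart R d g = (\<lambda>(j, k)\<in>{..<d} \<times> {..<d}. (\<Sum>i\<in>R. g (i, j) * g (i, k)) / 2)"

abbreviation matrix_space :: "nat \<Rightarrow> (nat \<times> nat \<Rightarrow> real) measure" where
  "matrix_space d \<equiv> PiM ({..<d} \<times> {..<d}) (\<lambda>_. borel)"

lemma measurable_matrix:
  assumes "\<And>j k. j < d \<Longrightarrow> k < d \<Longrightarrow> (\<lambda>x. f x j k) \<in> borel_measurable M"
  shows "(\<lambda>x. \<lambda>(j, k)\<in>{..<d} \<times> {..<d}. f x j k) \<in> measurable M (matrix_space d)"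
  unfolding restrict_def split_beta'
  using assms by (intro measurable_restrict[unfolded restrict_def]) auto

lemma measurable_matrix_entry:
  assumes "A \<in> measurable M (matrix_space d)" "j < d" "k < d"
  shows "(\<lambda>x. A x (j, k)) \<in> borel_measurable M"
  using measurable_comp[OF assms(1) measurable_component_singleton[of "(j, k)"]] assms(2,3)
  by (simp add: comp_def)

lemma measurable_gauss_entry:
  assumes "p \<in> K"
  shows "(\<lambda>g. g p) \<in> borel_measurable (gauss K)"
  using measurable_component_singleton[OF assms, of "\<lambda>_. std_normal"] by simp

lemma measurable_wishart:
  assumes "R \<times> {..<d} \<subseteq> K"
  shows "wishart R d \<in> measurable (gauss K) (matrix_space d)"
  unfolding wishart_def using assms
  by (intro measurable_matrix borel_measurable_divide borel_measurable_sum borel_measurable_times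
      measurable_gauss_entry) auto

lemma rot_sum: "rot p q c s (\<lambda>j. \<Sum>i\<in>S. f i j) j = (\<Sum>i\<in>S. rot p q c s (f i) j)"
  by (simp add: rot_def sum_distrib_left sum.distrib sum_subtractf)

lemma rot_scale: "rot p q c s (\<lambda>j. a * f j) j = a * rot p q c s f j"
  by (simp add: rot_def algebra_simps)

lemma rot_scale_right: "rot p q c s (\<lambda>j. f j * a) j = rot p q c s f j * a"
  by (simp add: rot_def algebra_simps)

lemma rot_divide: "rot p q c s (\<lambda>j. f j / a) j = rot p q c s f j / a"
  by (simp add: rot_def diff_divide_distrib add_divide_distrib)

lemma rot_add: "rot p q c s (\<lambda>j. f j + h j) j = rot p q c s f j + rot p q c s h j"
  by (simp add: rot_def algebra_simps)

lemma rot_cong: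
  assumes "\<And>j. j < d \<Longrightarrow> f j = h j" "p < d" "q < d" "j < d"
  shows "rot p q c s f j = rot p q c s h j"
  using assms by (simp add: rot_def)

definition rot_rows ::
    "nat set \<Rightarrow> nat \<Rightarrow> nat \<Rightarrow> real \<Rightarrow> real \<Rightarrow> (nat \<times> nat \<Rightarrow> real) \<Rightarrow> nat \<times> nat \<Rightarrow> real" where
  "rot_rows S p q c s g = (\<lambda>(i, j). if i \<in> S then rot p q c s (\<lambda>j. g (i, j)) j else g (i, j))"

definition rot_matrix ::
    "nat \<Rightarrow> nat \<Rightarrow> nat \<Rightarrow> real \<Rightarrow> real \<Rightarrow> (nat \<times> nat \<Rightarrow> real) \<Rightarrow> nat \<times> nat \<Rightarrow> real" where
  "rot_matrix d p q c s A =
    (\<lambda>(j, k)\<in>{..<d} \<times> {..<d}. rot p q c s (\<lambda>j. rot p q c s (\<lambda>k. A (j, k)) k) j)"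

text \<open>Rows are rotated one at a time. Measurability is carried through the same induction
  because invariance under the next rotation presupposes it.\<close>

lemma gauss_rot_rows:
  assumes "finite S" "finite K" "S \<times> {p, q} \<subseteq> K" "p \<noteq> q" "c\<^sup>2 + s\<^sup>2 = 1" "c \<ge> 0"
    and F: "F \<in> borel_measurable (gauss K)"
  shows "(\<integral>\<^sup>+g. F (rot_rows S p q c s g) \<partial>gauss K) = integral\<^sup>N (gauss K) F"
    "(\<lambda>g. F (rot_rows S p q c s g)) \<in> borel_measurable (gauss K)"
proof -
  have "(\<integral>\<^sup>+g. F (rot_rows S p q c s g) \<partial>gauss K) = integral\<^sup>N (gauss K) F \<and>
    (\<lambda>g. F (rot_rows S p q c s g)) \<in> borel_measurable (gauss K)"
    using assms(1,3)
  proof (induction S)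
    case empty
    have "rot_rows {} p q c s = (\<lambda>g. g)" by (auto simp: rot_rows_def fun_eq_iff)
    then show ?case using F by simp
  next
    case (insert r S)
    then have sub: "(r, p) \<in> K" "(r, q) \<in> K" and ne: "(r, p) \<noteq> (r, q)"
      using assms(4) by auto
    have *: "rot_rows (insert r S) p q c s g = rot_rows S p q c s (rot (r, p) (r, q) c s g)" for g
      using insert.hyps assms(4) by (auto simp: rot_rows_def rot_def fun_eq_iff)
    have m: "(\<lambda>g. F (rot_rows S p q c s g)) \<in> borel_measurable (gauss K)"
      using insert by auto
    have "rot (r, p) (r, q) c s \<in> measurable (gauss K) (gauss K)"
      using measurable_rot[OF sub, of c s] measurable_cong_sets[OF refl sets_gauss] by blast
    from measurable_comp[OF this m]
    have "(\<lambda>g. F (rot_rows (insert r S) p q c s g)) \<in> borel_measurable (gauss K)"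
      by (simp add: * comp_def)
    moreover have "(\<integral>\<^sup>+g. F (rot_rows (insert r S) p q c s g) \<partial>gauss K) = integral\<^sup>N (gauss K) F"
      using gauss_rot[OF assms(2) sub ne assms(5,6) m] insert by (simp add: *)
    ultimately show ?case by blast
  qed
  then show "(\<integral>\<^sup>+g. F (rot_rows S p q c s g) \<partial>gauss K) = integral\<^sup>N (gauss K) F"
    "(\<lambda>g. F (rot_rows S p q c s g)) \<in> borel_measurable (gauss K)" by auto
qed

text \<open>With the rows as a matrix \<open>G\<close>, rotating every row turns
  \<open>G^T G\<close> into its conjugate \<open>O G^T G O^T\<close>. Thus conjugation by a rotation
  leaves the distribution of the matrix unchanged.\<close>

lemma wishart_rot_rows:
  assumes "p < d" "q < d"
  shows "wishart R d (rot_rows R p q c s g) = rot_matrix d p q c s (wishart R d g)"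
proof (rule ext)
  fix x :: "nat \<times> nat"
  obtain j k where x: "x = (j, k)" by (cases x)
  show "wishart R d (rot_rows R p q c s g) x = rot_matrix d p q c s (wishart R d g) x"
  proof (cases "j < d \<and> k < d")
    case True
    let ?r = "rot p q c s"
    have "rot_matrix d p q c s (wishart R d g) (j, k) =
       ?r (\<lambda>j. ?r (\<lambda>k. \<Sum>i\<in>R. (g (i, j) / 2) * g (i, k)) k) j"
      using True assms unfolding rot_matrix_def wishart_def
      by (auto intro!: rot_cong[of d] simp: sum_divide_distrib)
    also have "\<dots> = (\<Sum>i\<in>R. ?r (\<lambda>j. (g (i, j) / 2) * ?r (\<lambda>k. g (i, k)) k) j)"
      by (simp only: rot_sum rot_scale)
    also have "\<dots> = (\<Sum>i\<in>R. ?r (\<lambda>j. g (i, j)) j * ?r (\<lambda>k. g (i, k)) k) / 2"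
      by (simp only: rot_scale_right) (simp add: rot_divide sum_divide_distrib)
    also have "\<dots> = wishart R d (rot_rows R p q c s g) (j, k)"
      using True by (simp add: wishart_def rot_rows_def)
    finally show ?thesis by (simp add: x)
  qed (auto simp: x wishart_def rot_matrix_def)
qed

lemma measurable_rot_matrix:
  assumes "p < d" "q < d"
  shows "rot_matrix d p q c s \<in> measurable (matrix_space d) (matrix_space d)"
proof -
  have e[measurable]: "(\<lambda>A. A (j, k)) \<in> borel_measurable (matrix_space d)" if "j < d" "k < d" for j k
    using that by (intro measurable_matrix_entry) auto
  show ?thesis
    unfolding rot_matrix_def rot_def using assms by (intro measurable_matrix) (auto simp: fun_upd_def)
qed

text \<open>Only the \<open>(0, 0)\<close> entry changes. It is half the squared length of the first column of \<open>g\<close>,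
  which enters the other entries only through its inner products with the other \<open>d - 1\<close> columns.\<close>

lemma wishart_shift_first:
  assumes R: "finite R" "card R > d" and d: "d > 0"
    and b: "\<And>j. j \<in> {..<d} - {0} \<Longrightarrow> b j = 0"
    and \<phi>: "\<phi> \<in> borel_measurable (matrix_space d)"
  shows "(\<integral>\<^sup>+g. \<phi> (\<lambda>(j, k)\<in>{..<d} \<times> {..<d}. wishart R d g (j, k) + b j * b k) \<partial>gauss (R \<times> {..<d}))
    \<le> ennreal (exp ((b 0)\<^sup>2)) * (\<integral>\<^sup>+g. \<phi> (wishart R d g) \<partial>gauss (R \<times> {..<d}))"
proof -
  define I where "I = R \<times> {1..<d}"
  define J where "J = R \<times> {0::nat}"
  have IJ: "R \<times> {..<d} = I \<union> J" "I \<inter> J = {}" "finite I" "finite J"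
    using R d by (auto simp: I_def J_def)
  have sumJ: "sum f J = (\<Sum>i\<in>R. f (i, 0))" for f :: "nat \<times> nat \<Rightarrow> real"
  proof -
    have "J = (\<lambda>i. (i, 0)) ` R" by (auto simp: J_def)
    then show ?thesis by (simp add: sum.reindex inj_on_def)
  qed
  \<comment> \<open>The corner entry is made the free argument \<open>r\<close>, so that
    \<open>gauss_half_norm_shift\<close> can be applied with the first column \<open>v\<close>
    random and the other columns \<open>w\<close> fixed.\<close>
  define A where "A w v r = (\<lambda>(j, k)\<in>{..<d} \<times> {..<d}. if j = 0 \<and> k = 0 then r
      else (\<Sum>i\<in>R. merge I J (w, v) (i, j) * merge I J (w, v) (i, k)) / 2)" for w v and r :: real
  have m1: "(\<lambda>g. \<phi> (\<lambda>(j, k)\<in>{..<d} \<times> {..<d}. wishart R d g (j, k) + b j * b k)) \<in> borel_measurable (gauss (I \<union> J))"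
  proof (rule measurable_compose[OF _ \<phi>], rule measurable_matrix)
    show "(\<lambda>g. wishart R d g (j, k) + b j * b k) \<in> borel_measurable (gauss (I \<union> J))" if "j < d" "k < d" for j k
      using that IJ by (intro borel_measurable_add measurable_matrix_entry[OF measurable_wishart]) auto
  qed
  have m2: "(\<lambda>g. \<phi> (wishart R d g)) \<in> borel_measurable (gauss (I \<union> J))"
    using IJ by (intro measurable_compose[OF _ \<phi>] measurable_wishart) auto
  have mrg: "merge I J (w, v) (i, j) = (if j = 0 then v (i, 0) else w (i, j))" if "i \<in> R" "j < d" for w v i j
    using that by (auto simp: merge_def I_def J_def)
  have e1: "(\<lambda>(j, k)\<in>{..<d} \<times> {..<d}. wishart R d (merge I J (w, v)) (j, k) + b j * b k) =
     A w v ((\<Sum>x\<in>J. (v x)\<^sup>2) / 2 + (b 0)\<^sup>2)" for w v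
    using b d by (auto simp: fun_eq_iff A_def wishart_def sumJ mrg power2_eq_square)
  have e2: "wishart R d (merge I J (w, v)) = A w v ((\<Sum>x\<in>J. (v x)\<^sup>2) / 2)" for w v
    using d by (auto simp: fun_eq_iff A_def wishart_def sumJ mrg power2_eq_square)
  have "(\<integral>\<^sup>+v. \<phi> (A w v ((\<Sum>x\<in>J. (v x)\<^sup>2) / 2 + (b 0)\<^sup>2)) \<partial>gauss J)
      \<le> ennreal (exp ((b 0)\<^sup>2)) * (\<integral>\<^sup>+v. \<phi> (A w v ((\<Sum>x\<in>J. (v x)\<^sup>2) / 2)) \<partial>gauss J)"
    if w: "w \<in> space (gauss I)" for w
  proof (rule gauss_half_norm_shift[where ls="map (\<lambda>j (i, _). w (i, j)) [1..<d]" and F="\<lambda>v r. \<phi> (A w v r)"])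
    \<comment> \<open>The count that fixes the degrees of freedom: \<open>d - 1\<close> linear forms
      on a column with at least \<open>d + 1\<close> entries.\<close>
    show "length (map (\<lambda>j (i, _). w (i, j)) [1..<d]) + 2 \<le> card J"
      using R d by (simp add: J_def)
    have "(\<lambda>z. \<phi> (A w (fst z) (snd z))) \<in> borel_measurable (gauss J \<Otimes>\<^sub>M borel)"
    proof (rule measurable_compose[OF _ \<phi>], unfold A_def, rule measurable_matrix)
      fix j k assume jk: "j < d" "k < d"
      have "(\<lambda>z. merge I J (w, fst z) (i, j)) \<in> borel_measurable (gauss J \<Otimes>\<^sub>M borel)" if "i \<in> R" "j < d" for i j
        unfolding mrg[OF that] using that
        by (cases "j = 0") (auto simp: J_def intro!: measurable_compose[OF measurable_fst measurable_gauss_entry])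
      then show "(\<lambda>z. if j = 0 \<and> k = 0 then snd z else (\<Sum>i\<in>R. merge I J (w, fst z) (i, j) * merge I J (w, fst z) (i, k)) / 2)
          \<in> borel_measurable (gauss J \<Otimes>\<^sub>M borel)"
        using jk by (cases "j = 0 \<and> k = 0") (auto intro!: borel_measurable_sum borel_measurable_times borel_measurable_divide)
    qed
    then show "(\<lambda>(v, r). \<phi> (A w v r)) \<in> borel_measurable (gauss J \<Otimes>\<^sub>M borel)"
      by (simp add: split_beta')
    fix v v' :: "nat \<times> nat \<Rightarrow> real" and r :: real
    assume eq: "\<forall>l\<in>set (map (\<lambda>j (i, _). w (i, j)) [1..<d]). (\<Sum>x\<in>J. l x * v x) = (\<Sum>x\<in>J. l x * v' x)"
    then have eq': "(\<Sum>i\<in>R. w (i, j) * v (i, 0)) = (\<Sum>i\<in>R. w (i, j) * v' (i, 0))" if "0 < j" "j < d" for j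
      using that by (auto simp: sumJ)
    have "A w v r = A w v' r"
    proof (rule ext)
      fix x :: "nat \<times> nat"
      obtain j k where x: "x = (j, k)" by (cases x)
      show "A w v r x = A w v' r x"
        using eq'[of j] eq'[of k]
        by (cases "j = 0"; cases "k = 0") (auto simp: x A_def mrg mult.commute)
    qed
    then show "\<phi> (A w v r) = \<phi> (A w v' r)" by simp
  qed (use IJ in auto)
  then have "(\<integral>\<^sup>+w. \<integral>\<^sup>+v. \<phi> (A w v ((\<Sum>x\<in>J. (v x)\<^sup>2) / 2 + (b 0)\<^sup>2)) \<partial>gauss J \<partial>gauss I) \<le>
    (\<integral>\<^sup>+w. ennreal (exp ((b 0)\<^sup>2)) * (\<integral>\<^sup>+v. \<phi> (A w v ((\<Sum>x\<in>J. (v x)\<^sup>2) / 2)) \<partial>gauss J) \<partial>gauss I)"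
    by (intro nn_integral_mono)
  also have "\<dots> = ennreal (exp ((b 0)\<^sup>2)) * (\<integral>\<^sup>+w. \<integral>\<^sup>+v. \<phi> (A w v ((\<Sum>x\<in>J. (v x)\<^sup>2) / 2)) \<partial>gauss J \<partial>gauss I)"
  proof (rule nn_integral_cmult)
    interpret sigma_finite_measure "gauss J"
      using prob_space_gauss by (rule prob_space_imp_sigma_finite)
    show "(\<lambda>w. \<integral>\<^sup>+v. \<phi> (A w v ((\<Sum>x\<in>J. (v x)\<^sup>2) / 2)) \<partial>gauss J) \<in> borel_measurable (gauss I)"
      unfolding e2[symmetric]
      using measurable_comp[OF measurable_merge m2]
      by (intro borel_measurable_nn_integral) (simp add: comp_def split_beta')
  qed
  finally show ?thesis
    unfolding IJ(1) gauss.product_nn_integral_fold[OF IJ(2-4) m1] gauss.product_nn_integral_fold[OF IJ(2-4) m2]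
    unfolding e1 unfolding e2 .
qed

lemma wishart_shift:
  assumes R: "finite R" "card R > d" and d: "d > 0" and \<phi>: "\<phi> \<in> borel_measurable (matrix_space d)"
  shows "(\<integral>\<^sup>+g. \<phi> (\<lambda>(j, k)\<in>{..<d} \<times> {..<d}. wishart R d g (j, k) + b j * b k) \<partial>gauss (R \<times> {..<d}))
    \<le> ennreal (exp (\<Sum>j<d. (b j)\<^sup>2)) * (\<integral>\<^sup>+g. \<phi> (wishart R d g) \<partial>gauss (R \<times> {..<d}))"
proof -
  let ?K = "R \<times> {..<d}"
  \<comment> \<open>All test functions at once, since a rotation step replaces \<open>\<phi>\<close>
    by its composition with a conjugation.\<close>
  define P where "P b \<longleftrightarrow> (\<forall>\<phi>\<in>borel_measurable (matrix_space d).
     (\<integral>\<^sup>+g. \<phi> (\<lambda>(j, k)\<in>{..<d} \<times> {..<d}. wishart R d g (j, k) + b j * b k) \<partial>gauss ?K)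
      \<le> ennreal (exp (\<Sum>j<d. (b j)\<^sup>2)) * (\<integral>\<^sup>+g. \<phi> (wishart R d g) \<partial>gauss ?K))" for b
  have "P b"
  proof (rule rot_induct[where C="{..<d}" and e=0])
    fix b p q c s
    assume "p \<in> {..<d}" "q \<in> {..<d}" and pq: "p \<noteq> q" and cs: "c\<^sup>2 + s\<^sup>2 = 1" "c \<ge> (0::real)" and Pb: "P b"
    then have pqd: "p < d" "q < d" by auto
    let ?r = "rot p q c s" and ?O = "rot_matrix d p q c s"
    show "P (?r b)"
      unfolding P_def
    proof (rule ballI)
      fix \<phi> :: "(nat \<times> nat \<Rightarrow> real) \<Rightarrow> ennreal" assume \<phi>: "\<phi> \<in> borel_measurable (matrix_space d)"
      have \<phi>O: "(\<lambda>A. \<phi> (?O A)) \<in> borel_measurable (matrix_space d)"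
        by (rule measurable_compose[OF measurable_rot_matrix[OF pqd] \<phi>])
      have m1: "(\<lambda>g. \<phi> (\<lambda>(j, k)\<in>{..<d} \<times> {..<d}. wishart R d g (j, k) + ?r b j * ?r b k)) \<in> borel_measurable (gauss ?K)"
      proof (rule measurable_compose[OF _ \<phi>], rule measurable_matrix)
        show "(\<lambda>g. wishart R d g (j, k) + ?r b j * ?r b k) \<in> borel_measurable (gauss ?K)" if "j < d" "k < d" for j k
          using that by (intro borel_measurable_add measurable_matrix_entry[OF measurable_wishart]) auto
      qed
      have m2: "(\<lambda>g. \<phi> (wishart R d g)) \<in> borel_measurable (gauss ?K)"
        by (intro measurable_compose[OF _ \<phi>] measurable_wishart) auto
      note rr = gauss_rot_rows(1)[OF R(1) _ _ pq cs]
      have eq: "(\<lambda>(j, k)\<in>{..<d} \<times> {..<d}. wishart R d (rot_rows R p q c s g) (j, k) + ?r b j * ?r b k)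
         = ?O (\<lambda>(j, k)\<in>{..<d} \<times> {..<d}. wishart R d g (j, k) + b j * b k)" for g
      proof (rule ext)
        fix x :: "nat \<times> nat"
        obtain j k where x: "x = (j, k)" by (cases x)
        have "?O (\<lambda>(j, k)\<in>{..<d} \<times> {..<d}. wishart R d g (j, k) + b j * b k) (j, k) =
            ?r (\<lambda>j. ?r (\<lambda>k. wishart R d g (j, k) + b j * b k) k) j" if "j < d" "k < d"
          using that pqd unfolding rot_matrix_def by (auto intro!: rot_cong[of d])
        also have "?r (\<lambda>j. ?r (\<lambda>k. wishart R d g (j, k) + b j * b k) k) j =
            ?r (\<lambda>j. ?r (\<lambda>k. wishart R d g (j, k)) k) j + ?r b j * ?r b k"
          by (simp only: rot_add rot_scale rot_scale_right)
        finally show "(\<lambda>(j, k)\<in>{..<d} \<times> {..<d}. wishart R d (rot_rows R p q c s g) (j, k) + ?r b j * ?r b k) x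
          = ?O (\<lambda>(j, k)\<in>{..<d} \<times> {..<d}. wishart R d g (j, k) + b j * b k) x"
          by (auto simp: x wishart_rot_rows[OF pqd]) (auto simp: rot_matrix_def)
      qed
      have "(\<integral>\<^sup>+g. \<phi> (\<lambda>(j, k)\<in>{..<d} \<times> {..<d}. wishart R d g (j, k) + ?r b j * ?r b k) \<partial>gauss ?K) =
         (\<integral>\<^sup>+g. \<phi> (?O (\<lambda>(j, k)\<in>{..<d} \<times> {..<d}. wishart R d g (j, k) + b j * b k)) \<partial>gauss ?K)"
        by (subst rr[OF _ _ m1, symmetric]) (use R pqd eq in auto)
      also have "\<dots> \<le> ennreal (exp (\<Sum>j<d. (b j)\<^sup>2)) * (\<integral>\<^sup>+g. \<phi> (?O (wishart R d g)) \<partial>gauss ?K)"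
        using Pb \<phi>O by (auto simp: P_def)
      also have "(\<integral>\<^sup>+g. \<phi> (?O (wishart R d g)) \<partial>gauss ?K) = (\<integral>\<^sup>+g. \<phi> (wishart R d g) \<partial>gauss ?K)"
        by (subst rr[OF _ _ m2, symmetric]) (use R pqd in \<open>auto simp: wishart_rot_rows\<close>)
      also have "(\<Sum>j<d. (b j)\<^sup>2) = (\<Sum>j<d. (?r b j)\<^sup>2)"
        using rot_inner[of "{..<d}" p q c s b b] pqd pq cs by (simp add: power2_eq_square)
      finally show "(\<integral>\<^sup>+g. \<phi> (\<lambda>(j, k)\<in>{..<d} \<times> {..<d}. wishart R d g (j, k) + ?r b j * ?r b k) \<partial>gauss ?K)
        \<le> ennreal (exp (\<Sum>j<d. (?r b j)\<^sup>2)) * (\<integral>\<^sup>+g. \<phi> (wishart R d g) \<partial>gauss ?K)" .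
    qed
  next
    fix b assume b: "\<And>j. j \<in> {..<d} - {0::nat} \<Longrightarrow> b j = (0::real)"
    have "(\<Sum>j<d. (b j)\<^sup>2) = (\<Sum>j\<in>{0}. (b j)\<^sup>2)"
      using b d by (intro sum.mono_neutral_right) auto
    then show "P b"
      unfolding P_def using wishart_shift_first[of R d b, OF R d b] by simp
  qed (use d in auto)
  then show ?thesis using \<phi> by (auto simp: P_def)
qed

text \<open>The two matrices use disjoint rows and are therefore independent, so the bound for one
  matrix applies for every fixed value of the other.\<close>

lemma wishart_pair_shift:
  assumes R: "finite R" "card R > d" "finite R'" "R \<inter> R' = {}" and d: "d > 0"
    and \<Psi>: "case_prod \<Psi> \<in> borel_measurable (matrix_space d \<Otimes>\<^sub>M matrix_space d)"
  shows "(\<integral>\<^sup>+g. \<Psi> (wishart R' d g) (\<lambda>(j, k)\<in>{..<d} \<times> {..<d}. wishart R d g (j, k) + b j * b k) \<partial>gauss ((R' \<union> R) \<times> {..<d}))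
    \<le> ennreal (exp (\<Sum>j<d. (b j)\<^sup>2)) * (\<integral>\<^sup>+g. \<Psi> (wishart R' d g) (wishart R d g) \<partial>gauss ((R' \<union> R) \<times> {..<d}))"
proof -
  define I where "I = R' \<times> {..<d}"
  define J where "J = R \<times> {..<d}"
  have IJ: "(R' \<union> R) \<times> {..<d} = I \<union> J" "I \<inter> J = {}" "finite I" "finite J"
    using R by (auto simp: I_def J_def)
  let ?B = "\<lambda>V. \<lambda>(j, k)\<in>{..<d} \<times> {..<d}. V (j, k) + b j * b k"
  have W: "wishart R' d \<in> measurable (gauss (I \<union> J)) (matrix_space d)"
    "wishart R d \<in> measurable (gauss (I \<union> J)) (matrix_space d)"
    by (rule measurable_wishart, auto simp: I_def J_def)+
  have B: "?B \<in> measurable (matrix_space d) (matrix_space d)"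
    by (intro measurable_matrix borel_measurable_add measurable_matrix_entry[OF measurable_ident_sets[OF refl]] borel_measurable_const)
  have m1: "(\<lambda>g. \<Psi> (wishart R' d g) (?B (wishart R d g))) \<in> borel_measurable (gauss (I \<union> J))"
    using measurable_compose[OF measurable_Pair[OF W(1) measurable_compose[OF W(2) B]] \<Psi>] by simp
  have m2: "(\<lambda>g. \<Psi> (wishart R' d g) (wishart R d g)) \<in> borel_measurable (gauss (I \<union> J))"
    using measurable_compose[OF measurable_Pair[OF W] \<Psi>] by simp
  have w1: "wishart R' d (merge I J (w, v)) = wishart R' d w" for w v
    by (auto simp: wishart_def fun_eq_iff merge_def I_def intro!: sum.cong)
  have w2: "wishart R d (merge I J (w, v)) = wishart R d v" for w v
    using R by (auto simp: wishart_def fun_eq_iff merge_def I_def J_def intro!: sum.cong)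
  have "(\<integral>\<^sup>+v. \<Psi> (wishart R' d w) (?B (wishart R d v)) \<partial>gauss J)
      \<le> ennreal (exp (\<Sum>j<d. (b j)\<^sup>2)) * (\<integral>\<^sup>+v. \<Psi> (wishart R' d w) (wishart R d v) \<partial>gauss J)"
    if w: "w \<in> space (gauss I)" for w
    unfolding J_def
  proof (rule wishart_shift[OF R(1,2) d])
    have "wishart R' d w \<in> space (matrix_space d)"
      by (auto simp: wishart_def space_PiM)
    then show "\<Psi> (wishart R' d w) \<in> borel_measurable (matrix_space d)"
      using measurable_compose[OF measurable_Pair1' \<Psi>] by simp
  qed
  then have "(\<integral>\<^sup>+w. \<integral>\<^sup>+v. \<Psi> (wishart R' d w) (?B (wishart R d v)) \<partial>gauss J \<partial>gauss I) \<le>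
      (\<integral>\<^sup>+w. ennreal (exp (\<Sum>j<d. (b j)\<^sup>2)) * (\<integral>\<^sup>+v. \<Psi> (wishart R' d w) (wishart R d v) \<partial>gauss J) \<partial>gauss I)"
    by (intro nn_integral_mono)
  also have "\<dots> = ennreal (exp (\<Sum>j<d. (b j)\<^sup>2)) *
      (\<integral>\<^sup>+w. \<integral>\<^sup>+v. \<Psi> (wishart R' d w) (wishart R d v) \<partial>gauss J \<partial>gauss I)"
  proof (rule nn_integral_cmult)
    interpret sigma_finite_measure "gauss J"
      using prob_space_gauss by (rule prob_space_imp_sigma_finite)
    have "wishart R' d \<in> measurable (gauss I) (matrix_space d)" "wishart R d \<in> measurable (gauss J) (matrix_space d)"
      by (auto simp: I_def J_def intro: measurable_wishart)
    from measurable_compose[OF measurable_Pair[OF measurable_compose[OF measurable_fst this(1)]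
        measurable_compose[OF measurable_snd this(2)]] \<Psi>]
    show "(\<lambda>w. \<integral>\<^sup>+v. \<Psi> (wishart R' d w) (wishart R d v) \<partial>gauss J) \<in> borel_measurable (gauss I)"
      by (intro borel_measurable_nn_integral) (simp add: case_prod_unfold)
  qed
  finally show ?thesis
    unfolding IJ(1) gauss.product_nn_integral_fold[OF IJ(2-4) m1] gauss.product_nn_integral_fold[OF IJ(2-4) m2]
    unfolding w1 w2 .
qed

section \<open>The noisy matrix and the privacy cost of a rank one change\<close>

definition noisy :: "nat set \<Rightarrow> nat set \<Rightarrow> nat \<Rightarrow> real \<Rightarrow> (nat \<Rightarrow> nat \<Rightarrow> real) \<Rightarrow> (nat \<times> nat \<Rightarrow> real) \<Rightarrow> nat \<times> nat \<Rightarrow> real" where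
  "noisy R R' d t Q g = (\<lambda>(j, k)\<in>{..<d} \<times> {..<d}. Q j k + t * (wishart R d g (j, k) - wishart R' d g (j, k)))"

lemma measurable_noisy:
  assumes "(R \<union> R') \<times> {..<d} \<subseteq> K"
  shows "noisy R R' d t Q \<in> measurable (gauss K) (matrix_space d)"
  unfolding noisy_def using assms
  by (intro measurable_matrix borel_measurable_add borel_measurable_times borel_measurable_diff
      measurable_matrix_entry[OF measurable_wishart] measurable_const) auto

text \<open>Adding \<open>b b^T\<close> to \<open>Q\<close> is the shift of \<open>W\<close> by
  \<open>b b^T / t\<close>. Conversely the noisy version of \<open>Q\<close> is that of
  \<open>Q + b b^T\<close> with the same shift applied to \<open>W'\<close>, so the second
  inequality follows with the roles of \<open>R\<close> and \<open>R'\<close> exchanged.\<close>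

lemma noisy_rank_one:
  assumes R: "finite R" "card R > d" "finite R'" "card R' > d" "R \<inter> R' = {}" and d: "d > 0" and t: "t > 0"
    and \<phi>: "\<phi> \<in> borel_measurable (matrix_space d)"
  shows "(\<integral>\<^sup>+g. \<phi> (noisy R R' d t (\<lambda>j k. Q j k + b j * b k) g) \<partial>gauss ((R \<union> R') \<times> {..<d}))
      \<le> ennreal (exp ((\<Sum>j<d. (b j)\<^sup>2) / t)) * (\<integral>\<^sup>+g. \<phi> (noisy R R' d t Q g) \<partial>gauss ((R \<union> R') \<times> {..<d}))"
    and "(\<integral>\<^sup>+g. \<phi> (noisy R R' d t Q g) \<partial>gauss ((R \<union> R') \<times> {..<d}))
      \<le> ennreal (exp ((\<Sum>j<d. (b j)\<^sup>2) / t)) * (\<integral>\<^sup>+g. \<phi> (noisy R R' d t (\<lambda>j k. Q j k + b j * b k) g) \<partial>gauss ((R \<union> R') \<times> {..<d}))"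
proof -
  define b' where "b' j = b j / sqrt t" for j
  have b': "t * (b' j * b' k) = b j * b k" for j k
    using t by (simp add: b'_def)
  have nb: "(\<Sum>j<d. (b' j)\<^sup>2) = (\<Sum>j<d. (b j)\<^sup>2) / t"
    using t by (simp add: b'_def power_divide sum_divide_distrib)
  have e: "(\<lambda>z. \<lambda>(j, k)\<in>{..<d} \<times> {..<d}. P j k + t * (snd z (j, k) - fst z (j, k)))
      \<in> measurable (matrix_space d \<Otimes>\<^sub>M matrix_space d) (matrix_space d)"
    "(\<lambda>z. \<lambda>(j, k)\<in>{..<d} \<times> {..<d}. P j k + t * (fst z (j, k) - snd z (j, k)))
      \<in> measurable (matrix_space d \<Otimes>\<^sub>M matrix_space d) (matrix_space d)" for P
    by (intro measurable_matrix borel_measurable_add borel_measurable_times borel_measurable_diff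
        borel_measurable_const measurable_matrix_entry[OF measurable_snd] measurable_matrix_entry[OF measurable_fst]; assumption)+
  have meas: "(\<lambda>(U, V). \<phi> (\<lambda>(j, k)\<in>{..<d} \<times> {..<d}. P j k + t * (V (j, k) - U (j, k)))) \<in>
      borel_measurable (matrix_space d \<Otimes>\<^sub>M matrix_space d)"
    "(\<lambda>(U, V). \<phi> (\<lambda>(j, k)\<in>{..<d} \<times> {..<d}. P j k + t * (U (j, k) - V (j, k)))) \<in>
      borel_measurable (matrix_space d \<Otimes>\<^sub>M matrix_space d)" for P
    using measurable_compose[OF e(1) \<phi>] measurable_compose[OF e(2) \<phi>] by (simp_all add: case_prod_unfold)
  have c: "R' \<union> R = R \<union> R'" "R' \<inter> R = {}" using R by auto
  show "(\<integral>\<^sup>+g. \<phi> (noisy R R' d t (\<lambda>j k. Q j k + b j * b k) g) \<partial>gauss ((R \<union> R') \<times> {..<d}))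
      \<le> ennreal (exp ((\<Sum>j<d. (b j)\<^sup>2) / t)) * (\<integral>\<^sup>+g. \<phi> (noisy R R' d t Q g) \<partial>gauss ((R \<union> R') \<times> {..<d}))"
  proof -
    have "noisy R R' d t (\<lambda>j k. Q j k + b j * b k) g = (\<lambda>(j, k)\<in>{..<d} \<times> {..<d}. Q j k + t *
        ((\<lambda>(j, k)\<in>{..<d} \<times> {..<d}. wishart R d g (j, k) + b' j * b' k) (j, k) - wishart R' d g (j, k)))" for g
      by (auto simp: noisy_def fun_eq_iff algebra_simps simp flip: b')
    then show ?thesis
      using wishart_pair_shift[OF R(1,2,3,5) d meas(1)[of Q], of b'] unfolding nb c by (simp add: noisy_def)
  qed
  show "(\<integral>\<^sup>+g. \<phi> (noisy R R' d t Q g) \<partial>gauss ((R \<union> R') \<times> {..<d}))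
      \<le> ennreal (exp ((\<Sum>j<d. (b j)\<^sup>2) / t)) * (\<integral>\<^sup>+g. \<phi> (noisy R R' d t (\<lambda>j k. Q j k + b j * b k) g) \<partial>gauss ((R \<union> R') \<times> {..<d}))"
  proof -
    have "noisy R R' d t Q g = (\<lambda>(j, k)\<in>{..<d} \<times> {..<d}. Q j k + b j * b k + t * (wishart R d g (j, k) -
        (\<lambda>(j, k)\<in>{..<d} \<times> {..<d}. wishart R' d g (j, k) + b' j * b' k) (j, k)))" for g
      by (auto simp: noisy_def fun_eq_iff algebra_simps simp flip: b')
    then show ?thesis
      using wishart_pair_shift[OF R(3,4,1) c(2) d meas(2)[of "\<lambda>j k. Q j k + b j * b k"], of b']
      unfolding nb by (simp add: noisy_def)
  qed
qed

section \<open>Mean operator norm of a Wishart matrix\<close>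

definition wishart_form :: "nat set \<Rightarrow> nat \<Rightarrow> (nat \<times> nat \<Rightarrow> real) \<Rightarrow> (nat \<Rightarrow> real) \<Rightarrow> real" where
  "wishart_form R d g u = (\<Sum>i\<in>R. (\<Sum>j<d. u j * g (i, j))\<^sup>2) / 2"

lemma measurable_wishart_form:
  assumes "R \<times> {..<d} \<subseteq> K"
  shows "(\<lambda>g. wishart_form R d g u) \<in> borel_measurable (gauss K)"
  unfolding wishart_form_def using assms
  by (intro borel_measurable_divide borel_measurable_sum borel_measurable_times borel_measurable_power
      measurable_gauss_entry) auto

text \<open>By rotation invariance \<open>u\<close> may be replaced by \<open>|u|\<close> times the
  first coordinate vector, so the form is \<open>|u|\<^sup>2 / 2\<close> times a chi-square variable
  with one degree of freedom per row.\<close>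

lemma wishart_form_distr:
  assumes R: "finite R" "finite K" "R \<times> {..<d} \<subseteq> K" and d: "d > 0"
    and \<psi>: "\<psi> \<in> borel_measurable borel"
  shows "(\<integral>\<^sup>+g. \<psi> (wishart_form R d g u) \<partial>gauss K)
    = (\<integral>\<^sup>+g. \<psi> ((\<Sum>j<d. (u j)\<^sup>2) * (\<Sum>i\<in>R. (g (i, 0))\<^sup>2) / 2) \<partial>gauss K)"
proof -
  define P where "P u \<longleftrightarrow> (\<integral>\<^sup>+g. \<psi> (wishart_form R d g u) \<partial>gauss K)
    = (\<integral>\<^sup>+g. \<psi> ((\<Sum>j<d. (u j)\<^sup>2) * (\<Sum>i\<in>R. (g (i, 0))\<^sup>2) / 2) \<partial>gauss K)" for u
  have "P u"
  proof (rule rot_induct[where C="{..<d}" and e=0])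
    fix u p q c s
    assume pq: "p \<in> {..<d}" "q \<in> {..<d}" "p \<noteq> q" and cs: "c\<^sup>2 + s\<^sup>2 = 1" "c \<ge> (0::real)" and P: "P u"
    have "wishart_form R d (rot_rows R p q c s g) (rot p q c s u) = wishart_form R d g u" for g
      unfolding wishart_form_def
      using rot_inner[OF _ pq cs(1), of u "\<lambda>j. g (_, j)"] by (simp add: rot_rows_def)
    moreover have "R \<times> {p, q} \<subseteq> K" using R(3) pq by auto
    ultimately have "(\<integral>\<^sup>+g. \<psi> (wishart_form R d g (rot p q c s u)) \<partial>gauss K) = (\<integral>\<^sup>+g. \<psi> (wishart_form R d g u) \<partial>gauss K)"
      using gauss_rot_rows(1)[OF R(1,2) _ pq(3) cs measurable_compose[OF measurable_wishart_form[OF R(3)] \<psi>], of "rot p q c s u"]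
      by simp
    moreover have "(\<Sum>j<d. (u j)\<^sup>2) = (\<Sum>j<d. (rot p q c s u j)\<^sup>2)"
      using rot_inner[OF _ pq cs(1), of u u] by (simp add: power2_eq_square)
    ultimately show "P (rot p q c s u)" using P by (simp add: P_def)
  next
    fix u assume u: "\<And>j. j \<in> {..<d} - {0::nat} \<Longrightarrow> u j = (0::real)"
    have "(\<Sum>j<d. u j * f j) = u 0 * f 0" for f
      using u d by (subst sum.mono_neutral_right[of _ "{0}"]) auto
    moreover have "(\<Sum>j<d. (u j)\<^sup>2) = (u 0)\<^sup>2"
      using u d by (subst sum.mono_neutral_right[of _ "{0}"]) auto
    ultimately show "P u"
      by (simp add: P_def wishart_form_def power_mult_distrib sum_distrib_left)
  qed (use d in auto)
  then show ?thesis by (simp add: P_def)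
qed

text \<open>The factor \<open>exp (x\<^sup>2 / 4)\<close> halves the exponent of the density and
  leaves \<open>sqrt 2\<close> times the normal density of standard deviation
  \<open>sqrt 2\<close>.\<close>

lemma std_normal_exp_square: "(\<integral>\<^sup>+x. ennreal (exp (x\<^sup>2 / 4)) \<partial>std_normal) = ennreal (sqrt 2)"
proof -
  have "(\<integral>\<^sup>+x. ennreal (exp (x\<^sup>2 / 4)) \<partial>std_normal) =
     (\<integral>\<^sup>+x. ennreal (std_normal_density x) * ennreal (exp (x\<^sup>2 / 4)) \<partial>lborel)"
    by (rule nn_integral_density) auto
  also have "\<dots> = (\<integral>\<^sup>+x. ennreal (sqrt 2) * ennreal (normal_density 0 (sqrt 2) x) \<partial>lborel)"
    by (intro nn_integral_cong)
       (simp add: ennreal_mult[symmetric] normal_density_def real_sqrt_mult field_simps mult_exp_exp)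
  also have "\<dots> = ennreal (sqrt 2)"
    using prob_space.emeasure_space_1[OF prob_space_normal_density[of "sqrt 2" 0]]
    by (simp add: nn_integral_cmult emeasure_density)
  finally show ?thesis .
qed

text \<open>The scale \<open>8 * real d\<close> turns \<open>|u|\<^sup>2 \<le> 4 d\<close> into an
  exponent of at most the sum of \<open>g\<^sup>2 / 4\<close> over the first column, whose
  exponential is a product of independent factors of mean \<open>sqrt 2\<close>.\<close>

lemma wishart_form_exp_moment:
  assumes R: "finite R" "finite K" "R \<times> {..<d} \<subseteq> K" and d: "d > 0"
    and u: "(\<Sum>j<d. (u j)\<^sup>2) \<le> 4 * real d"
  shows "(\<integral>\<^sup>+g. ennreal (exp (wishart_form R d g u / (8 * real d))) \<partial>gauss K) \<le> ennreal (2 ^ card R)"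
proof -
  have "(\<integral>\<^sup>+g. ennreal (exp (wishart_form R d g u / (8 * real d))) \<partial>gauss K) =
    (\<integral>\<^sup>+g. ennreal (exp ((\<Sum>j<d. (u j)\<^sup>2) * (\<Sum>i\<in>R. (g (i, 0))\<^sup>2) / 2 / (8 * real d))) \<partial>gauss K)"
    by (rule wishart_form_distr[OF R d]) measurable
  \<comment> \<open>Factors \<open>1\<close> are inserted outside the first column so that the
    product formula over all of \<open>K\<close> applies.\<close>
  also have "\<dots> \<le> (\<integral>\<^sup>+g. (\<Prod>x\<in>K. if x \<in> R \<times> {0} then ennreal (exp ((g x)\<^sup>2 / 4)) else 1) \<partial>gauss K)"
  proof (rule nn_integral_mono)
    fix g :: "nat \<times> nat \<Rightarrow> real"
    have sub: "R \<times> {0} \<subseteq> K" using R d by auto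
    have "(\<Sum>j<d. (u j)\<^sup>2) * (\<Sum>i\<in>R. (g (i, 0))\<^sup>2) \<le> (4 * real d) * (\<Sum>i\<in>R. (g (i, 0))\<^sup>2)"
      by (intro mult_right_mono u sum_nonneg) auto
    then have "(\<Sum>j<d. (u j)\<^sup>2) * (\<Sum>i\<in>R. (g (i, 0))\<^sup>2) / 2 / (8 * real d) \<le> (\<Sum>i\<in>R. (g (i, 0))\<^sup>2 / 4)"
      using d by (simp add: field_simps sum_divide_distrib[symmetric])
    also have "\<dots> = (\<Sum>x\<in>R \<times> {0}. (g x)\<^sup>2 / 4)"
    proof -
      have "R \<times> {0} = (\<lambda>i. (i, 0::nat)) ` R" by auto
      then show ?thesis by (simp add: sum.reindex inj_on_def)
    qed
    finally have "ennreal (exp ((\<Sum>j<d. (u j)\<^sup>2) * (\<Sum>i\<in>R. (g (i, 0))\<^sup>2) / 2 / (8 * real d))) \<le>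
      ennreal (\<Prod>x\<in>R \<times> {0}. exp ((g x)\<^sup>2 / 4))"
      using R by (simp add: exp_sum ennreal_leI flip: exp_sum)
    also have "\<dots> = (\<Prod>x\<in>R \<times> {0}. ennreal (exp ((g x)\<^sup>2 / 4)))"
      by (simp add: prod_ennreal)
    also have "\<dots> = (\<Prod>x\<in>K. if x \<in> R \<times> {0} then ennreal (exp ((g x)\<^sup>2 / 4)) else 1)"
      using R sub by (intro prod.mono_neutral_cong_left) auto
    finally show "ennreal (exp ((\<Sum>j<d. (u j)\<^sup>2) * (\<Sum>i\<in>R. (g (i, 0))\<^sup>2) / 2 / (8 * real d))) \<le>
      (\<Prod>x\<in>K. if x \<in> R \<times> {0} then ennreal (exp ((g x)\<^sup>2 / 4)) else 1)" .
  qed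
  also have "\<dots> = (\<Prod>x\<in>K. \<integral>\<^sup>+y. (if x \<in> R \<times> {0} then ennreal (exp (y\<^sup>2 / 4)) else 1) \<partial>std_normal)"
    using R(2) by (intro gauss.product_nn_integral_prod[where f="\<lambda>x y. if x \<in> R \<times> {0} then ennreal (exp (y\<^sup>2 / 4)) else 1"]) auto
  also have "\<dots> = (\<Prod>x\<in>K. if x \<in> R \<times> {0} then ennreal (sqrt 2) else 1)"
    using prob_space.emeasure_space_1[OF prob_space_std_normal]
    by (intro prod.cong refl) (auto simp: std_normal_exp_square)
  also have "\<dots> = (\<Prod>x\<in>R \<times> {0::nat}. ennreal (sqrt 2))"
    using R d by (intro prod.mono_neutral_cong_right) auto
  also have "\<dots> = ennreal (sqrt 2 ^ card R)"
    by (simp add: card_cartesian_product ennreal_power)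
  also have "\<dots> \<le> ennreal (2 ^ card R)"
    by (intro ennreal_leI power_mono) (auto simp: sqrt2_less_2 less_imp_le)
  finally show ?thesis .
qed

text \<open>The quadratic form is controlled on a ball of radius \<open>sqrt d\<close> by its values on the integer
  points of the ball of twice that radius.\<close>

definition grid :: "nat \<Rightarrow> (nat \<Rightarrow> int) set" where
  "grid d = {u \<in> {..<d} \<rightarrow>\<^sub>E {- (4 * int d)..4 * int d}. (\<Sum>j<d. (u j)\<^sup>2) \<le> 4 * int d}"

lemma finite_grid: "finite (grid d)"
  unfolding grid_def by (rule finite_subset[OF _ finite_PiE[of "{..<d}" "\<lambda>_. {- (4 * int d)..4 * int d}"]]) auto

lemma sum_half_powers: "(\<Sum>x\<in>{- int m..int m}. (1 / 2) ^ nat \<bar>x\<bar>) \<le> (3::real)"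
proof -
  have "(\<Sum>x\<in>{- int m..int m}. (1 / 2) ^ nat \<bar>x\<bar>) = 3 - 2 * (1 / 2 :: real) ^ m"
  proof (induction m)
    case (Suc m)
    have "{- int (Suc m)..int (Suc m)} = insert (- int (Suc m)) (insert (int (Suc m)) {- int m..int m})"
      by auto
    then show ?case using Suc by (simp add: nat_add_distrib)
  qed simp
  then show ?thesis by simp
qed

text \<open>Weighted counting. Integers satisfy \<open>\<bar>u\<bar> \<le> u\<^sup>2\<close>, so
  every grid point has weight \<open>2 ^ (- \<Sum>\<bar>u j\<bar>)\<close> at least
  \<open>16 ^ (- d)\<close>, while the weights of all integer vectors in the box factor into
  \<open>d\<close> sums of at most \<open>3\<close>. Hence \<open>48 = 3 * 16\<close>.\<close>

lemma card_grid: "card (grid d) \<le> 48 ^ d"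
proof -
  let ?S = "{- int (4 * d)..int (4 * d)}"
  let ?w = "\<lambda>u. \<Prod>j<d. (1 / 2 :: real) ^ nat \<bar>u j\<bar>"
  have "real (card (grid d)) * (1 / 2) ^ (4 * d) = (\<Sum>u\<in>grid d. (1 / 2) ^ (4 * d))" by simp
  also have "\<dots> \<le> (\<Sum>u\<in>grid d. ?w u)"
  proof (rule sum_mono)
    fix u assume "u \<in> grid d"
    then have u: "(\<Sum>j<d. (u j)\<^sup>2) \<le> 4 * int d" by (simp add: grid_def)
    have "int (\<Sum>j<d. nat \<bar>u j\<bar>) = (\<Sum>j<d. \<bar>u j\<bar>)" by simp
    also have "\<dots> \<le> (\<Sum>j<d. (u j)\<^sup>2)"
    proof (rule sum_mono)
      fix j
      show "\<bar>u j\<bar> \<le> (u j)\<^sup>2"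
        using self_le_power[of "\<bar>u j\<bar>" 2] by (cases "u j = 0") auto
    qed
    finally have "(\<Sum>j<d. nat \<bar>u j\<bar>) \<le> 4 * d" using u by linarith
    then have "(1 / 2 :: real) ^ (4 * d) \<le> (1 / 2) ^ (\<Sum>j<d. nat \<bar>u j\<bar>)"
      by (intro power_decreasing) auto
    then show "(1 / 2 :: real) ^ (4 * d) \<le> ?w u" by (simp add: power_sum)
  qed
  also have "\<dots> \<le> (\<Sum>u\<in>{..<d} \<rightarrow>\<^sub>E ?S. ?w u)"
    by (intro sum_mono2 finite_PiE) (auto simp: grid_def prod_nonneg)
  also have "\<dots> = (\<Prod>j<d. \<Sum>x\<in>?S. (1 / 2) ^ nat \<bar>x\<bar>)"
    by (rule prod_sum_PiE[symmetric]) auto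
  also have "\<dots> \<le> (\<Prod>j<d. 3)"
    by (intro prod_mono conjI sum_nonneg sum_half_powers) auto
  finally have "real (card (grid d)) / 16 ^ d \<le> 3 ^ d"
    by (simp add: power_mult power_one_over)
  then have "real (card (grid d)) \<le> 3 ^ d * 16 ^ d"
    by (simp add: pos_divide_le_eq)
  also have "\<dots> = real (48 ^ d)" by (simp flip: power_mult_distrib)
  finally show ?thesis using of_nat_le_iff by blast
qed

text \<open>The form is convex in each coordinate, so a coordinate can be rounded to one of the two
  neighbouring integers without decreasing it.\<close>

lemma wishart_form_round:
  assumes "m \<le> d"
  shows "\<exists>u. (\<forall>j<m. u j = of_int \<lfloor>v j\<rfloor> \<or> u j = of_int \<lfloor>v j\<rfloor> + 1) \<and> (\<forall>j\<ge>m. u j = v j)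
    \<and> wishart_form R d g v \<le> wishart_form R d g u"
  using assms
proof (induction m)
  case 0
  then show ?case by auto
next
  case (Suc m)
  then obtain u where u: "\<forall>j<m. u j = of_int \<lfloor>v j\<rfloor> \<or> u j = of_int \<lfloor>v j\<rfloor> + 1"
    "\<forall>j\<ge>m. u j = v j" "wishart_form R d g v \<le> wishart_form R d g u" by auto
  define l where "l = (of_int \<lfloor>v m\<rfloor> :: real)"
  define \<theta> where "\<theta> = v m - l"
  have \<theta>: "0 \<le> \<theta>" "\<theta> \<le> 1" "u m = l + \<theta>" 
    using u(2) floor_correct[of "v m"] unfolding \<theta>_def l_def by (auto simp: algebra_simps)
  define f where "f x = wishart_form R d g (u(m := x))" for x
  define s where "s i = (\<Sum>j\<in>{..<d} - {m}. u j * g (i, j))" for i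
  have f: "f x = (\<Sum>i\<in>R. (s i + x * g (i, m))\<^sup>2) / 2" for x
  proof -
    have "(\<Sum>j<d. (u(m := x)) j * g (i, j)) = s i + x * g (i, m)" for i
      using Suc.prems by (subst sum.remove[of _ m]) (auto simp: s_def intro!: sum.cong)
    then show ?thesis by (simp add: f_def wishart_form_def)
  qed
  have "f (l + \<theta>) \<le> (\<Sum>i\<in>R. (1 - \<theta>) * (s i + l * g (i, m))\<^sup>2 + \<theta> * (s i + (l + 1) * g (i, m))\<^sup>2) / 2"
    unfolding f
  proof (intro divide_right_mono sum_mono)
    fix i
    have "(1 - \<theta>) * (s i + l * g (i, m))\<^sup>2 + \<theta> * (s i + (l + 1) * g (i, m))\<^sup>2 - (s i + (l + \<theta>) * g (i, m))\<^sup>2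
      = \<theta> * (1 - \<theta>) * (g (i, m))\<^sup>2"
      by (simp add: power2_eq_square algebra_simps)
    also have "\<dots> \<ge> 0" using \<theta> by simp
    finally show "(s i + (l + \<theta>) * g (i, m))\<^sup>2 \<le> (1 - \<theta>) * (s i + l * g (i, m))\<^sup>2 + \<theta> * (s i + (l + 1) * g (i, m))\<^sup>2"
      by simp
  qed simp
  also have "\<dots> = (1 - \<theta>) * f l + \<theta> * f (l + 1)"
    by (simp add: f sum.distrib sum_distrib_left add_divide_distrib)
  also have "\<dots> \<le> max (f l) (f (l + 1))"
    using \<theta> convex_bound_le[of "f l" "max (f l) (f (l + 1))" "f (l + 1)" "1 - \<theta>" \<theta>] by auto
  finally have "f (u m) \<le> f l \<or> f (u m) \<le> f (l + 1)" using \<theta> by auto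
  then obtain x where x: "x = l \<or> x = l + 1" "f (u m) \<le> f x" by auto
  have "f (u m) = wishart_form R d g u" by (simp add: f_def)
  then have "wishart_form R d g v \<le> wishart_form R d g (u(m := x))"
    using x(2) u(3) by (simp add: f_def)
  moreover have "\<forall>j<Suc m. (u(m := x)) j = of_int \<lfloor>v j\<rfloor> \<or> (u(m := x)) j = of_int \<lfloor>v j\<rfloor> + 1"
    using u(1) x(1) by (auto simp: l_def less_Suc_eq)
  moreover have "\<forall>j\<ge>Suc m. (u(m := x)) j = v j" using u(2) by auto
  ultimately show ?case by blast
qed

text \<open>Scale \<open>v\<close> to a vector \<open>w\<close> of squared length \<open>d\<close>
  and round it upwards in the form. Each coordinate moves by at most \<open>1\<close>, so the
  rounded vector has squared length at most \<open>2 d + 2 d\<close> and lies in the grid.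
  Homogeneity undoes the scaling.\<close>

lemma wishart_form_le:
  assumes d: "d > 0" and m: "\<And>u. u \<in> grid d \<Longrightarrow> wishart_form R d g (\<lambda>j. of_int (u j)) \<le> real d * m"
  shows "wishart_form R d g v \<le> m * (\<Sum>j<d. (v j)\<^sup>2)"
proof (cases "(\<Sum>j<d. (v j)\<^sup>2) = 0")
  case True
  then have "v j = 0" if "j < d" for j using that by (simp add: sum_nonneg_eq_0_iff)
  then show ?thesis by (simp add: wishart_form_def)
next
  case False
  define N where "N = (\<Sum>j<d. (v j)\<^sup>2)"
  have N: "N > 0" using False by (simp add: N_def sum_nonneg less_le)
  define r where "r = sqrt (real d / N)"
  have r: "r\<^sup>2 = real d / N" using N by (simp add: r_def)
  define w where "w j = (if j < d then r * v j else 0)" for j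
  have w: "(\<Sum>j<d. (w j)\<^sup>2) = real d"
  proof -
    have "(\<Sum>j<d. (w j)\<^sup>2) = r\<^sup>2 * N"
      by (simp add: w_def power_mult_distrib N_def sum_distrib_left)
    then show ?thesis using N by (simp add: r)
  qed
  obtain u where u: "\<forall>j<d. u j = of_int \<lfloor>w j\<rfloor> \<or> u j = of_int \<lfloor>w j\<rfloor> + 1"
    "wishart_form R d g w \<le> wishart_form R d g u" using wishart_form_round[of d d w R g] by auto
  define z where "z = (\<lambda>j\<in>{..<d}. \<lfloor>u j\<rfloor>)"
  have uz: "u j = of_int (z j)" if "j < d" for j using u(1) that by (auto simp: z_def)
  have "(\<Sum>j<d. (u j)\<^sup>2) \<le> (\<Sum>j<d. 2 * (w j)\<^sup>2 + 2)"
  proof (rule sum_mono)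
    fix j assume j: "j \<in> {..<d}"
    then have "u j = of_int \<lfloor>w j\<rfloor> \<or> u j = of_int \<lfloor>w j\<rfloor> + 1" using u(1) by simp
    then have "\<bar>u j - w j\<bar> \<le> 1" using floor_correct[of "w j"] by linarith
    then have "(u j - w j)\<^sup>2 \<le> 1" by (simp add: abs_square_le_1)
    moreover have "(u j)\<^sup>2 \<le> 2 * (w j)\<^sup>2 + 2 * (u j - w j)\<^sup>2"
      using zero_le_power2[of "u j - 2 * w j"] by (simp add: power2_eq_square algebra_simps)
    ultimately show "(u j)\<^sup>2 \<le> 2 * (w j)\<^sup>2 + 2" by simp
  qed
  also have "\<dots> = 4 * real d" by (simp add: sum.distrib w flip: sum_distrib_left)
  also have "(\<Sum>j<d. (u j)\<^sup>2) = of_int (\<Sum>j<d. (z j)\<^sup>2)" using uz by simp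
  finally have "(of_int (\<Sum>j<d. (z j)\<^sup>2) :: real) \<le> of_int (4 * int d)" by simp
  then have z: "(\<Sum>j<d. (z j)\<^sup>2) \<le> 4 * int d" by (simp only: of_int_le_iff)
  have "z \<in> grid d"
  proof -
    have "\<bar>z j\<bar> \<le> 4 * int d" if "j < d" for j
    proof -
      have "\<bar>z j\<bar> \<le> (z j)\<^sup>2" using self_le_power[of "\<bar>z j\<bar>" 2] by (cases "z j = 0") auto
      also have "\<dots> \<le> (\<Sum>j<d. (z j)\<^sup>2)" using that by (intro member_le_sum) auto
      finally show ?thesis using z by simp
    qed
    then have "z \<in> {..<d} \<rightarrow>\<^sub>E {- (4 * int d)..4 * int d}"
      by (intro PiE_I) (force simp: abs_le_iff, simp add: z_def)
    then show ?thesis using z by (simp add: grid_def)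
  qed
  then have "wishart_form R d g u \<le> real d * m"
    using m[of z] uz by (simp add: wishart_form_def)
  moreover have "wishart_form R d g w = r\<^sup>2 * wishart_form R d g v"
    by (simp add: wishart_form_def w_def power_mult_distrib mult.assoc flip: sum_distrib_left)
  ultimately have "real d / N * wishart_form R d g v \<le> real d * m" using u(2) r by simp
  then show ?thesis using N d by (simp add: field_simps flip: N_def)
qed

text \<open>With \<open>z\<close> the sum of exponentials and \<open>A\<close> a bound on its mean, the maximum over the grid is
  at most \<open>8 d ln z \<le> 8 d (z / A + ln A)\<close>, whose mean is of order \<open>d\<^sup>2\<close>.\<close>

definition wishart_bound :: "nat set \<Rightarrow> nat \<Rightarrow> (nat \<times> nat \<Rightarrow> real) \<Rightarrow> real" where
  "wishart_bound R d g = 8 * ((\<Sum>u\<in>grid d. exp (wishart_form R d g (\<lambda>j. of_int (u j)) / (8 * real d)))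
     / (48 ^ d * 2 ^ card R) + ln (48 ^ d * 2 ^ card R))"

lemma measurable_wishart_bound:
  assumes "R \<times> {..<d} \<subseteq> K"
  shows "wishart_bound R d \<in> borel_measurable (gauss K)"
proof -
  note [measurable] = measurable_wishart_form[OF assms]
  show ?thesis unfolding wishart_bound_def by measurable
qed

lemma wishart_form_le_bound:
  assumes d: "d > 0"
  shows "wishart_form R d g v \<le> wishart_bound R d g * (\<Sum>j<d. (v j)\<^sup>2)"
proof (rule wishart_form_le[OF d])
  fix u assume u: "u \<in> grid d"
  define A :: real where "A = 48 ^ d * 2 ^ card R"
  define z where "z = (\<Sum>u\<in>grid d. exp (wishart_form R d g (\<lambda>j. of_int (u j)) / (8 * real d)))"
  have A: "A > 0" by (simp add: A_def)
  have le: "exp (wishart_form R d g (\<lambda>j. of_int (u j)) / (8 * real d)) \<le> z"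
    unfolding z_def by (rule member_le_sum[OF u]) (auto simp: finite_grid)
  then have z: "z > 0" using exp_gt_zero less_le_trans by blast
  have "wishart_form R d g (\<lambda>j. of_int (u j)) / (8 * real d) \<le> ln z"
    using le z by (simp add: ln_ge_iff)
  also have "ln z = ln (z / A) + ln A" using z A by (simp add: ln_div)
  also have "\<dots> \<le> z / A + ln A" using ln_le_minus_one[of "z / A"] z A by simp
  finally have "wishart_form R d g (\<lambda>j. of_int (u j)) \<le> 8 * real d * (z / A + ln A)"
    using d by (simp add: pos_divide_le_eq mult.commute)
  then show "wishart_form R d g (\<lambda>j. of_int (u j)) \<le> real d * wishart_bound R d g"
    by (simp add: wishart_bound_def A_def z_def algebra_simps)
qed

lemma wishart_bound_nonneg: "wishart_bound R d g \<ge> 0"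
proof -
  have "(1::real) \<le> 48 ^ d * 2 ^ card R" by (intro mult_ge1_I) auto
  then have "ln (48 ^ d * 2 ^ card R :: real) \<ge> 0" by (rule ln_ge_zero)
  then show ?thesis unfolding wishart_bound_def by (simp add: sum_nonneg)
qed

text \<open>With \<open>A\<close> the normaliser, the sum of exponentials has mean at most
  \<open>A\<close>, contributing \<open>8\<close>, and \<open>ln A \<le> 8 d\<close> from
  \<open>ln 48 \<le> 6\<close> and \<open>card R \<le> 2 d\<close>, contributing
  \<open>64 d\<close>. The constant is \<open>8 + 64\<close>, as \<open>d \<ge> 1\<close>.\<close>

lemma wishart_bound_mean:
  assumes R: "finite R" "finite K" "R \<times> {..<d} \<subseteq> K" "card R \<le> 2 * d" and d: "d > 0"
  shows "(\<integral>\<^sup>+g. ennreal (wishart_bound R d g) \<partial>gauss K) \<le> ennreal (72 * real d)"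
proof -
  define A :: real where "A = 48 ^ d * 2 ^ card R"
  have A: "A > 0" "A \<ge> 1" by (auto simp: A_def intro!: mult_ge1_I)
  note [measurable] = measurable_wishart_form[OF R(3)]
  let ?e = "\<lambda>u g. exp (wishart_form R d g (\<lambda>j. of_int (u j)) / (8 * real d))"
  have "(\<integral>\<^sup>+g. ennreal (wishart_bound R d g) \<partial>gauss K) =
    (\<integral>\<^sup>+g. ennreal (8 / A) * (\<Sum>u\<in>grid d. ennreal (?e u g)) + ennreal (8 * ln A) \<partial>gauss K)"
    using A unfolding wishart_bound_def A_def[symmetric]
    by (intro nn_integral_cong)
       (auto simp: sum_ennreal ennreal_mult[symmetric] ennreal_plus[symmetric] sum_nonneg algebra_simps simp del: ennreal_plus)
  also have "\<dots> = ennreal (8 / A) * (\<Sum>u\<in>grid d. \<integral>\<^sup>+g. ennreal (?e u g) \<partial>gauss K) + ennreal (8 * ln A)"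
    using prob_space.emeasure_space_1[OF prob_space_gauss[of K]]
    by (simp add: nn_integral_add nn_integral_cmult nn_integral_sum del: sum_ennreal)
  also have "\<dots> \<le> ennreal (8 / A) * (\<Sum>u\<in>grid d. ennreal (2 ^ card R)) + ennreal (8 * ln A)"
  proof (intro add_mono mult_left_mono sum_mono order_refl)
    fix u assume "u \<in> grid d"
    then have "(of_int (\<Sum>j<d. (u j)\<^sup>2) :: real) \<le> of_int (4 * int d)"
      unfolding of_int_le_iff by (simp add: grid_def)
    then show "(\<integral>\<^sup>+g. ennreal (?e u g) \<partial>gauss K) \<le> ennreal (2 ^ card R)"
      by (intro wishart_form_exp_moment R d) simp
  qed auto
  also have "\<dots> = ennreal (8 / A * (real (card (grid d)) * 2 ^ card R) + 8 * ln A)"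
    using A by (simp add: ennreal_mult[symmetric] ennreal_plus[symmetric] ennreal_of_nat_eq_real_of_nat del: ennreal_plus)
  also have "\<dots> \<le> ennreal (8 + 8 * (8 * real d))"
  proof (intro ennreal_leI add_mono mult_left_mono)
    have "real (card (grid d)) * 2 ^ card R \<le> A"
      using card_grid[of d] unfolding A_def by (intro mult_right_mono) (metis of_nat_le_iff of_nat_numeral of_nat_power, simp)
    then show "8 / A * (real (card (grid d)) * 2 ^ card R) \<le> 8"
      using A by (simp add: field_simps)
    have "ln A = real d * ln 48 + real (card R) * ln 2"
      by (simp add: A_def ln_mult ln_realpow)
    also have "\<dots> \<le> real d * 6 + (2 * real d) * 1"
    proof (intro add_mono mult_mono)
      have "(48::real) \<le> 2 ^ 6" by simp
      also have "\<dots> \<le> exp 1 ^ 6" using exp_ge_add_one_self[of 1] by (intro power_mono) auto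
      also have "\<dots> = exp 6" by (simp flip: exp_of_nat_mult)
      finally show "ln 48 \<le> (6::real)" using ln_le_cancel_iff[of 48 "exp 6"] by simp
    qed (use R(4) ln_le_minus_one[of 2] in auto)
    finally show "ln A \<le> 8 * real d" by simp
  qed auto
  also have "\<dots> \<le> ennreal (72 * real d)"
  proof (rule ennreal_leI)
    have "1 \<le> real d" using d by simp
    then show "8 + 8 * (8 * real d) \<le> 72 * real d" by simp
  qed
  finally show ?thesis .
qed


section \<open>Powers of positive semidefinite matrices\<close>

text \<open>Matrices are total functions of which only the entries with both indices below
  \<open>d\<close> carry meaning; memory contents and mathematical matrices will agree only
  there.\<close>

type_synonym mat = "nat \<Rightarrow> nat \<Rightarrow> real"

definition dot :: "nat \<Rightarrow> (nat \<Rightarrow> real) \<Rightarrow> (nat \<Rightarrow> real) \<Rightarrow> real" where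
  "dot d v w = (\<Sum>j<d. v j * w j)"

definition mvec :: "nat \<Rightarrow> mat \<Rightarrow> (nat \<Rightarrow> real) \<Rightarrow> nat \<Rightarrow> real" where
  "mvec d M v = (\<lambda>j. \<Sum>k<d. M j k * v k)"

text \<open>This is \<open>A^T A\<close>: positive semidefinite for every \<open>A\<close>, and the
  square of \<open>A\<close> if \<open>A\<close> is symmetric. Iterating it therefore computes
  powers by repeated squaring.\<close>

definition gram :: "nat \<Rightarrow> mat \<Rightarrow> mat" where
  "gram d A = (\<lambda>j k. \<Sum>i<d. A i j * A i k)"

definition mtrace :: "nat \<Rightarrow> mat \<Rightarrow> real" where
  "mtrace d A = (\<Sum>j<d. A j j)"

definition minner :: "nat \<Rightarrow> mat \<Rightarrow> mat \<Rightarrow> real" where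
  "minner d A B = (\<Sum>j<d. \<Sum>k<d. A j k * B j k)"

definition symm :: "nat \<Rightarrow> mat \<Rightarrow> bool" where
  "symm d A \<longleftrightarrow> (\<forall>j<d. \<forall>k<d. A j k = A k j)"

abbreviation form :: "nat \<Rightarrow> mat \<Rightarrow> (nat \<Rightarrow> real) \<Rightarrow> real" where
  "form d A v \<equiv> dot d v (mvec d A v)"

abbreviation unit :: "nat \<Rightarrow> nat \<Rightarrow> real" where
  "unit k \<equiv> (\<lambda>j. if j = k then 1 else 0)"

lemma dot_add: "dot d (\<lambda>j. v j + t * u j) w = dot d v w + t * dot d u w"
  "dot d w (\<lambda>j. v j + t * u j) = dot d w v + t * dot d w u"
  by (simp_all add: dot_def sum.distrib sum_distrib_left algebra_simps)

lemma dot_nonneg: "dot d v v \<ge> 0"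
  by (simp add: dot_def sum_nonneg)

lemma dot_unit: "k < d \<Longrightarrow> dot d (unit k) w = w k" "k < d \<Longrightarrow> dot d w (unit k) = w k"
  by (simp_all add: dot_def if_distrib[of "\<lambda>x. x * _"] if_distrib[of "\<lambda>x. _ * x"] sum.delta cong: if_cong)

lemma mvec_unit: "k < d \<Longrightarrow> mvec d M (unit k) j = M j k"
  by (simp add: mvec_def if_distrib[of "\<lambda>x. _ * x"] sum.delta cong: if_cong)

lemma mvec_add: "mvec d M (\<lambda>j. v j + t * u j) = (\<lambda>j. mvec d M v j + t * mvec d M u j)"
  by (simp add: mvec_def sum.distrib sum_distrib_left algebra_simps)

lemma mvec_symm:
  assumes "symm d M"
  shows "dot d (mvec d M v) w = dot d v (mvec d M w)"
proof -
  have "dot d (mvec d M v) w = (\<Sum>j<d. \<Sum>k<d. M j k * v k * w j)"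
    by (simp add: dot_def mvec_def sum_distrib_right)
  also have "\<dots> = (\<Sum>k<d. \<Sum>j<d. M j k * v k * w j)" by (rule sum.swap)
  also have "\<dots> = (\<Sum>k<d. \<Sum>j<d. v k * (M k j * w j))"
    using assms by (intro sum.cong refl) (auto simp: symm_def)
  also have "\<dots> = dot d v (mvec d M w)"
    by (simp add: dot_def mvec_def sum_distrib_left)
  finally show ?thesis .
qed

lemma mvec_pow_symm:
  assumes "symm d M"
  shows "dot d ((mvec d M ^^ n) v) w = dot d v ((mvec d M ^^ n) w)"
proof (induction n arbitrary: w)
  case (Suc n)
  have "dot d ((mvec d M ^^ Suc n) v) w = dot d ((mvec d M ^^ n) v) (mvec d M w)"
    by (simp add: mvec_symm[OF assms])
  also have "\<dots> = dot d v ((mvec d M ^^ Suc n) w)"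
    by (simp only: Suc funpow_Suc_right comp_def)
  finally show ?case .
qed simp

text \<open>The discriminant criterion, through which positivity of moments becomes
  log-convexity.\<close>

lemma nonneg_quadratic:
  fixes p b q :: real
  assumes "\<And>t. p + 2 * t * b + t\<^sup>2 * q \<ge> 0" "q \<ge> 0"
  shows "b\<^sup>2 \<le> p * q"
proof (cases "q = 0")
  case True
  have "b = 0"
  proof (rule ccontr)
    assume "b \<noteq> 0"
    \<comment> \<open>For \<open>q = 0\<close> the expression is affine in \<open>t\<close>; at this
      \<open>t\<close> it would be \<open>-1\<close>.\<close>
    then have "2 * (- (p + 1) / (2 * b)) * b = - (p + 1)" by simp
    then show False using assms(1)[of "- (p + 1) / (2 * b)"] True by simp
  qed
  then show ?thesis using True by simp
next
  case False
  then have q: "q > 0" using assms(2) by simp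
  have "p + 2 * (- b / q) * b + (- b / q)\<^sup>2 * q = p - b\<^sup>2 / q"
    using q by (simp add: power2_eq_square field_simps)
  then have "b\<^sup>2 / q \<le> p" using assms(1)[of "- b / q"] by linarith
  then show ?thesis using q by (simp add: pos_divide_le_eq)
qed

text \<open>\<open>v^T M^n v\<close> is the \<open>n\<close>-th moment of the spectral measure of
  \<open>M\<close> at \<open>v\<close>; the inequalities that follow are moment inequalities for
  it.\<close>

definition moment :: "nat \<Rightarrow> mat \<Rightarrow> (nat \<Rightarrow> real) \<Rightarrow> nat \<Rightarrow> real" where
  "moment d M v n = dot d v ((mvec d M ^^ n) v)"

lemma moment_even:
  assumes "symm d M"
  shows "moment d M v (2 * n) = dot d ((mvec d M ^^ n) v) ((mvec d M ^^ n) v)"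
  by (simp add: moment_def mvec_pow_symm[OF assms] mult_2 funpow_add)

lemma moment_odd:
  assumes "symm d M"
  shows "moment d M v (Suc (2 * n)) = form d M ((mvec d M ^^ n) v)"
proof -
  have "(mvec d M ^^ Suc (2 * n)) v = (mvec d M ^^ n) (mvec d M ((mvec d M ^^ n) v))"
    by (simp add: mult_2 funpow_add funpow_swap1)
  then show ?thesis by (simp only: moment_def mvec_pow_symm[OF assms])
qed

lemma moment_nonneg:
  assumes "symm d M" "\<And>v. form d M v \<ge> 0"
  shows "moment d M v n \<ge> 0"
proof (cases "even n")
  case True
  then show ?thesis using moment_even[OF assms(1)] by (auto elim!: evenE simp: dot_nonneg)
next
  case False
  then show ?thesis using moment_odd[OF assms(1)] assms(2) by (auto elim!: oddE)
qed

text \<open>The left side is the \<open>n\<close>-th moment of the vector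
  \<open>v + t M v\<close>.\<close>

lemma moment_quadratic:
  assumes M: "symm d M" "\<And>v. form d M v \<ge> 0"
  shows "moment d M v n + 2 * t * moment d M v (n + 1) + t\<^sup>2 * moment d M v (n + 2) \<ge> 0"
proof -
  define w where "w = (\<lambda>j. v j + t * mvec d M v j)"
  have pw: "(mvec d M ^^ n) (\<lambda>j. v j + t * u j) = (\<lambda>j. (mvec d M ^^ n) v j + t * (mvec d M ^^ n) u j)" for v u n
    by (induction n) (simp_all add: mvec_add)
  have "moment d M w n = dot d v ((mvec d M ^^ n) v) + t * dot d v ((mvec d M ^^ n) (mvec d M v))
      + t * (dot d (mvec d M v) ((mvec d M ^^ n) v) + t * dot d (mvec d M v) ((mvec d M ^^ n) (mvec d M v)))"
    unfolding moment_def w_def pw dot_add by simp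
  also have "\<dots> = moment d M v n + 2 * t * moment d M v (n + 1) + t\<^sup>2 * moment d M v (n + 2)"
    unfolding mvec_symm[OF M(1)] by (simp add: moment_def funpow_swap1 power2_eq_square algebra_simps)
  finally show ?thesis using moment_nonneg[OF M, of w n] by simp
qed

definition log_convex :: "(nat \<Rightarrow> real) \<Rightarrow> bool" where
  "log_convex a \<longleftrightarrow> (\<forall>n. a n \<ge> 0) \<and> (\<forall>n. (a (n + 1))\<^sup>2 \<le> a n * a (n + 2))"

lemma log_convex_sum_moment:
  assumes M: "symm d M" "\<And>v. form d M v \<ge> 0"
  shows "log_convex (\<lambda>n. \<Sum>i\<in>I. moment d M (v i) n)"
  unfolding log_convex_def
proof (intro conjI allI)
  fix n
  show "(\<Sum>i\<in>I. moment d M (v i) n) \<ge> 0" by (intro sum_nonneg moment_nonneg M)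
  show "(\<Sum>i\<in>I. moment d M (v i) (n + 1))\<^sup>2 \<le> (\<Sum>i\<in>I. moment d M (v i) n) * (\<Sum>i\<in>I. moment d M (v i) (n + 2))"
  proof (rule nonneg_quadratic)
    fix t :: real
    have "0 \<le> (\<Sum>i\<in>I. moment d M (v i) n + 2 * t * moment d M (v i) (n + 1) + t\<^sup>2 * moment d M (v i) (n + 2))"
      by (intro sum_nonneg moment_quadratic M)
    then show "0 \<le> (\<Sum>i\<in>I. moment d M (v i) n) + 2 * t * (\<Sum>i\<in>I. moment d M (v i) (n + 1)) + t\<^sup>2 * (\<Sum>i\<in>I. moment d M (v i) (n + 2))"
      by (simp add: sum.distrib sum_distrib_left)
  qed (intro sum_nonneg moment_nonneg M)
qed

text \<open>A root-free form of the fact that \<open>(a n / a 0) ^ (1 / n)\<close> increases with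
  \<open>n\<close>: by log-convexity \<open>a n / a 0\<close> is a product of \<open>n\<close>
  ratios, none exceeding the next one, \<open>a (n + 1) / a n\<close>.\<close>

lemma log_convex_power:
  assumes a: "log_convex a"
  shows "a n ^ (n + 1) \<le> a 0 * a (n + 1) ^ n"
proof (induction n)
  case (Suc n)
  have nn: "a k \<ge> 0" for k using a by (simp add: log_convex_def)
  show ?case
  proof (cases "a (n + 1) = 0")
    case True
    then show ?thesis using nn by simp
  next
    case False
    then have pos: "a (n + 1) ^ n > 0" using nn[of "n + 1"] by simp
    have "a (n + 1) ^ n * a (n + 1) ^ (n + 2) = ((a (n + 1))\<^sup>2) ^ (n + 1)"
      by (simp add: power_add[symmetric] power_mult[symmetric] mult_2 del: power_Suc)
    also have "\<dots> \<le> (a n * a (n + 2)) ^ (n + 1)"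
      using a by (intro power_mono) (auto simp: log_convex_def)
    also have "\<dots> = a n ^ (n + 1) * a (n + 2) ^ (n + 1)" by (rule power_mult_distrib)
    also have "\<dots> \<le> (a 0 * a (n + 1) ^ n) * a (n + 2) ^ (n + 1)"
      using nn by (intro mult_right_mono Suc zero_le_power)
    finally have "a (n + 1) ^ n * a (n + 1) ^ (n + 2) \<le> a (n + 1) ^ n * (a 0 * a (n + 2) ^ (n + 1))"
      by (simp only: mult_ac)
    then show ?thesis using pos by (simp only: mult_le_cancel_left_pos) simp
  qed
qed simp

text \<open>Jensen's inequality for the exponent \<open>2 ^ L\<close>, obtained from one
  Cauchy-Schwarz inequality per doubling.\<close>

lemma moment_doubling:
  assumes "symm d M" "form d M v \<ge> 0"
  shows "form d M v ^ 2 ^ L \<le> dot d v v ^ (2 ^ L - 1) * moment d M v (2 ^ L)"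
proof (induction L)
  case 0
  then show ?case by (simp add: moment_def)
next
  case (Suc L)
  let ?w = "(mvec d M ^^ 2 ^ L) v"
  have cs: "(moment d M v (2 ^ L))\<^sup>2 \<le> dot d v v * moment d M v (2 ^ Suc L)"
    using Cauchy_Schwarz_ineq_sum[of v ?w "{..<d}"] moment_even[OF assms(1), of v "2 ^ L"]
    by (simp add: moment_def dot_def power2_eq_square)
  have "form d M v ^ 2 ^ Suc L = (form d M v ^ 2 ^ L)\<^sup>2"
    by (simp add: power_mult[symmetric] mult.commute)
  also have "\<dots> \<le> (dot d v v ^ (2 ^ L - 1) * moment d M v (2 ^ L))\<^sup>2"
    by (intro power_mono Suc zero_le_power assms)
  also have "\<dots> \<le> (dot d v v ^ (2 ^ L - 1))\<^sup>2 * (dot d v v * moment d M v (2 ^ Suc L))"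
    unfolding power_mult_distrib by (intro mult_left_mono cs) simp
  also have "\<dots> = dot d v v ^ Suc ((2 ^ L - 1) * 2) * moment d M v (2 ^ Suc L)"
    by (simp add: power_mult[symmetric])
  also have "Suc ((2 ^ L - 1) * 2) = 2 ^ Suc L - (1::nat)"
    using one_le_power[of "2::nat" L] unfolding power_Suc by arith
  finally show ?case .
qed

definition pow_entry :: "nat \<Rightarrow> mat \<Rightarrow> nat \<Rightarrow> mat" where
  "pow_entry d M n = (\<lambda>j k. (mvec d M ^^ n) (unit k) j)"

lemma gram_cong: "(\<And>j k. j < d \<Longrightarrow> k < d \<Longrightarrow> A j k = B j k) \<Longrightarrow> j < d \<Longrightarrow> k < d \<Longrightarrow> gram d A j k = gram d B j k"
  by (simp add: gram_def)

lemma gram_pow_entry: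
  assumes "symm d M" "j < d" "k < d"
  shows "gram d (pow_entry d M n) j k = pow_entry d M (2 * n) j k"
proof -
  have "gram d (pow_entry d M n) j k = dot d ((mvec d M ^^ n) (unit j)) ((mvec d M ^^ n) (unit k))"
    by (simp add: gram_def pow_entry_def dot_def)
  also have "\<dots> = dot d (unit j) ((mvec d M ^^ (2 * n)) (unit k))"
    by (simp only: mvec_pow_symm[OF assms(1)]) (simp add: mult_2 funpow_add)
  also have "\<dots> = pow_entry d M (2 * n) j k"
    using assms by (simp only: dot_unit pow_entry_def)
  finally show ?thesis .
qed

lemma gram_iterate:
  assumes "symm d M" "j < d" "k < d"
  shows "(gram d ^^ L) M j k = pow_entry d M (2 ^ L) j k"
  using assms(2,3)
proof (induction L arbitrary: j k)
  case 0
  then show ?case by (simp add: pow_entry_def mvec_unit)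
next
  case (Suc L)
  have "(gram d ^^ Suc L) M j k = gram d (pow_entry d M (2 ^ L)) j k"
    using Suc.prems by (simp, intro gram_cong Suc.IH)
  then show ?case using gram_pow_entry[OF assms(1) Suc.prems] by simp
qed

lemma trace_pow: "mtrace d (pow_entry d M n) = (\<Sum>l<d. moment d M (unit l) n)"
  unfolding mtrace_def pow_entry_def moment_def by (intro sum.cong refl) (simp only: dot_unit lessThan_iff)

lemma minner_pow:
  assumes "symm d M"
  shows "minner d M (pow_entry d M n) = (\<Sum>l<d. moment d M (unit l) (n + 1))"
proof -
  have "minner d M (pow_entry d M n) = (\<Sum>k<d. \<Sum>j<d. M j k * pow_entry d M n j k)"
    unfolding minner_def by (rule sum.swap)
  also have "\<dots> = (\<Sum>k<d. dot d (mvec d M (unit k)) ((mvec d M ^^ n) (unit k)))"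
    by (intro sum.cong refl) (simp add: dot_def pow_entry_def mvec_unit)
  also have "\<dots> = (\<Sum>k<d. moment d M (unit k) (n + 1))"
    by (simp only: mvec_symm[OF assms] moment_def) simp
  finally show ?thesis .
qed

lemma mvec_pow_expand:
  assumes "j < d"
  shows "(mvec d M ^^ n) v j = (\<Sum>k<d. v k * (mvec d M ^^ n) (unit k) j)"
  using assms
proof (induction n arbitrary: j)
  case 0
  have "(\<Sum>k<d. v k * (if j = k then 1 else 0)) = v j"
    using 0 by (simp add: if_distrib[of "\<lambda>x. _ * x"] sum.delta' cong: if_cong)
  then show ?case by simp
next
  case (Suc n)
  have "(mvec d M ^^ Suc n) v j = (\<Sum>i<d. M j i * (\<Sum>k<d. v k * (mvec d M ^^ n) (unit k) i))"
    using Suc.IH by (simp add: mvec_def[of d M "(mvec d M ^^ n) v"])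
  also have "\<dots> = (\<Sum>k<d. \<Sum>i<d. M j i * (v k * (mvec d M ^^ n) (unit k) i))"
    unfolding sum_distrib_left by (rule sum.swap)
  also have "\<dots> = (\<Sum>k<d. v k * (mvec d M ^^ Suc n) (unit k) j)"
    by (simp add: mvec_def[of d M "(mvec d M ^^ n) (unit _)"] sum_distrib_left algebra_simps)
  finally show ?case .
qed

text \<open>The operator norm of \<open>M^n\<close> is at most its Frobenius norm, whose square is
  the trace of \<open>M^(2n)\<close>.\<close>

lemma moment_le_trace:
  assumes "symm d M"
  shows "moment d M v (2 * n) \<le> dot d v v * mtrace d (pow_entry d M (2 * n))"
proof -
  let ?e = "\<lambda>k. (mvec d M ^^ n) (unit k)"
  have "moment d M v (2 * n) = (\<Sum>j<d. (\<Sum>k<d. v k * ?e k j)\<^sup>2)"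
    by (simp add: moment_even[OF assms] dot_def mvec_pow_expand[where v=v] power2_eq_square)
  also have "\<dots> \<le> (\<Sum>j<d. (\<Sum>k<d. (v k)\<^sup>2) * (\<Sum>k<d. (?e k j)\<^sup>2))"
    by (intro sum_mono Cauchy_Schwarz_ineq_sum)
  also have "\<dots> = dot d v v * (\<Sum>j<d. \<Sum>k<d. (?e k j)\<^sup>2)"
    by (simp add: dot_def power2_eq_square sum_distrib_left)
  also have "(\<Sum>j<d. \<Sum>k<d. (?e k j)\<^sup>2) = (\<Sum>k<d. \<Sum>j<d. (?e k j)\<^sup>2)" by (rule sum.swap)
  also have "\<dots> = mtrace d (pow_entry d M (2 * n))"
    by (simp add: trace_pow moment_even[OF assms] dot_def power2_eq_square)
  finally show ?thesis .
qed

text \<open>Stands in for \<open>d ^ (1 / p) \<le> 1 + d / p\<close>; comparing \<open>p\<close>-th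
  powers keeps roots out of the argument.\<close>

lemma bernoulli_bound:
  assumes "p > 0"
  shows "real d \<le> (1 + real d / real p) ^ p"
proof -
  have "- 1 \<le> real d / real p" by (rule order_trans[of _ 0]) auto
  from Bernoulli_inequality[OF this, of p] show ?thesis using assms by simp
qed

text \<open>A high power of a positive semidefinite matrix, scaled to trace 1, is almost optimal for the
  linear functional given by the matrix: consecutive traces of powers have increasing ratios.\<close>

lemma form_le_power:
  assumes M: "symm d M" "\<And>v. form d M v \<ge> 0" and L: "L > 0"
  shows "form d M v \<le> dot d v v * ((1 + real d / 2 ^ L) *
    (minner d M ((gram d ^^ L) M) / mtrace d ((gram d ^^ L) M)))"
proof -
  define p :: nat where "p = 2 ^ L"
  define a where "a n = (\<Sum>l<d. moment d M (unit l) n)" for n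
  have p: "p > 0" "p = 2 * 2 ^ (L - 1)" using L by (auto simp: p_def simp flip: power_Suc)
  have a: "log_convex a" unfolding a_def by (rule log_convex_sum_moment[OF M])
  then have nn: "a n \<ge> 0" for n by (simp add: log_convex_def)
  have tr: "mtrace d ((gram d ^^ L) M) = a p"
    unfolding a_def trace_pow[symmetric] mtrace_def p_def by (intro sum.cong) (auto simp: gram_iterate[OF M(1)])
  have inn: "minner d M ((gram d ^^ L) M) = a (p + 1)"
    unfolding a_def minner_pow[OF M(1), symmetric] minner_def p_def
    by (intro sum.cong) (auto simp: gram_iterate[OF M(1)])
  have a0: "a 0 \<le> real d"
  proof -
    have "a 0 = (\<Sum>l<d. 1)" unfolding a_def moment_def by (intro sum.cong refl) (simp add: dot_unit)
    then show ?thesis by simp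
  qed
  define \<mu> where "\<mu> = form d M v"
  define N where "N = dot d v v"
  have N: "N \<ge> 0" by (simp add: N_def dot_nonneg)
  have \<mu>: "\<mu> \<ge> 0" by (simp add: \<mu>_def M)
  \<comment> \<open>In \<open>p\<close>-th powers: the form at \<open>v\<close> is at most
    \<open>N\<close> times the \<open>p\<close>-th root of the trace of \<open>M^p\<close>.\<close>
  have "\<mu> ^ p \<le> N ^ (p - 1) * moment d M v p"
    using moment_doubling[OF M(1) M(2)] by (simp add: \<mu>_def N_def p_def)
  also have "moment d M v p \<le> N * a p"
    using moment_le_trace[OF M(1), of v "2 ^ (L - 1)"] unfolding p(2) N_def a_def trace_pow .
  finally have "\<mu> ^ p \<le> N ^ (p - 1) * (N * a p)" using N by (simp add: mult_left_mono)
  also have "\<dots> = N ^ p * a p" using power_minus_mult[OF p(1), of N] by (simp add: mult.assoc[symmetric])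
  finally have 1: "\<mu> ^ p \<le> N ^ p * a p" .
  show ?thesis
  proof (cases "a p = 0")
    \<comment> \<open>If the power vanishes, the quotient of the claim is \<open>0\<close> by
      convention, but then the form is \<open>0\<close> too.\<close>
    case True
    then have "\<mu> = 0" using 1 \<mu> p by (simp add: zero_less_power_eq power_le_zero_eq)
    then show ?thesis by (simp add: \<mu>_def tr True)
  next
    case False
    then have ap: "a p > 0" using nn[of p] by simp
    define r where "r = a (p + 1) / a p"
    have r: "r \<ge> 0" using nn ap by (simp add: r_def)
    \<comment> \<open>Log-convexity bounds that trace: \<open>a p\<close> is at most
      \<open>a 0 \<le> d\<close> times the \<open>p\<close>-th power of the last ratio
      \<open>r\<close>, and \<open>r\<close> is the value the scaled power attains.\<close>
    have "a p * a p ^ p \<le> real d * a (p + 1) ^ p"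
      using log_convex_power[OF a, of p] a0 nn by (simp add: order_trans[OF _ mult_right_mono])
    then have "a p \<le> real d * r ^ p"
      using ap by (simp add: r_def power_divide pos_le_divide_eq)
    also have "\<dots> \<le> (1 + real d / real p) ^ p * r ^ p"
      using r by (intro mult_right_mono bernoulli_bound p) simp
    finally have "N ^ p * a p \<le> N ^ p * ((1 + real d / real p) ^ p * r ^ p)"
      using N by (intro mult_left_mono) auto
    with 1 have "\<mu> ^ p \<le> (N * ((1 + real d / real p) * r)) ^ p" by (simp add: power_mult_distrib)
    then have "\<mu> \<le> N * ((1 + real d / real p) * r)"
      using p N r by (subst (asm) power_mono_iff) (auto simp: \<mu>)
    then show ?thesis by (simp add: \<mu>_def N_def r_def tr inn p_def)
  qed
qed


section \<open>Frank-Wolfe iteration\<close>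

text \<open>The dual description of the positive semidefinite matrices of trace at most \<open>\<tau>\<close>.\<close>

definition in_cone :: "nat \<Rightarrow> mat \<Rightarrow> real \<Rightarrow> bool" where
  "in_cone d Y \<tau> \<longleftrightarrow> (\<forall>E \<kappa>. \<kappa> \<ge> 0 \<longrightarrow> (\<forall>v. form d E v \<le> \<kappa> * dot d v v) \<longrightarrow> minner d E Y \<le> \<kappa> * \<tau>)"

definition off :: "mat \<Rightarrow> mat" where
  "off A = (\<lambda>j k. if j = k then 0 else A j k)"

definition offnorm2 :: "nat \<Rightarrow> mat \<Rightarrow> real" where
  "offnorm2 d A = minner d (off A) (off A)"

text \<open>A bound for the operator norm of the residual that needs only field operations and
  comparisons. Put on the diagonal, it makes the residual positive semidefinite.\<close>

definition absdiff :: "nat \<Rightarrow> mat \<Rightarrow> mat \<Rightarrow> real" where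
  "absdiff d A Y = (\<Sum>j<d. \<Sum>k<d. \<bar>A j k - Y j k\<bar>)"

text \<open>Only the off-diagonal entries are fitted. The residual then has trace \<open>0\<close>, so its largest
  eigenvalue is nonnegative and it does not matter that the comparison matrix may have trace
  less than \<open>d\<close>. The new diagonal makes the matrix positive semidefinite.\<close>

definition shifted :: "nat \<Rightarrow> mat \<Rightarrow> mat \<Rightarrow> mat" where
  "shifted d A Y = (\<lambda>j k. if j = k then absdiff d A Y else A j k - Y j k)"

text \<open>\<open>4 * d\<close> squarings reach the exponent \<open>2 ^ (4 * d)\<close>. The
  relative error \<open>d / 2 ^ (4 * d)\<close> is multiplied by a shift of order
  \<open>d ^ 3\<close>, and \<open>d ^ 4 \<le> 2 ^ (4 * d)\<close>.\<close>

definition power_matrix :: "nat \<Rightarrow> mat \<Rightarrow> mat \<Rightarrow> mat" where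
  "power_matrix d A Y = (gram d ^^ (4 * d)) (shifted d A Y)"

text \<open>The convex combination of \<open>Y\<close> and \<open>d * W\<close> with weights
  \<open>1 - 1 / d\<close> and \<open>1 / d\<close>, where \<open>W\<close> is the power matrix
  scaled to trace \<open>1\<close>. The constant step keeps the quadratic term at most
  \<open>4\<close> and contracts the gap by \<open>1 - 1 / d\<close>.\<close>

definition fw_step :: "nat \<Rightarrow> mat \<Rightarrow> mat \<Rightarrow> mat" where
  "fw_step d A Y = (\<lambda>j k. Y j k - Y j k / real d
     + power_matrix d A Y j k / mtrace d (power_matrix d A Y))"

text \<open>After \<open>d * d\<close> steps the contraction factor is at most
  \<open>exp (- d)\<close>, which outweighs the initial gap of order
  \<open>d\<^sup>2\<close>.\<close>

definition frank_wolfe :: "nat \<Rightarrow> mat \<Rightarrow> mat" where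
  "frank_wolfe d A = (fw_step d A ^^ (d * d)) (\<lambda>_ _. 0)"

section \<open>Inner products of matrices and the dual cone\<close>

lemma minner_add: "minner d E (\<lambda>j k. A j k + t * B j k) = minner d E A + t * minner d E B"
  "minner d (\<lambda>j k. A j k + t * B j k) E = minner d A E + t * minner d B E"
  by (simp_all add: minner_def sum.distrib sum_distrib_left algebra_simps)

lemma minner_scale: "minner d E (\<lambda>j k. t * B j k) = t * minner d E B"
  by (simp add: minner_def sum_distrib_left algebra_simps)

lemma minner_nonneg: "minner d A A \<ge> 0"
  by (simp add: minner_def sum_nonneg)

lemma offnorm2_add: "offnorm2 d (\<lambda>j k. A j k + t * B j k) = offnorm2 d A + 2 * t * minner d (off A) B + t\<^sup>2 * offnorm2 d B"
proof -
  have "off (\<lambda>j k. A j k + t * B j k) j k * off (\<lambda>j k. A j k + t * B j k) j k =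
    off A j k * off A j k + 2 * t * (off A j k * B j k) + t\<^sup>2 * (off B j k * off B j k)" for j k
    by (simp add: off_def power2_eq_square algebra_simps)
  then show ?thesis
    by (simp add: offnorm2_def minner_def sum.distrib sum_distrib_left)
qed

lemma offnorm2_le: "offnorm2 d A \<le> minner d A A"
  unfolding offnorm2_def minner_def by (intro sum_mono) (simp add: off_def)

lemma offnorm2_nonneg: "offnorm2 d A \<ge> 0"
  unfolding offnorm2_def by (rule minner_nonneg)

lemma in_coneD:
  "in_cone d Y \<tau> \<Longrightarrow> l \<ge> 0 \<Longrightarrow> (\<And>v. form d E v \<le> l * dot d v v) \<Longrightarrow> minner d E Y \<le> l * \<tau>"
  by (simp add: in_cone_def)

lemma in_cone_zero: "in_cone d (\<lambda>_ _. 0) 0"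
  by (simp add: in_cone_def minner_def)

lemma in_cone_add:
  assumes "in_cone d Y \<tau>" "in_cone d Z \<sigma>" "a \<ge> 0" "b \<ge> 0"
  shows "in_cone d (\<lambda>j k. a * Y j k + b * Z j k) (a * \<tau> + b * \<sigma>)"
  unfolding in_cone_def
proof (intro allI impI)
  fix E l assume l: "l \<ge> 0" "\<forall>v. form d E v \<le> l * dot d v v"
  have "minner d E (\<lambda>j k. a * Y j k + b * Z j k) = a * minner d E Y + b * minner d E Z"
    by (simp add: minner_add(1) minner_scale)
  also have "\<dots> \<le> a * (l * \<tau>) + b * (l * \<sigma>)"
    using assms l by (intro add_mono mult_left_mono) (auto simp: in_cone_def)
  finally show "minner d E (\<lambda>j k. a * Y j k + b * Z j k) \<le> l * (a * \<tau> + b * \<sigma>)"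
    by (simp add: algebra_simps)
qed

lemma in_cone_mono:
  assumes "in_cone d Y \<tau>" "\<tau> \<le> \<sigma>"
  shows "in_cone d Y \<sigma>"
  unfolding in_cone_def
proof (intro allI impI)
  fix E l assume l: "l \<ge> 0" "\<forall>v. form d E v \<le> l * dot d v v"
  then have "minner d E Y \<le> l * \<tau>" using in_coneD[OF assms(1)] by blast
  also have "\<dots> \<le> l * \<sigma>" using l assms(2) by (intro mult_left_mono)
  finally show "minner d E Y \<le> l * \<sigma>" .
qed

text \<open>Pairing \<open>E\<close> with a sum of rank one matrices gives the sum of the values of
  its form at the vectors. Both the marginals and the iterates enter the cone in this way.\<close>

lemma in_cone_gram: "in_cone d (\<lambda>j k. \<Sum>i\<in>I. B i j * B i k) (\<Sum>i\<in>I. dot d (B i) (B i))"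
  unfolding in_cone_def
proof (intro allI impI)
  fix E l assume l: "l \<ge> 0" "\<forall>v. form d E v \<le> l * dot d v v"
  have "minner d E (\<lambda>j k. \<Sum>i\<in>I. B i j * B i k) = (\<Sum>j<d. \<Sum>i\<in>I. \<Sum>k<d. E j k * (B i j * B i k))"
    unfolding minner_def sum_distrib_left by (intro sum.cong refl sum.swap)
  also have "\<dots> = (\<Sum>i\<in>I. \<Sum>j<d. \<Sum>k<d. E j k * (B i j * B i k))" by (rule sum.swap)
  also have "\<dots> = (\<Sum>i\<in>I. form d E (B i))"
    by (simp add: dot_def mvec_def sum_distrib_left algebra_simps)
  also have "\<dots> \<le> (\<Sum>i\<in>I. l * dot d (B i) (B i))" using l by (intro sum_mono) auto
  finally show "minner d E (\<lambda>j k. \<Sum>i\<in>I. B i j * B i k) \<le> l * (\<Sum>i\<in>I. dot d (B i) (B i))"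
    by (simp add: sum_distrib_left)
qed

lemma dot_cauchy: "(dot d v w)\<^sup>2 \<le> dot d v v * dot d w w"
  using Cauchy_Schwarz_ineq_sum[of v w "{..<d}"] by (simp add: dot_def power2_eq_square)

text \<open>The duality is used twice: \<open>E = v v^T\<close> bounds the form of \<open>Y\<close>
  by \<open>\<tau>\<close>, and then \<open>Y\<close> itself is admissible as
  \<open>E\<close>.\<close>

lemma in_cone_norm:
  assumes Y: "in_cone d Y \<tau>" "\<tau> \<ge> 0"
  shows "minner d Y Y \<le> \<tau>\<^sup>2"
proof -
  have "form d Y v \<le> \<tau> * dot d v v" for v
  proof -
    have f: "form d (\<lambda>j k. v j * v k) w = (dot d v w)\<^sup>2" for w
      by (simp add: dot_def mvec_def power2_eq_square sum_product sum_distrib_left algebra_simps)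
    have "form d Y v = minner d (\<lambda>j k. v j * v k) Y"
      by (simp add: dot_def mvec_def minner_def sum_distrib_left algebra_simps)
    also have "\<dots> \<le> dot d v v * \<tau>"
      by (rule in_coneD[OF Y(1) dot_nonneg]) (simp only: f dot_cauchy)
    finally show ?thesis by (simp add: mult.commute)
  qed
  then have "minner d Y Y \<le> \<tau> * \<tau>" using Y by (auto simp: in_cone_def)
  then show ?thesis by (simp add: power2_eq_square)
qed

lemma entry_le_norm:
  assumes "j < d" "k < d"
  shows "(Y j k)\<^sup>2 \<le> minner d Y Y"
proof -
  have "(Y j k)\<^sup>2 \<le> (\<Sum>k<d. Y j k * Y j k)"
    unfolding power2_eq_square using assms by (intro member_le_sum) auto
  also have "\<dots> \<le> minner d Y Y"
    unfolding minner_def using assms by (intro member_le_sum[of j]) (auto intro!: sum_nonneg)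
  finally show ?thesis .
qed

lemma in_cone_entry:
  assumes "in_cone d Y \<tau>" "\<tau> \<ge> 0" "j < d" "k < d"
  shows "\<bar>Y j k\<bar> \<le> \<tau>"
  using order_trans[OF entry_le_norm[OF assms(3,4)] in_cone_norm[OF assms(1,2)]] assms(2)
  by (simp add: abs_le_square_iff[symmetric])

lemma form_abs_le:
  assumes "\<And>j k. j < d \<Longrightarrow> k < d \<Longrightarrow> \<bar>E j k\<bar> \<le> B j k"
  shows "\<bar>form d E v\<bar> \<le> (\<Sum>j<d. \<Sum>k<d. B j k) * dot d v v"
proof -
  have vv: "(v j)\<^sup>2 \<le> dot d v v" if "j < d" for j
    unfolding dot_def power2_eq_square using that by (intro member_le_sum) auto
  have "\<bar>form d E v\<bar> = \<bar>\<Sum>j<d. \<Sum>k<d. E j k * (v j * v k)\<bar>"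
    by (simp add: dot_def mvec_def sum_distrib_left algebra_simps)
  also have "\<dots> \<le> (\<Sum>j<d. \<Sum>k<d. \<bar>E j k * (v j * v k)\<bar>)"
    by (rule order_trans[OF sum_abs]) (intro sum_mono sum_abs)
  also have "\<dots> \<le> (\<Sum>j<d. \<Sum>k<d. B j k * dot d v v)"
  proof (intro sum_mono)
    fix j k assume jk: "j \<in> {..<d}" "k \<in> {..<d}"
    have "2 * \<bar>v j\<bar> * \<bar>v k\<bar> \<le> \<bar>v j\<bar>\<^sup>2 + \<bar>v k\<bar>\<^sup>2" by (rule sum_squares_bound)
    then have "\<bar>v j * v k\<bar> \<le> dot d v v" using vv[of j] vv[of k] jk by (simp add: abs_mult)
    then show "\<bar>E j k * (v j * v k)\<bar> \<le> B j k * dot d v v"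
      using assms jk unfolding abs_mult[of "E j k"]
      by (intro mult_mono) (auto intro: order_trans[OF abs_ge_zero])
  qed
  finally show ?thesis by (simp add: sum_distrib_right)
qed

lemma symm_gram: "symm d (gram d A)"
  by (simp add: symm_def gram_def mult.commute)

lemma form_shifted:
  "form d (shifted d A Y) v = form d (off (\<lambda>j k. A j k - Y j k)) v + absdiff d A Y * dot d v v"
proof -
  have "(\<Sum>k<d. shifted d A Y j k * v k) = (\<Sum>k<d. off (\<lambda>j k. A j k - Y j k) j k * v k) + absdiff d A Y * v j"
    if "j < d" for j
  proof -
    have "(\<Sum>k<d. shifted d A Y j k * v k) =
       (\<Sum>k<d. off (\<lambda>j k. A j k - Y j k) j k * v k + (if k = j then absdiff d A Y * v j else 0))"
      by (intro sum.cong) (auto simp: shifted_def off_def)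
    then show ?thesis using that by (simp add: sum.distrib)
  qed
  then show ?thesis
    by (simp add: dot_def mvec_def distrib_left sum.distrib sum_distrib_left algebra_simps)
qed

lemma minner_shifted:
  "minner d (shifted d A Y) W = minner d (off (\<lambda>j k. A j k - Y j k)) W + absdiff d A Y * mtrace d W"
proof -
  have "(\<Sum>k<d. shifted d A Y j k * W j k) = (\<Sum>k<d. off (\<lambda>j k. A j k - Y j k) j k * W j k) + absdiff d A Y * W j j"
    if "j < d" for j
  proof -
    have "(\<Sum>k<d. shifted d A Y j k * W j k) =
       (\<Sum>k<d. off (\<lambda>j k. A j k - Y j k) j k * W j k + (if k = j then absdiff d A Y * W j j else 0))"
      by (intro sum.cong) (auto simp: shifted_def off_def)
    then show ?thesis using that by (simp add: sum.distrib)
  qed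
  then show ?thesis
    by (simp add: minner_def mtrace_def sum.distrib sum_distrib_left)
qed

lemma power4_le: "real d ^ 4 \<le> 2 ^ (4 * d)"
proof -
  have "real d ^ 4 \<le> (2 ^ d) ^ 4" by (intro power_mono) (auto simp: less_imp_le of_nat_less_two_power)
  then show ?thesis by (simp add: power_mult[symmetric] mult.commute)
qed

text \<open>\<open>\<kappa>\<close> measures the noise \<open>A - Q\<close> as an off-diagonal form
  and entry by entry. The entries include the diagonal because \<open>absdiff\<close> sums over
  it.\<close>

locale frank_wolfe_setup =
  fixes d :: nat and A Q :: mat and \<kappa> :: real
  assumes d: "d > 0" and A: "symm d A"
    and Q: "in_cone d Q (real d)"
    and \<kappa>: "\<And>v. \<bar>form d (off (\<lambda>j k. A j k - Q j k)) v\<bar> \<le> \<kappa> * dot d v v" "\<kappa> \<ge> 0"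
    and entry: "\<And>j k. j < d \<Longrightarrow> k < d \<Longrightarrow> \<bar>A j k - Q j k\<bar> \<le> \<kappa>"
begin

context
  fixes Y :: mat
  assumes Y: "symm d Y" "in_cone d Y (real d)"
begin

text \<open>If the power matrix has trace \<open>0\<close>, the division makes \<open>W\<close> the
  zero matrix; hence the bounds on its trace are inequalities.\<close>

definition W :: mat where
  "W = (\<lambda>j k. power_matrix d A Y j k / mtrace d (power_matrix d A Y))"

lemma power_matrix_gram: "power_matrix d A Y = gram d ((gram d ^^ (4 * d - 1)) (shifted d A Y))"
proof -
  have "4 * d = Suc (4 * d - 1)" using d by simp
  then have "(gram d ^^ (4 * d)) (shifted d A Y) = (gram d ^^ Suc (4 * d - 1)) (shifted d A Y)" by presburger
  then show ?thesis by (simp add: power_matrix_def)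
qed

lemma symm_W: "symm d W"
  using symm_gram by (simp add: W_def power_matrix_gram symm_def)

lemma in_cone_W: "in_cone d W 1" and mtrace_W: "mtrace d W \<le> 1"
proof -
  define P where "P = power_matrix d A Y"
  define B where "B = (gram d ^^ (4 * d - 1)) (shifted d A Y)"
  have P: "P = (\<lambda>j k. \<Sum>i<d. B i j * B i k)" unfolding P_def power_matrix_gram B_def by (simp add: gram_def)
  have tr: "(\<Sum>i<d. dot d (B i) (B i)) = mtrace d P"
    unfolding mtrace_def P dot_def by (rule sum.swap)
  have nn: "mtrace d P \<ge> 0" unfolding tr[symmetric] by (intro sum_nonneg dot_nonneg)
  have "in_cone d P (mtrace d P)" using in_cone_gram[of d B "{..<d}"] by (simp only: P tr)
  from in_cone_add[OF this in_cone_zero, of "1 / mtrace d P" 0] nn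
  have "in_cone d W (mtrace d P / mtrace d P)" by (simp add: W_def P_def)
  then show "in_cone d W 1" by (rule in_cone_mono) simp
  have "mtrace d W = mtrace d P / mtrace d P"
    unfolding W_def mtrace_def P_def by (rule sum_divide_distrib[symmetric])
  then show "mtrace d W \<le> 1" by simp
qed

lemma absdiff_le: "absdiff d A Y \<le> real d ^ 3 * (\<kappa> + 2)"
proof -
  have "absdiff d A Y \<le> (\<Sum>j<d. \<Sum>k<d. \<kappa> + 2 * real d)"
    unfolding absdiff_def
  proof (intro sum_mono)
    fix j k assume "j \<in> {..<d}" "k \<in> {..<d}"
    then have "\<bar>A j k - Q j k\<bar> \<le> \<kappa>" "\<bar>Q j k\<bar> \<le> real d" "\<bar>Y j k\<bar> \<le> real d"
      using entry in_cone_entry[OF Q] in_cone_entry[OF Y(2)] by auto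
    then show "\<bar>A j k - Y j k\<bar> \<le> \<kappa> + 2 * real d" by linarith
  qed
  also have "\<dots> = real d * real d * (\<kappa> + 2 * real d)" by simp
  also have "\<dots> \<le> real d * real d * (real d * (\<kappa> + 2))"
  proof (intro mult_left_mono)
    have "1 * \<kappa> \<le> real d * \<kappa>" using d \<kappa>(2) by (intro mult_right_mono) auto
    then show "\<kappa> + 2 * real d \<le> real d * (\<kappa> + 2)" by (simp add: algebra_simps)
  qed simp
  finally show ?thesis by (simp add: power3_eq_cube algebra_simps)
qed

text \<open>The largest value of the form of the residual on unit vectors is approximated by its
  pairing with \<open>W\<close>, and by the dual description of \<open>Q\<close> that value times
  \<open>d\<close> bounds the pairing with \<open>Q\<close>.\<close>

lemma linear_oracle:
  "minner d (off (\<lambda>j k. A j k - Y j k)) Q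
    \<le> real d * (minner d (off (\<lambda>j k. A j k - Y j k)) W + (4 + 2 * \<kappa>))"
proof -
  define S where "S = off (\<lambda>j k. A j k - Y j k)"
  define M where "M = shifted d A Y"
  define c where "c = absdiff d A Y"
  define r where "r = minner d M W"
  have c: "c \<ge> 0" by (simp add: c_def absdiff_def sum_nonneg)
  have symM: "symm d M" using A Y(1) by (auto simp: M_def symm_def shifted_def)
  have S: "\<bar>form d S v\<bar> \<le> c * dot d v v" for v
    unfolding c_def absdiff_def by (rule form_abs_le) (simp add: S_def off_def)
  have formM: "form d M v = form d S v + c * dot d v v" for v
    by (simp add: M_def S_def c_def form_shifted)
  have psd: "form d M v \<ge> 0" for v using S[of v] formM[of v] by linarith
  have rW: "r = minner d M (power_matrix d A Y) / mtrace d (power_matrix d A Y)"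
    by (simp add: r_def W_def minner_def sum_divide_distrib)
  have "form d M v \<le> 2 * c * dot d v v" for v using S[of v] formM[of v] by linarith
  then have r2: "r \<le> 2 * c" using in_cone_W c by (auto simp: in_cone_def r_def)
  \<comment> \<open>The relative error \<open>d / 2 ^ (4 * d)\<close> of the power method, applied
    to a quantity of at most \<open>2 * c\<close>.\<close>
  define \<delta> where "\<delta> = 2 * c * (real d / 2 ^ (4 * d))"
  have up: "form d S v \<le> (minner d S W + \<delta>) * dot d v v" for v
  proof -
    have "form d M v \<le> dot d v v * ((1 + real d / 2 ^ (4 * d)) * r)"
      using form_le_power[OF symM psd, of "4 * d" v] d by (simp add: rW power_matrix_def M_def)
    also have "\<dots> = dot d v v * (r + r * (real d / 2 ^ (4 * d)))" by (simp add: algebra_simps)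
    also have "\<dots> \<le> dot d v v * (r + \<delta>)"
      unfolding \<delta>_def using r2 by (intro mult_left_mono add_left_mono mult_right_mono dot_nonneg) auto
    finally have "form d S v \<le> dot d v v * (r + \<delta> - c)" by (simp add: formM algebra_simps)
    also have "\<dots> \<le> dot d v v * (minner d S W + \<delta>)"
    proof (intro mult_left_mono dot_nonneg)
      have "r = minner d S W + c * mtrace d W" by (simp add: r_def M_def S_def c_def minner_shifted)
      moreover have "c * mtrace d W \<le> c" using c mtrace_W by (simp add: mult_left_le)
      ultimately show "r + \<delta> - c \<le> minner d S W + \<delta>" by linarith
    qed
    finally show ?thesis by (simp add: mult.commute)
  qed
  \<comment> \<open>The dual description accepts only nonnegative multipliers. Summing
    \<open>up\<close> over the unit vectors gives the trace of \<open>S\<close>, which is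
    \<open>0\<close>, on the left.\<close>
  have "(\<Sum>k<d. form d S (unit k)) \<le> (\<Sum>k<d. minner d S W + \<delta>)"
  proof (rule sum_mono)
    fix k assume "k \<in> {..<d}"
    then show "form d S (unit k) \<le> minner d S W + \<delta>"
      using up[of "unit k"] by (simp add: dot_unit)
  qed
  moreover have "form d S (unit k) = 0" if "k < d" for k
    using that by (simp add: dot_unit mvec_unit S_def off_def)
  ultimately have "0 \<le> real d * (minner d S W + \<delta>)" by simp
  then have nn: "minner d S W + \<delta> \<ge> 0" using d by (simp add: zero_le_mult_iff)
  have "minner d S Q \<le> (minner d S W + \<delta>) * real d"
    by (rule in_coneD[OF Q nn up])
  also have "\<dots> \<le> (minner d S W + (4 + 2 * \<kappa>)) * real d"
  proof (intro mult_right_mono add_left_mono)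
    have "\<delta> \<le> 2 * (real d ^ 3 * (\<kappa> + 2)) * (real d / 2 ^ (4 * d))"
      unfolding \<delta>_def c_def by (intro mult_right_mono mult_left_mono absdiff_le) auto
    also have "\<dots> = 2 * (\<kappa> + 2) * (real d ^ 4 / 2 ^ (4 * d))"
      by (simp add: eval_nat_numeral power3_eq_cube)
    also have "\<dots> \<le> 2 * (\<kappa> + 2) * 1"
      using power4_le[of d] \<kappa>(2) by (intro mult_left_mono) (auto simp: divide_le_eq)
    finally show "\<delta> \<le> 4 + 2 * \<kappa>" by simp
  qed simp
  finally show ?thesis by (simp add: S_def mult.commute)
qed

lemma fw_step_invariant: "symm d (fw_step d A Y)" "in_cone d (fw_step d A Y) (real d)"
proof -
  have e: "fw_step d A Y = (\<lambda>j k. (1 - 1 / real d) * Y j k + 1 * W j k)"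
    by (simp add: fw_step_def W_def fun_eq_iff algebra_simps)
  show "symm d (fw_step d A Y)" using Y(1) symm_W by (simp add: e symm_def)
  have "in_cone d (fw_step d A Y) ((1 - 1 / real d) * real d + 1 * 1)"
    unfolding e using d by (intro in_cone_add Y in_cone_W) auto
  also have "(1 - 1 / real d) * real d + 1 * 1 = real d" using d by (simp add: field_simps)
  finally show "in_cone d (fw_step d A Y) (real d)" .
qed

text \<open>Expand the square along the direction \<open>d W - Y\<close> with step
  \<open>1 / d\<close>. The quadratic term contributes \<open>4\<close> and the inexact linear step
  \<open>2 * (4 + 2 * \<kappa>)\<close>.\<close>

lemma fw_step_gap:
  "offnorm2 d (\<lambda>j k. A j k - fw_step d A Y j k) - offnorm2 d (\<lambda>j k. A j k - Q j k)
    \<le> (1 - 1 / real d) * (offnorm2 d (\<lambda>j k. A j k - Y j k) - offnorm2 d (\<lambda>j k. A j k - Q j k))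
      + (12 + 4 * \<kappa>)"
proof -
  define R where "R = (\<lambda>j k. A j k - Y j k)"
  define Z where "Z = (\<lambda>j k. (- Y j k) + real d * W j k)"
  have neg: "(\<lambda>j k. (- Y j k)) = (\<lambda>j k. (-1) * Y j k)" by simp
  have Z2: "offnorm2 d Z \<le> 4 * (real d)\<^sup>2"
  proof -
    have "offnorm2 d Z \<le> minner d Z Z" by (rule offnorm2_le)
    also have "\<dots> \<le> (\<Sum>j<d. \<Sum>k<d. 2 * (Y j k * Y j k) + 2 * (real d)\<^sup>2 * (W j k * W j k))"
      unfolding minner_def
    proof (intro sum_mono)
      fix j k
      have "0 \<le> (Y j k + real d * W j k)\<^sup>2" by simp
      then show "Z j k * Z j k \<le> 2 * (Y j k * Y j k) + 2 * (real d)\<^sup>2 * (W j k * W j k)"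
        by (simp add: Z_def power2_eq_square algebra_simps)
    qed
    also have "\<dots> = 2 * minner d Y Y + 2 * (real d)\<^sup>2 * minner d W W"
      by (simp add: minner_def sum.distrib sum_distrib_left)
    also have "\<dots> \<le> 2 * (real d)\<^sup>2 + 2 * (real d)\<^sup>2 * 1\<^sup>2"
      by (intro add_mono mult_left_mono in_cone_norm Y in_cone_W) auto
    finally show ?thesis by simp
  qed
  have "(\<lambda>j k. A j k - fw_step d A Y j k) = (\<lambda>j k. R j k + (- 1 / real d) * Z j k)"
    using d by (simp add: fun_eq_iff R_def Z_def fw_step_def W_def field_simps)
  then have "offnorm2 d (\<lambda>j k. A j k - fw_step d A Y j k) =
      offnorm2 d R + 2 * (- 1 / real d) * minner d (off R) Z + (- 1 / real d)\<^sup>2 * offnorm2 d Z"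
    by (simp only: offnorm2_add)
  also have "minner d (off R) Z = real d * minner d (off R) W - minner d (off R) Y"
    unfolding Z_def minner_add(1) neg minner_scale by simp
  also have "(- 1 / real d)\<^sup>2 * offnorm2 d Z \<le> (- 1 / real d)\<^sup>2 * (4 * (real d)\<^sup>2)"
    by (intro mult_left_mono Z2) simp
  also have "(- 1 / real d)\<^sup>2 * (4 * (real d)\<^sup>2) = 4" using d by (simp add: power2_eq_square)
  finally have 1: "offnorm2 d (\<lambda>j k. A j k - fw_step d A Y j k) \<le>
      offnorm2 d R + 2 * (- 1 / real d) * (real d * minner d (off R) W - minner d (off R) Y) + 4" by simp
  \<comment> \<open>Convexity of the objective: its linearisation at \<open>Y\<close> bounds the gap
    to \<open>Q\<close>.\<close>
  have "(\<lambda>j k. A j k - Q j k) = (\<lambda>j k. R j k + (-1) * (Q j k + (-1) * Y j k))"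
    by (simp add: fun_eq_iff R_def)
  then have "offnorm2 d (\<lambda>j k. A j k - Q j k) = offnorm2 d R + 2 * (-1) * minner d (off R) (\<lambda>j k. Q j k + (-1) * Y j k)
     + (-1)\<^sup>2 * offnorm2 d (\<lambda>j k. Q j k + (-1) * Y j k)"
    by (simp only: offnorm2_add)
  then have 2: "offnorm2 d R - offnorm2 d (\<lambda>j k. A j k - Q j k) \<le> 2 * (minner d (off R) Q - minner d (off R) Y)"
    using offnorm2_nonneg[of d "\<lambda>j k. Q j k + (-1) * Y j k"] by (simp only: minner_add) simp
  have 3: "minner d (off R) Q \<le> real d * (minner d (off R) W + (4 + 2 * \<kappa>))"
    using linear_oracle by (simp add: R_def)
  define G where "G = offnorm2 d R - offnorm2 d (\<lambda>j k. A j k - Q j k)"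
  have "G / real d \<le> 2 * (real d * (minner d (off R) W + (4 + 2 * \<kappa>)) - minner d (off R) Y) / real d"
    using 2 3 unfolding G_def by (intro divide_right_mono) auto
  also have "\<dots> = 2 * (4 + 2 * \<kappa>) + 2 / real d * (real d * minner d (off R) W - minner d (off R) Y)"
    using d by (simp add: field_simps)
  finally show ?thesis using 1 unfolding R_def[symmetric] G_def[symmetric] 
    by (simp add: G_def left_diff_distrib)
qed

end

text \<open>The iterate fits \<open>A\<close> almost as well as \<open>Q\<close> does. Expanding the
  two squared distances, \<open>|Y - Q|\<^sup>2\<close> is this gap plus twice the pairing of
  \<open>A - Q\<close> with \<open>Y - Q\<close>, which trace and operator norm duality bounds by
  \<open>4 \<kappa> d\<close> in total.\<close>

lemma frank_wolfe_error:
  "offnorm2 d (\<lambda>j k. frank_wolfe d A j k - Q j k) \<le> 13 * real d + 10 * real d * \<kappa>"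
proof -
  define T where "T = fw_step d A"
  define G where "G t = offnorm2 d (\<lambda>j k. A j k - (T ^^ t) (\<lambda>_ _. 0) j k) - offnorm2 d (\<lambda>j k. A j k - Q j k)" for t
  define E where "E = (\<lambda>j k. A j k - Q j k)"
  have inv: "symm d ((T ^^ t) (\<lambda>_ _. 0)) \<and> in_cone d ((T ^^ t) (\<lambda>_ _. 0)) (real d)" for t
  proof (induction t)
    case 0
    then show ?case using in_cone_mono[OF in_cone_zero, of "real d" d] by (simp add: symm_def)
  next
    case (Suc t)
    then show ?case using fw_step_invariant by (simp add: T_def)
  qed
  define q where "q = 1 - 1 / real d"
  have q: "0 \<le> q" "q \<le> 1" using d by (auto simp: q_def)
  have "G (Suc t) \<le> q * G t + (12 + 4 * \<kappa>)" for t
    using fw_step_gap inv[of t] by (simp add: G_def T_def q_def)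
  \<comment> \<open>The additive errors sum to a geometric series with limit
    \<open>1 / (1 - q) = d\<close>.\<close>
  then have G: "G t \<le> q ^ t * G 0 + real d * (12 + 4 * \<kappa>)" for t
  proof (induction t)
    case 0
    then show ?case using \<kappa>(2) by simp
  next
    case (Suc t)
    have "G (Suc t) \<le> q * G t + (12 + 4 * \<kappa>)" by (rule Suc.prems)
    also have "\<dots> \<le> q * (q ^ t * G 0 + real d * (12 + 4 * \<kappa>)) + (12 + 4 * \<kappa>)"
      using Suc q by (intro add_right_mono mult_left_mono) auto
    also have "\<dots> = q ^ Suc t * G 0 + (q * real d + 1) * (12 + 4 * \<kappa>)" by (simp add: algebra_simps)
    also have "q * real d + 1 = real d" using d by (simp add: q_def field_simps)
    finally show ?case .
  qed
  have offE: "\<bar>minner d (off E) P\<bar> \<le> \<kappa> * real d" if P: "in_cone d P (real d)" for P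
  proof -
    have "minner d (off E) P \<le> \<kappa> * real d"
      unfolding E_def by (rule in_coneD[OF P \<kappa>(2) abs_le_D1[OF \<kappa>(1)]])
    moreover have "minner d (\<lambda>j k. - off E j k) P \<le> \<kappa> * real d"
    proof -
      have "form d (\<lambda>j k. - off E j k) v = - form d (off E) v" for v
        by (simp add: dot_def mvec_def sum_negf)
      then show ?thesis
        using abs_le_D2[OF \<kappa>(1)] by (intro in_coneD[OF P \<kappa>(2)]) (simp add: E_def)
    qed
    moreover have "minner d (\<lambda>j k. - off E j k) P = - minner d (off E) P"
      by (simp add: minner_def sum_negf)
    ultimately show ?thesis by linarith
  qed
  have "G 0 = offnorm2 d A - offnorm2 d E" by (simp add: G_def E_def)
  also have "A = (\<lambda>j k. E j k + 1 * Q j k)" by (simp add: E_def)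
  also have "offnorm2 d (\<lambda>j k. E j k + 1 * Q j k) - offnorm2 d E = 2 * minner d (off E) Q + offnorm2 d Q"
    unfolding offnorm2_add by simp
  also have "\<dots> \<le> 2 * (\<kappa> * real d) + (real d)\<^sup>2"
    using offE[OF Q] in_cone_norm[OF Q] offnorm2_le[of d Q] by simp
  finally have G0: "G 0 \<le> 2 * (\<kappa> * real d) + (real d)\<^sup>2" .
  \<comment> \<open>The initial gap is at most \<open>(1 + d) * (2 * \<kappa> + d)\<close>; the
    factor \<open>1 + d\<close> is cancelled here by \<open>exp (- d)\<close>.\<close>
  have qT: "q ^ (d * d) * (1 + real d) \<le> 1"
  proof -
    have "q \<le> exp (- 1 / real d)" using exp_ge_add_one_self[of "- 1 / real d"] by (simp add: q_def)
    then have "q ^ (d * d) \<le> exp (- 1 / real d) ^ (d * d)" using q by (intro power_mono)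
    also have "\<dots> = exp (- real d)" using d by (simp flip: exp_of_nat_mult)
    finally have "q ^ (d * d) * (1 + real d) \<le> exp (- real d) * exp (real d)"
      by (intro mult_mono) (auto simp: exp_ge_add_one_self)
    then show ?thesis by (simp flip: exp_add)
  qed
  have "q ^ (d * d) * G 0 \<le> q ^ (d * d) * ((1 + real d) * (2 * \<kappa> + real d))"
  proof (rule mult_left_mono)
    show "G 0 \<le> (1 + real d) * (2 * \<kappa> + real d)"
      using G0 \<kappa>(2) by (simp add: power2_eq_square algebra_simps)
  qed (use q in simp)
  also have "\<dots> = q ^ (d * d) * (1 + real d) * (2 * \<kappa> + real d)" by simp
  also have "\<dots> \<le> 1 * (2 * \<kappa> + real d)"
    using \<kappa>(2) by (intro mult_right_mono qT) auto
  finally have GT: "G (d * d) \<le> 2 * \<kappa> + real d + real d * (12 + 4 * \<kappa>)" using G[of "d * d"] by simp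
  define Y where "Y = frank_wolfe d A"
  have Yc: "in_cone d Y (real d)" using inv[of "d * d"] by (simp add: Y_def frank_wolfe_def T_def)
  have "(\<lambda>j k. A j k - Y j k) = (\<lambda>j k. E j k + (-1) * (Y j k + (-1) * Q j k))"
    by (simp add: E_def)
  then have "offnorm2 d (\<lambda>j k. A j k - Y j k) = offnorm2 d E + 2 * (-1) * minner d (off E) (\<lambda>j k. Y j k + (-1) * Q j k)
     + (-1)\<^sup>2 * offnorm2 d (\<lambda>j k. Y j k + (-1) * Q j k)"
    by (simp only: offnorm2_add)
  moreover have "G (d * d) = offnorm2 d (\<lambda>j k. A j k - Y j k) - offnorm2 d E"
    by (simp add: G_def Y_def E_def frank_wolfe_def T_def)
  ultimately have "offnorm2 d (\<lambda>j k. Y j k - Q j k) = G (d * d) + 2 * (minner d (off E) Y - minner d (off E) Q)"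
    by (simp only: minner_add) simp
  also have "\<dots> \<le> G (d * d) + 4 * (\<kappa> * real d)"
    using offE[OF Q] offE[OF Yc] by simp
  also have "\<dots> \<le> 13 * real d + 10 * real d * \<kappa>"
  proof -
    have "1 * \<kappa> \<le> real d * \<kappa>" using d \<kappa>(2) by (intro mult_right_mono) auto
    then show ?thesis using GT by (simp add: algebra_simps)
  qed
  finally show ?thesis by (simp add: Y_def)
qed

end

text \<open>By polarisation a bound on a symmetric form bounds the lengths of all
  \<open>E v\<close>; the squared Frobenius norm adds up these for the \<open>d\<close> unit
  vectors.\<close>

lemma symm_form_norm:
  assumes E: "symm d E" and f: "\<And>v. \<bar>form d E v\<bar> \<le> \<kappa> * dot d v v" and l: "\<kappa> \<ge> 0"
  shows "minner d E E \<le> real d * \<kappa>\<^sup>2"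
proof -
  have vec: "dot d (mvec d E v) (mvec d E v) \<le> \<kappa>\<^sup>2 * dot d v v" for v
  proof -
    define w where "w = mvec d E v"
    have pol: "4 * t * dot d w w = form d E (\<lambda>j. t * v j + 1 * w j) - form d E (\<lambda>j. t * v j + (-1) * w j)" for t
    proof -
      have t: "(\<lambda>j. t * v j + b * w j) = (\<lambda>j. (\<lambda>j. b * w j) j + t * v j)" for b by (simp add: add.commute)
      have s: "mvec d E (\<lambda>j. b * w j) = (\<lambda>j. b * mvec d E w j)" "dot d (\<lambda>j. b * u j) z = b * dot d u z"
        "dot d z (\<lambda>j. b * u j) = b * dot d z u" for b u z
        by (simp_all add: mvec_def dot_def sum_distrib_left algebra_simps)
      have "dot d v (mvec d E w) = dot d w w" using mvec_symm[OF E, of v w] by (simp add: w_def)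
      moreover have "dot d w (mvec d E v) = dot d w w" by (simp add: w_def)
      ultimately show ?thesis
        unfolding t mvec_add dot_add s by (simp add: algebra_simps)
    qed
    have sq: "dot d (\<lambda>j. t * v j + 1 * w j) (\<lambda>j. t * v j + 1 * w j) + dot d (\<lambda>j. t * v j + (-1) * w j) (\<lambda>j. t * v j + (-1) * w j)
        = 2 * (t\<^sup>2 * dot d v v + dot d w w)" for t
      by (simp add: dot_def sum.distrib[symmetric] sum_distrib_left power2_eq_square algebra_simps)
    have le: "4 * t * dot d w w \<le> \<kappa> * (2 * (t\<^sup>2 * dot d v v + dot d w w))" for t
      using f[of "\<lambda>j. t * v j + 1 * w j"] f[of "\<lambda>j. t * v j + (-1) * w j"]
      unfolding pol sq[symmetric] by (simp only: distrib_left)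
    show ?thesis
    proof (cases "\<kappa> = 0")
      case True
      then show ?thesis using le[of 1] by (simp add: w_def)
    next
      case False
      then have "\<kappa> > 0" using l by simp
      \<comment> \<open>The choice \<open>t = \<kappa>\<close> balances the two squares,
        \<open>w\<close> being expected to be as long as \<open>\<kappa>\<close> times
        \<open>v\<close>.\<close>
      have "\<kappa> * (4 * dot d w w) \<le> \<kappa> * (2 * (\<kappa>\<^sup>2 * dot d v v + dot d w w))" using le[of \<kappa>] by simp
      then have "4 * dot d w w \<le> 2 * (\<kappa>\<^sup>2 * dot d v v + dot d w w)"
        using \<open>\<kappa> > 0\<close> by (simp only: mult_le_cancel_left_pos)
      then show ?thesis by (simp add: w_def)
    qed
  qed
  have "minner d E E = (\<Sum>k<d. dot d (mvec d E (unit k)) (mvec d E (unit k)))"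
  proof -
    have "minner d E E = (\<Sum>k<d. \<Sum>j<d. E j k * E j k)" unfolding minner_def by (rule sum.swap)
    then show ?thesis by (simp add: dot_def mvec_unit)
  qed
  also have "\<dots> \<le> (\<Sum>k<d. \<kappa>\<^sup>2 * dot d (unit k) (unit k))" by (intro sum_mono vec)
  also have "\<dots> = real d * \<kappa>\<^sup>2" by (simp add: dot_unit)
  finally show ?thesis .
qed


section \<open>Reasoning about programs\<close>

text \<open>A total correctness triple for a single start state. The time is only bounded, so
  branches of different cost can be joined.\<close>

definition achieves :: "tape \<Rightarrow> com \<Rightarrow> state \<Rightarrow> nat \<Rightarrow> (state \<Rightarrow> bool) \<Rightarrow> bool" where
  "achieves \<omega> c s B Q \<longleftrightarrow> (\<exists>t s'. exec \<omega> c s t s' \<and> t \<le> B \<and> Q s')"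

lemma achieves_mono:
  "achieves \<omega> c s B Q \<Longrightarrow> B \<le> B' \<Longrightarrow> (\<And>s. Q s \<Longrightarrow> Q' s) \<Longrightarrow> achieves \<omega> c s B' Q'"
  unfolding achieves_def using order_trans by blast

lemma achieves_Seq:
  "achieves \<omega> c1 s B1 P \<Longrightarrow> (\<And>s. P s \<Longrightarrow> achieves \<omega> c2 s B2 Q) \<Longrightarrow> achieves \<omega> (Seq c1 c2) s (B1 + B2) Q"
proof -
  assume 1: "achieves \<omega> c1 s B1 P" and 2: "\<And>s. P s \<Longrightarrow> achieves \<omega> c2 s B2 Q"
  from 1 obtain t1 s1 where *: "exec \<omega> c1 s t1 s1" "t1 \<le> B1" "P s1" by (auto simp: achieves_def)
  from 2[OF this(3)] obtain t2 s2 where "exec \<omega> c2 s1 t2 s2" "t2 \<le> B2" "Q s2" by (auto simp: achieves_def)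
  with * show ?thesis unfolding achieves_def
    by (intro exI[of _ "t1 + t2"] exI[of _ s2]) (auto intro: exec.Seq)
qed

lemma achieves_Cond:
  assumes "holds s b \<Longrightarrow> achieves \<omega> c1 s B1 Q" "\<not> holds s b \<Longrightarrow> achieves \<omega> c2 s B2 Q"
  shows "achieves \<omega> (Cond b c1 c2) s (Suc (max B1 B2)) Q"
proof (cases "holds s b")
  case True
  with assms(1) obtain t s' where "exec \<omega> c1 s t s'" "t \<le> B1" "Q s'" by (auto simp: achieves_def)
  with True show ?thesis unfolding achieves_def
    by (intro exI[of _ "Suc t"] exI[of _ s']) (auto intro: exec.CondTrue)
next
  case False
  with assms(2) obtain t s' where "exec \<omega> c2 s t s'" "t \<le> B2" "Q s'" by (auto simp: achieves_def)
  with False show ?thesis unfolding achieves_def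
    by (intro exI[of _ "Suc t"] exI[of _ s']) (auto intro: exec.CondFalse)
qed

lemma achieves_SetReg: "Q (set_reg r (ival s a) s) \<Longrightarrow> achieves \<omega> (SetReg r a) s 1 Q"
  unfolding achieves_def by (blast intro: exec.SetReg)

lemma achieves_SetCell: "Q (set_cell (ival s a) (rval s e) s) \<Longrightarrow> achieves \<omega> (SetCell a e) s 1 Q"
  unfolding achieves_def by (blast intro: exec.SetCell)

lemma achieves_DrawNormal:
  "Q (tick_drawn (set_cell (ival s a) (snd \<omega> (drawn s)) s)) \<Longrightarrow> achieves \<omega> (DrawNormal a) s 1 Q"
  unfolding achieves_def by (blast intro: exec.DrawNormal)

text \<open>Each pass pays for its test and its body; the last summand \<open>1\<close> is the
  failing test.\<close>

lemma achieves_Loop: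
  assumes step: "\<And>i s. i < m \<Longrightarrow> I i s \<Longrightarrow> holds s b \<and> achieves \<omega> c s B (I (Suc i))"
    and stop: "\<And>s. I m s \<Longrightarrow> \<not> holds s b"
    and init: "I 0 s"
  shows "achieves \<omega> (Loop b c) s (m * (B + 1) + 1) (I m)"
proof -
  have "achieves \<omega> (Loop b c) s ((m - i) * (B + 1) + 1) (I m)" if "i \<le> m" "I i s" for i s
    using that
  proof (induction "m - i" arbitrary: i s)
    case 0
    then have "I m s" by simp
    then show ?case using stop[of s] unfolding achieves_def by (blast intro: exec.LoopFalse le_add2)
  next
    case (Suc n)
    then have i: "i < m" "n = m - Suc i" by auto
    from step[OF i(1) Suc.prems(2)] obtain t1 s1 where 1: "holds s b" "exec \<omega> c s t1 s1" "t1 \<le> B" "I (Suc i) s1"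
      by (auto simp: achieves_def)
    from Suc.hyps(1)[OF i(2) _ 1(4)] i obtain t2 s2 where 2: "exec \<omega> (Loop b c) s1 t2 s2"
      "t2 \<le> (m - Suc i) * (B + 1) + 1" "I m s2"
      by (auto simp: achieves_def)
    have "Suc (t1 + t2) \<le> (m - i) * (B + 1) + 1"
    proof -
      have "m - i = Suc (m - Suc i)" using i by simp
      then show ?thesis using 1(3) 2(2) by simp
    qed
    then show ?case unfolding achieves_def using exec.LoopTrue[OF 1(1,2) 2(1)] 2(3) by blast
  qed
  from this[of 0 s] init show ?thesis by simp
qed

text \<open>The registers from \<open>N\<close> on are free for use.\<close>

definition st :: "nat \<Rightarrow> (nat \<Rightarrow> nat) \<Rightarrow> nat \<Rightarrow> ((nat \<Rightarrow> real) \<Rightarrow> bool) \<Rightarrow> state \<Rightarrow> bool" where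
  "st N R k P s \<longleftrightarrow> (\<forall>r<N. reg s r = R r) \<and> drawn s = k \<and> P (cell s)"

lemma set_simps[simp]:
  "reg (set_reg r x s) = (reg s)(r := x)" "cell (set_reg r x s) = cell s" "drawn (set_reg r x s) = drawn s"
  "reg (set_cell a v s) = reg s" "cell (set_cell a v s) = (cell s)(a := v)" "drawn (set_cell a v s) = drawn s"
  "reg (tick_drawn s) = reg s" "cell (tick_drawn s) = cell s" "drawn (tick_drawn s) = Suc (drawn s)"
  by (simp_all add: set_reg_def set_cell_def tick_drawn_def)

lemma st_SetCell:
  assumes "st N R k P s" "\<And>s. st N R k P s \<Longrightarrow> Q ((cell s)(ival s a := rval s e))"
  shows "achieves \<omega> (SetCell a e) s 1 (st N R k Q)"
  using assms by (intro achieves_SetCell) (auto simp: st_def)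

text \<open>Register \<open>N\<close> runs from \<open>lo\<close> to \<open>hi\<close>, and register \<open>N + 1\<close> keeps pace with a step of its own.\<close>

definition for_loop :: "nat \<Rightarrow> iexp \<Rightarrow> iexp \<Rightarrow> iexp \<Rightarrow> iexp \<Rightarrow> iexp \<Rightarrow> com \<Rightarrow> com" where
  "for_loop N lo hi step lo' step' body =
     Seq (SetReg N lo) (Seq (SetReg (Suc N) lo')
       (Loop (ILess (IReg N) hi)
         (Seq body (Seq (SetReg N (IPlus (IReg N) step)) (SetReg (Suc N) (IPlus (IReg (Suc N)) step'))))))"

text \<open>A pass costs the body, two increments and a test; \<open>3\<close> covers the two
  initial assignments and the failing test. The final counters are recorded because index
  multiplication is done by reading them off after empty loops.\<close>

lemma st_for_loop:
  assumes s: "st N R (k 0) (P 0) s"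
    and iv: "\<And>s. \<forall>r<N. reg s r = R r \<Longrightarrow> ival s lo = a \<and> ival s hi = h \<and> ival s step = u \<and>
      ival s lo' = a' \<and> ival s step' = u'"
    and m: "\<And>i. i \<le> m \<Longrightarrow> a + i * u < h \<longleftrightarrow> i < m"
    and body: "\<And>i s. i < m \<Longrightarrow> st (N + 2) (R(N := a + i * u, Suc N := a' + i * u')) (k i) (P i) s \<Longrightarrow>
      achieves \<omega> body s B (st (N + 2) (R(N := a + i * u, Suc N := a' + i * u')) (k (Suc i)) (P (Suc i)))"
  shows "achieves \<omega> (for_loop N lo hi step lo' step' body) s (m * (B + 3) + 3)
    (st (N + 2) (R(N := a + m * u, Suc N := a' + m * u')) (k m) (P m))"
proof -
  let ?I = "\<lambda>i. st (N + 2) (R(N := a + i * u, Suc N := a' + i * u')) (k i) (P i)"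
  have regs: "\<forall>r<N. reg s r = R r" if "?I i s" for i s using that by (simp add: st_def)
  have "achieves \<omega> (Seq (SetReg N lo) (Seq (SetReg (Suc N) lo')
       (Loop (ILess (IReg N) hi)
         (Seq body (Seq (SetReg N (IPlus (IReg N) step)) (SetReg (Suc N) (IPlus (IReg (Suc N)) step')))))))
       s (1 + (1 + (m * ((B + (1 + 1)) + 1) + 1))) (?I m)"
  proof (rule achieves_Seq[where P="\<lambda>s. st N R (k 0) (P 0) s \<and> reg s N = a"])
    show "achieves \<omega> (SetReg N lo) s 1 (\<lambda>s. st N R (k 0) (P 0) s \<and> reg s N = a)"
      using s iv[of s] by (intro achieves_SetReg) (auto simp: st_def)
    fix s assume s: "st N R (k 0) (P 0) s \<and> reg s N = a"
    show "achieves \<omega> (Seq (SetReg (Suc N) lo')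
       (Loop (ILess (IReg N) hi)
         (Seq body (Seq (SetReg N (IPlus (IReg N) step)) (SetReg (Suc N) (IPlus (IReg (Suc N)) step'))))))
         s (1 + (m * ((B + (1 + 1)) + 1) + 1)) (?I m)"
    proof (rule achieves_Seq[where P="?I 0"])
      show "achieves \<omega> (SetReg (Suc N) lo') s 1 (?I 0)"
        using s iv[of s] by (intro achieves_SetReg) (auto simp: st_def less_Suc_eq)
      fix s assume "?I 0 s"
      then show "achieves \<omega> (Loop (ILess (IReg N) hi)
         (Seq body (Seq (SetReg N (IPlus (IReg N) step)) (SetReg (Suc N) (IPlus (IReg (Suc N)) step')))))
         s (m * ((B + (1 + 1)) + 1) + 1) (?I m)"
      proof (rule achieves_Loop[rotated 2])
        fix s assume "?I m s"
        then show "\<not> holds s (ILess (IReg N) hi)"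
          using iv[OF regs[of m s]] m[of m] by (simp add: st_def)
      next
        fix i s assume i: "i < m" and I: "?I i s"
        have "holds s (ILess (IReg N) hi)"
          using iv[OF regs[OF I]] m[of i] i I by (simp add: st_def)
        moreover have "achieves \<omega> (Seq body (Seq (SetReg N (IPlus (IReg N) step)) (SetReg (Suc N) (IPlus (IReg (Suc N)) step'))))
          s (B + (1 + 1)) (?I (Suc i))"
        proof (rule achieves_Seq[OF body[OF i I]], rule achieves_Seq[where P="st (N + 2) (R(N := a + Suc i * u, Suc N := a' + i * u')) (k (Suc i)) (P (Suc i))"])
          fix s assume s: "st (N + 2) (R(N := a + i * u, Suc N := a' + i * u')) (k (Suc i)) (P (Suc i)) s"
          then show "achieves \<omega> (SetReg N (IPlus (IReg N) step)) s 1
             (st (N + 2) (R(N := a + Suc i * u, Suc N := a' + i * u')) (k (Suc i)) (P (Suc i)))"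
            using iv[of s] by (intro achieves_SetReg) (auto simp: st_def less_Suc_eq)
        next
          fix s assume s: "st (N + 2) (R(N := a + Suc i * u, Suc N := a' + i * u')) (k (Suc i)) (P (Suc i)) s"
          then show "achieves \<omega> (SetReg (Suc N) (IPlus (IReg (Suc N)) step')) s 1 (?I (Suc i))"
            using iv[of s] by (intro achieves_SetReg) (auto simp: st_def less_Suc_eq)
        qed
        ultimately show "holds s (ILess (IReg N) hi) \<and> achieves \<omega>
          (Seq body (Seq (SetReg N (IPlus (IReg N) step)) (SetReg (Suc N) (IPlus (IReg (Suc N)) step')))) s (B + (1 + 1)) (?I (Suc i))"
          by blast
      qed
    qed
  qed
  then show ?thesis unfolding for_loop_def by (rule achieves_mono) (auto simp: algebra_simps)
qed

lemma st_for_loop':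
  assumes "st N R (k 0) (P 0) s"
    and "\<And>s. \<forall>r<N. reg s r = R r \<Longrightarrow> ival s lo = a \<and> ival s hi = h \<and> ival s step = u \<and>
      ival s lo' = a' \<and> ival s step' = u'"
    and "\<And>i. i \<le> m \<Longrightarrow> a + i * u < h \<longleftrightarrow> i < m"
    and "\<And>i s. i < m \<Longrightarrow> st (N + 2) (R(N := a + i * u, Suc N := a' + i * u')) (k i) (P i) s \<Longrightarrow>
      achieves \<omega> body s B (st (N + 2) (R(N := a + i * u, Suc N := a' + i * u')) (k (Suc i)) (P (Suc i)))"
  shows "achieves \<omega> (for_loop N lo hi step lo' step' body) s (m * (B + 3) + 3) (st N R (k m) (P m))"
  by (rule achieves_mono[OF st_for_loop[OF assms]]) (auto simp: st_def)

definition count_loop :: "nat \<Rightarrow> iexp \<Rightarrow> com \<Rightarrow> com" where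
  "count_loop N hi body = for_loop N (INum 0) hi (INum 1) (INum 0) (INum 0) body"

lemma st_count_loop:
  assumes s: "st N R (k 0) (P 0) s"
    and iv: "\<And>s. \<forall>r<N. reg s r = R r \<Longrightarrow> ival s hi = m"
    and body: "\<And>i s. i < m \<Longrightarrow> st (N + 2) (R(N := i, Suc N := 0)) (k i) (P i) s \<Longrightarrow>
      achieves \<omega> body s B (st (N + 2) (R(N := i, Suc N := 0)) (k (Suc i)) (P (Suc i)))"
  shows "achieves \<omega> (count_loop N hi body) s (m * (B + 3) + 3) (st N R (k m) (P m))"
  unfolding count_loop_def
  by (rule st_for_loop'[where a=0 and u=1 and a'=0 and u'=0 and h=m and k=k and P=P])
     (use s iv body in auto)

text \<open>The expression \<open>e\<close> may refer to register \<open>N\<close> for the position relative to \<open>base\<close>.\<close>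

definition fill :: "nat \<Rightarrow> iexp \<Rightarrow> iexp \<Rightarrow> rexp \<Rightarrow> com" where
  "fill N len base e = count_loop N len (SetCell (IPlus base (IReg N)) e)"

text \<open>The expression is evaluated in the partially filled memory, so it may still read the old
  content of the cell that it is about to replace.\<close>

lemma st_fill:
  assumes s: "st N R k (\<lambda>C'. C' = C) s"
    and iv: "\<And>s. \<forall>r<N. reg s r = R r \<Longrightarrow> ival s len = m \<and> ival s base = b"
    and e: "\<And>i s. i < m \<Longrightarrow> \<forall>r<N. reg s r = R r \<Longrightarrow> reg s N = i \<Longrightarrow>
      cell s = (\<lambda>x. if b \<le> x \<and> x < b + i then f (x - b) else C x) \<Longrightarrow> rval s e = f i"
  shows "achieves \<omega> (fill N len base e) s (4 * m + 3)
    (st N R k (\<lambda>C'. C' = (\<lambda>x. if b \<le> x \<and> x < b + m then f (x - b) else C x)))"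
proof -
  have "achieves \<omega> (fill N len base e) s (m * (1 + 3) + 3)
    (st N R k (\<lambda>C'. C' = (\<lambda>x. if b \<le> x \<and> x < b + m then f (x - b) else C x)))"
    unfolding fill_def
  proof (rule st_count_loop[where k="\<lambda>_. k"])
    show "st N R k (\<lambda>C'. C' = (\<lambda>x. if b \<le> x \<and> x < b + 0 then f (x - b) else C x)) s"
      using s by (auto simp: st_def)
    fix i s assume i: "i < m"
      and s: "st (N + 2) (R(N := i, Suc N := 0)) k (\<lambda>C'. C' = (\<lambda>x. if b \<le> x \<and> x < b + i then f (x - b) else C x)) s"
    show "achieves \<omega> (SetCell (IPlus base (IReg N)) e) s 1 (st (N + 2) (R(N := i, Suc N := 0)) k
         (\<lambda>C'. C' = (\<lambda>x. if b \<le> x \<and> x < b + Suc i then f (x - b) else C x)))"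
    proof (rule st_SetCell[OF s])
      fix s assume s: "st (N + 2) (R(N := i, Suc N := 0)) k (\<lambda>C'. C' = (\<lambda>x. if b \<le> x \<and> x < b + i then f (x - b) else C x)) s"
      then have "ival s (IPlus base (IReg N)) = b + i" "rval s e = f i"
        using iv[of s] e[OF i, of s] by (auto simp: st_def)
      then show "(cell s)(ival s (IPlus base (IReg N)) := rval s e) = (\<lambda>x. if b \<le> x \<and> x < b + Suc i then f (x - b) else C x)"
        using s by (auto simp: st_def fun_eq_iff)
    qed
  qed (use iv in auto)
  then show ?thesis by (rule achieves_mono) auto
qed

text \<open>Indices cannot be multiplied, so addresses are advanced by \<open>d\<close>: register
  \<open>N\<close> holds the address of the source row, \<open>N + 2\<close> and
  \<open>N + 4\<close> the two column indices, and \<open>N + 3\<close> the address of the target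
  row.\<close>

definition gram_summand :: "nat \<Rightarrow> rexp \<Rightarrow> rexp" where
  "gram_summand N w =
    RTimes w (RTimes (RCell (IPlus (IReg N) (IReg (N + 2)))) (RCell (IPlus (IReg N) (IReg (N + 4)))))"

definition gram_row :: "nat \<Rightarrow> rexp \<Rightarrow> com" where
  "gram_row N w = count_loop (N + 4) (IReg 0)
    (SetCell (IPlus (IReg (N + 3)) (IReg (N + 4)))
      (RPlus (RCell (IPlus (IReg (N + 3)) (IReg (N + 4)))) (gram_summand N w)))"

text \<open>The rows are stored consecutively from \<open>src\<close> up to \<open>src_end\<close>; register \<open>0\<close> holds their
  length.\<close>

definition add_gram :: "nat \<Rightarrow> iexp \<Rightarrow> iexp \<Rightarrow> iexp \<Rightarrow> rexp \<Rightarrow> com" where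
  "add_gram N src src_end dst w =
    for_loop N src src_end (IReg 0) (INum 0) (INum 0)
     (for_loop (N + 2) (INum 0) (IReg 0) (INum 1) dst (IReg 0) (gram_row N w))"

definition gram_cells :: "nat \<Rightarrow> nat \<Rightarrow> nat \<Rightarrow> nat \<Rightarrow> real \<Rightarrow> (nat \<Rightarrow> real) \<Rightarrow> nat \<Rightarrow> real" where
  "gram_cells d m a b w C x = (if b \<le> x \<and> x < b + d * d
     then C x + w * (\<Sum>i<m. C (a + i * d + (x - b) div d) * C (a + i * d + (x - b) mod d)) else C x)"

lemma st_add_gram:
  assumes s: "st N R k (\<lambda>C'. C' = C) s" and N: "N > 0" and R0: "R 0 = d" and d: "d > 0"
    and iv: "\<And>s. \<forall>r<N. reg s r = R r \<Longrightarrow> ival s src = a \<and> ival s src_end = a + m * d \<and> ival s dst = b"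
    and disj: "a + m * d \<le> b \<or> b + d * d \<le> a"
    and w: "\<And>s. \<forall>r<N. reg s r = R r \<Longrightarrow> (\<And>x. x < b \<or> b + d * d \<le> x \<Longrightarrow> cell s x = C x) \<Longrightarrow> rval s w = v"
  shows "achieves \<omega> (add_gram N src src_end dst w) s (m * (d * (4 * d + 6) + 6) + 3)
    (st N R k (\<lambda>C'. C' = gram_cells d m a b v C))"
proof -
  define g where "g i x = v * (C (a + i * d + (x - b) div d) * C (a + i * d + (x - b) mod d))" for i x
  \<comment> \<open>\<open>C1 i\<close> is the memory after \<open>i\<close> source rows, and
    \<open>C3 i q\<close> the memory when row \<open>i\<close> has been added to the first
    \<open>q\<close> target cells as well. Source cells keep their original content
    throughout.\<close>
  define C1 where "C1 i x = (if b \<le> x \<and> x < b + d * d then C x + (\<Sum>i'<i. g i' x) else C x)" for i x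
  define C3 where "C3 i q x = C1 i x + (if b \<le> x \<and> x < b + q then g i x else 0)" for i q x
  have C3_0: "C3 i 0 = C1 i" for i by (auto simp: C3_def)
  have C3_full: "C3 i (d * d) = C1 (Suc i)" for i by (auto simp: C3_def C1_def fun_eq_iff)
  have C3_out: "C3 i q x = C x" if "x < b \<or> b + d * d \<le> x" "q \<le> d * d" for i q x
    using that by (auto simp: C3_def C1_def)
  have idx: "j * d + l < d * d" if "j < d" "l < d" for j l
  proof -
    have "j * d + l < Suc j * d" using that by simp
    also have "\<dots> \<le> d * d" using that by (intro mult_right_mono) auto
    finally show ?thesis .
  qed
  have "achieves \<omega> (add_gram N src src_end dst w) s (m * ((d * ((d * (1 + 3) + 3) + 3) + 3) + 3) + 3)
    (st N R k (\<lambda>C'. C' = C1 m))"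
    unfolding add_gram_def
  proof (rule st_for_loop'[where k="\<lambda>_. k" and a=a and h="a + m * d" and u=d and a'=0 and u'=0])
    show "st N R k (\<lambda>C'. C' = C1 0) s" using s by (auto simp: st_def C1_def)
    show "ival s src = a \<and> ival s src_end = a + m * d \<and> ival s (IReg 0) = d \<and> ival s (INum 0) = 0 \<and> ival s (INum 0) = 0"
      if "\<forall>r<N. reg s r = R r" for s
      using that iv[OF that] N R0 by simp
    show "a + i * d < a + m * d \<longleftrightarrow> i < m" for i using d by simp
    fix i s assume i: "i < m" and s: "st (N + 2) (R(N := a + i * d, Suc N := 0 + i * 0)) k (\<lambda>C'. C' = C1 i) s"
    let ?R = "R(N := a + i * d, Suc N := 0 + i * 0)"
    show "achieves \<omega> (for_loop (N + 2) (INum 0) (IReg 0) (INum 1) dst (IReg 0) (gram_row N w)) s (d * ((d * (1 + 3) + 3) + 3) + 3) (st (N + 2) ?R k (\<lambda>C'. C' = C1 (Suc i)))"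
      unfolding C3_full[symmetric]
    proof (rule st_for_loop'[where k="\<lambda>_. k" and a=0 and h=d and u=1 and a'=b and u'=d and P="\<lambda>j C'. C' = C3 i (j * d)"])
      show "st (N + 2) ?R k (\<lambda>C'. C' = C3 i (0 * d)) s" using s by (simp add: C3_0)
      show "ival s (INum 0) = 0 \<and> ival s (IReg 0) = d \<and> ival s (INum 1) = 1 \<and> ival s dst = b \<and> ival s (IReg 0) = d"
        if "\<forall>r<N + 2. reg s r = ?R r" for s
      proof -
        have "\<forall>r<N. reg s r = R r" using that by auto
        then show ?thesis using iv[of s] N R0 by simp
      qed
      show "0 + i * 1 < d \<longleftrightarrow> i < d" for i by simp
      fix j s assume j: "j < d" and s: "st (N + 2 + 2) (?R(N + 2 := 0 + j * 1, Suc (N + 2) := b + j * d)) k (\<lambda>C'. C' = C3 i (j * d)) s"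
      let ?R' = "?R(N + 2 := 0 + j * 1, Suc (N + 2) := b + j * d)"
      have 4: "N + 2 + 2 = N + 4" by simp
      have "achieves \<omega> (gram_row N w)
         s (d * (1 + 3) + 3) (st (N + 4) ?R' k (\<lambda>C'. C' = C3 i (j * d + d)))"
        unfolding gram_row_def
      proof (rule st_count_loop[where k="\<lambda>_. k" and P="\<lambda>l C'. C' = C3 i (j * d + l)"])
        show "st (N + 4) ?R' k (\<lambda>C'. C' = C3 i (j * d + 0)) s" using s by (simp only: 4 add_0_right)
        show "ival s (IReg 0) = d" if "\<forall>r<N + 4. reg s r = ?R' r" for s using that N R0 by simp
        fix l s assume l: "l < d" and s: "st (N + 4 + 2) (?R'(N + 4 := l, Suc (N + 4) := 0)) k (\<lambda>C'. C' = C3 i (j * d + l)) s"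
        let ?x = "b + j * d + l"
        have x: "(?x - b) div d = j" "(?x - b) mod d = l" using l by auto
        have lt: "j * d + l < d * d" by (rule idx[OF j l])
        have a_out: "a + i * d + y < b \<or> b + d * d \<le> a + i * d + y" if "y < d" for y
        proof -
          have "a + i * d + y < a + Suc i * d" using that by simp
          also have "\<dots> \<le> a + m * d" using i by (intro add_left_mono mult_right_mono) auto
          finally show ?thesis using disj by linarith
        qed
        show "achieves \<omega> (SetCell (IPlus (IReg (N + 3)) (IReg (N + 4)))
           (RPlus (RCell (IPlus (IReg (N + 3)) (IReg (N + 4))))
             (gram_summand N w)))
           s 1 (st (N + 4 + 2) (?R'(N + 4 := l, Suc (N + 4) := 0)) k (\<lambda>C'. C' = C3 i (j * d + Suc l)))"
        proof (rule st_SetCell[OF s])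
          fix s assume s: "st (N + 4 + 2) (?R'(N + 4 := l, Suc (N + 4) := 0)) k (\<lambda>C'. C' = C3 i (j * d + l)) s"
          then have r: "reg s N = a + i * d" "reg s (N + 2) = j" "reg s (N + 3) = b + j * d" "reg s (N + 4) = l"
            and c: "cell s = C3 i (j * d + l)" and rN: "\<forall>r<N. reg s r = R r"
            by (auto simp: st_def)
          have wv: "rval s w = v" using w[OF rN] C3_out lt by (simp add: c)
          have "rval s (RPlus (RCell (IPlus (IReg (N + 3)) (IReg (N + 4))))
             (gram_summand N w))
             = C3 i (j * d + l) ?x + v * (C (a + i * d + j) * C (a + i * d + l))"
            using C3_out[OF a_out[OF j]] C3_out[OF a_out[OF l]] lt by (simp add: gram_summand_def r[simplified] wv c)
          also have "v * (C (a + i * d + j) * C (a + i * d + l)) = g i ?x" by (simp only: g_def x)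
          also have "C3 i (j * d + l) ?x = C1 i ?x" by (simp add: C3_def)
          finally have val: "rval s (RPlus (RCell (IPlus (IReg (N + 3)) (IReg (N + 4))))
             (gram_summand N w))
             = C1 i ?x + g i ?x" .
          have addr: "ival s (IPlus (IReg (N + 3)) (IReg (N + 4))) = ?x" by (simp add: r[simplified])
          show "(cell s)(ival s (IPlus (IReg (N + 3)) (IReg (N + 4))) := rval s (RPlus (RCell (IPlus (IReg (N + 3)) (IReg (N + 4))))
             (gram_summand N w))) = C3 i (j * d + Suc l)"
            unfolding val addr c by (auto simp: fun_eq_iff C3_def)
        qed
      qed
      then show "achieves \<omega> (gram_row N w)
         s (d * (1 + 3) + 3) (st (N + 2 + 2) ?R' k (\<lambda>C'. C' = C3 i (Suc j * d)))"
        by (simp only: 4 mult_Suc add.commute[of d])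
    qed
  qed
  moreover have "C1 m = gram_cells d m a b v C"
    by (auto simp: C1_def gram_cells_def g_def sum_distrib_left fun_eq_iff)
  ultimately show ?thesis by (elim achieves_mono) (auto simp: algebra_simps)
qed


section \<open>The program\<close>

abbreviation acc_cell :: iexp where
  "acc_cell \<equiv> IPlus (IReg 8) (INum 2)"

definition add_abs :: com where
  "add_abs = Cond (RLess (RCell (IPlus (IReg 5) (IReg 11))) (RNum 0))
     (SetCell acc_cell (RMinus (RCell acc_cell) (RCell (IPlus (IReg 5) (IReg 11)))))
     (SetCell acc_cell (RPlus (RCell acc_cell) (RCell (IPlus (IReg 5) (IReg 11)))))"

text \<open>Squaring cannot be done in place. Two squarings bring the result back to where it
  started, with the second work matrix as scratch space; targets are cleared first because
  \<open>add_gram\<close> accumulates.\<close>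

definition square_twice :: com where
  "square_twice =
    Seq (fill 13 (IReg 2) (IReg 6) (RNum 0))
   (Seq (add_gram 13 (IReg 5) (IReg 6) (IReg 6) (RNum 1))
   (Seq (fill 13 (IReg 2) (IReg 5) (RNum 0))
        (add_gram 13 (IReg 6) (IReg 7) (IReg 5) (RNum 1))))"

definition move_iterate :: rexp where
  "move_iterate =
    RPlus (RMinus (RCell (IPlus (IReg 4) (IReg 11))) (RDivide (RCell (IPlus (IReg 4) (IReg 11))) (RCell (IReg 8))))
      (RDivide (RCell (IPlus (IReg 5) (IReg 11))) (RCell acc_cell))"

text \<open>The diagonal of a matrix stored by rows has stride \<open>d + 1\<close>; the second
  counter of \<open>for_loop\<close> walks along it, once to write the shift and once to sum the
  trace.\<close>

definition fw_body :: com where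
  "fw_body =
    Seq (fill 11 (IReg 2) (IReg 5) (RMinus (RCell (IPlus (IReg 3) (IReg 11))) (RCell (IPlus (IReg 4) (IReg 11)))))
   (Seq (SetCell acc_cell (RNum 0))
   (Seq (count_loop 11 (IReg 2) add_abs)
   (Seq (for_loop 11 (INum 0) (IReg 0) (INum 1) (INum 0) (IPlus (IReg 0) (INum 1))
      (SetCell (IPlus (IReg 5) (IReg 12)) (RCell acc_cell)))
   (Seq (count_loop 11 (IPlus (IReg 0) (IReg 0)) square_twice)
   (Seq (SetCell acc_cell (RNum 0))
   (Seq (for_loop 11 (INum 0) (IReg 0) (INum 1) (INum 0) (IPlus (IReg 0) (INum 1))
      (SetCell acc_cell (RPlus (RCell acc_cell) (RCell (IPlus (IReg 5) (IReg 12))))))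
    (fill 11 (IReg 2) (IReg 4) move_iterate)))))))"

definition arr :: "nat \<Rightarrow> (nat \<Rightarrow> real) \<Rightarrow> nat \<Rightarrow> mat \<Rightarrow> bool" where
  "arr d C b A \<longleftrightarrow> (\<forall>j<d. \<forall>k<d. C (b + (j * d + k)) = A j k)"

lemma index_less:
  assumes "j < d" "k < (d::nat)"
  shows "j * d + k < d * d"
proof -
  have "j * d + k < Suc j * d" using assms by simp
  also have "\<dots> \<le> d * d" using assms by (intro mult_right_mono) auto
  finally show ?thesis .
qed

lemma sum_flat: "(\<Sum>q<m * d. f q) = (\<Sum>j<m. \<Sum>k<d. f (j * d + k))" for f :: "nat \<Rightarrow> real"
proof (induction m)
  case (Suc m)
  have *: "sum f {..<a + k} = sum f {..<a} + (\<Sum>i<k. f (a + i))" for a k :: nat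
    by (induction k) simp_all
  show ?case using *[of "m * d" d] Suc by (simp add: add.commute)
qed simp

lemma arrI_flat:
  assumes "\<And>q. q < d * d \<Longrightarrow> C (b + q) = f q" "\<And>j k. j < d \<Longrightarrow> k < d \<Longrightarrow> f (j * d + k) = A j k"
  shows "arr d C b A"
  using assms index_less by (simp add: arr_def)

lemma arr_gram_cells:
  assumes src: "arr d C a A" and dst: "\<And>q. q < d * d \<Longrightarrow> C (b + q) = 0"
  shows "arr d (gram_cells d d a b 1 C) b (gram d A)"
  unfolding arr_def
proof (intro allI impI)
  fix j k assume jk: "j < d" "k < d"
  have "gram_cells d d a b 1 C (b + (j * d + k)) = (\<Sum>i<d. C (a + i * d + j) * C (a + i * d + k))"
    using index_less[OF jk] dst[OF index_less[OF jk]] jk by (simp add: gram_cells_def)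
  also have "\<dots> = gram d A j k"
    using src jk by (simp add: gram_def arr_def add.assoc)
  finally show "gram_cells d d a b 1 C (b + (j * d + k)) = gram d A j k" .
qed

text \<open>Names the current memory, as the loop rules expect an equation for it.\<close>

lemma st_exact: "st N R k P s \<Longrightarrow> st N R k (\<lambda>C'. C' = cell s) s \<and> P (cell s)"
  by (simp add: st_def)

text \<open>From cell \<open>bA\<close> on, the memory holds four \<open>d \<times> d\<close> matrices (the noisy matrix, the
  Frank-Wolfe iterate and two work matrices), the normal samples, and at \<open>bS\<close> the scalars
  \<open>d\<close> and \<open>n\<close> and an accumulator.\<close>

locale layout =
  fixes d n :: nat
  assumes d: "d > 0"
begin

text \<open>The extra \<open>d * d\<close> puts all matrices beyond the output cells, whatever
  \<open>n\<close> is; subtracting it again yields the end of the data.\<close>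

definition "bA = 1 + n * d + d * d"
definition "bY = bA + d * d"
definition "bM = bY + d * d"
definition "bT = bM + d * d"
definition "bG = bT + d * d"
definition "bS = bG + (d * d + d) + (d * d + d)"

lemmas bases = bA_def bY_def bM_def bT_def bG_def bS_def

definition frame :: "nat \<Rightarrow> (nat \<Rightarrow> nat) \<Rightarrow> bool" where
  "frame N R \<longleftrightarrow> 9 \<le> N \<and> R 0 = d \<and> R 1 = n \<and> R 2 = d * d \<and> R 3 = bA \<and> R 4 = bY \<and> R 5 = bM \<and>
  R 6 = bT \<and> R 7 = bG \<and> R 8 = bS"

lemma frame_regs:
  assumes "frame N R" "\<forall>r<N. reg s r = R r"
  shows "reg s 0 = d" "reg s (Suc 0) = n" "reg s 2 = d * d" "reg s 3 = bA" "reg s 4 = bY" "reg s 5 = bM"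
    "reg s 6 = bT" "reg s 7 = bG" "reg s 8 = bS"
  using assms by (auto simp: frame_def)

lemma frame_ext: "frame N R \<Longrightarrow> frame (N + 2) (R(N := x, Suc N := y))"
  by (auto simp: frame_def)

lemma square_step:
  assumes R: "frame 13 R" and s: "st 13 R k (\<lambda>C'. C' = C) s" and A: "arr d C bM A"
  shows "achieves \<omega> square_twice s
      ((4 * (d * d) + 3) + ((d * (d * (4 * d + 6) + 6) + 3) + ((4 * (d * d) + 3) + (d * (d * (4 * d + 6) + 6) + 3))))
     (st 13 R k (\<lambda>C'. (\<forall>x. x < bM \<or> bG \<le> x \<longrightarrow> C' x = C x) \<and> arr d C' bM (gram d (gram d A))))"
proof -
  define C1 where "C1 x = (if bT \<le> x \<and> x < bT + d * d then 0 else C x)" for x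
  define C2 where "C2 = gram_cells d d bM bT 1 C1"
  define C3 where "C3 x = (if bM \<le> x \<and> x < bM + d * d then 0 else C2 x)" for x
  define C4 where "C4 = gram_cells d d bT bM 1 C3"
  have idx: "j * d + k < d * d" if "j < d" "k < d" for j k using index_less that .
  have "arr d C1 bM A"
    unfolding arr_def
  proof (intro allI impI)
    fix j k assume "j < d" "k < d"
    then show "C1 (bM + (j * d + k)) = A j k" using A idx[of j k] by (simp add: arr_def C1_def bT_def)
  qed
  then have 2: "arr d C2 bT (gram d A)" unfolding C2_def by (rule arr_gram_cells) (simp add: C1_def)
  then have "arr d C3 bT (gram d A)" using idx by (auto simp: arr_def C3_def bT_def)
  then have 4: "arr d C4 bM (gram d (gram d A))" unfolding C4_def by (rule arr_gram_cells) (simp add: C3_def)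
  have out: "C4 x = C x" if "x < bM \<or> bG \<le> x" for x
    using that by (auto simp: C4_def C3_def C2_def C1_def gram_cells_def bG_def bT_def)
  have "achieves \<omega> square_twice s
      ((4 * (d * d) + 3) + ((d * (d * (4 * d + 6) + 6) + 3) + ((4 * (d * d) + 3) + (d * (d * (4 * d + 6) + 6) + 3))))
     (st 13 R k (\<lambda>C'. C' = C4))"
    unfolding square_twice_def
  proof (rule achieves_Seq)
    show "achieves \<omega> (fill 13 (IReg 2) (IReg 6) (RNum 0)) s (4 * (d * d) + 3) (st 13 R k (\<lambda>C'. C' = C1))"
      unfolding C1_def
      by (rule st_fill[OF s, where f="\<lambda>_. 0"]) (auto simp: frame_regs[OF R])
    fix s assume s: "st 13 R k (\<lambda>C'. C' = C1) s"
    show "achieves \<omega> (Seq (add_gram 13 (IReg 5) (IReg 6) (IReg 6) (RNum 1))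
      (Seq (fill 13 (IReg 2) (IReg 5) (RNum 0))
           (add_gram 13 (IReg 6) (IReg 7) (IReg 5) (RNum 1)))) s
      ((d * (d * (4 * d + 6) + 6) + 3) + ((4 * (d * d) + 3) + (d * (d * (4 * d + 6) + 6) + 3)))
     (st 13 R k (\<lambda>C'. C' = C4))"
    proof (rule achieves_Seq)
      show "achieves \<omega> (add_gram 13 (IReg 5) (IReg 6) (IReg 6) (RNum 1)) s (d * (d * (4 * d + 6) + 6) + 3) (st 13 R k (\<lambda>C'. C' = C2))"
        unfolding C2_def
        by (rule st_add_gram[OF s]) (use d R in \<open>auto simp: frame_regs[OF R] bT_def frame_def\<close>)
      fix s assume s: "st 13 R k (\<lambda>C'. C' = C2) s"
      show "achieves \<omega> (Seq (fill 13 (IReg 2) (IReg 5) (RNum 0))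
           (add_gram 13 (IReg 6) (IReg 7) (IReg 5) (RNum 1))) s ((4 * (d * d) + 3) + (d * (d * (4 * d + 6) + 6) + 3))
     (st 13 R k (\<lambda>C'. C' = C4))"
      proof (rule achieves_Seq)
        show "achieves \<omega> (fill 13 (IReg 2) (IReg 5) (RNum 0)) s (4 * (d * d) + 3) (st 13 R k (\<lambda>C'. C' = C3))"
          unfolding C3_def
          by (rule st_fill[OF s, where f="\<lambda>_. 0"]) (auto simp: frame_regs[OF R])
        fix s assume s: "st 13 R k (\<lambda>C'. C' = C3) s"
        show "achieves \<omega> (add_gram 13 (IReg 6) (IReg 7) (IReg 5) (RNum 1)) s (d * (d * (4 * d + 6) + 6) + 3) (st 13 R k (\<lambda>C'. C' = C4))"
          unfolding C4_def
          by (rule st_add_gram[OF s]) (use d R in \<open>auto simp: frame_regs[OF R] bT_def bG_def frame_def\<close>)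
      qed
    qed
  qed
  then show ?thesis by (rule achieves_mono) (auto simp: st_def 4 out)
qed

definition "square_time = 2 * (4 * (d * d) + 3) + 2 * (d * (d * (4 * d + 6) + 6) + 3)"

definition "step_time = (4 * (d * d) + 3) + (1 + ((d * d * 5 + 3) + ((d * 4 + 3) + ((2 * d * (square_time + 3) + 3)
  + (1 + ((d * 4 + 3) + (4 * (d * d) + 3)))))))"

lemma fw_body:
  assumes R: "frame 11 R" and s: "st 11 R k (\<lambda>C'. C' = C) s"
    and A: "arr d C bA A" and Y: "arr d C bY Y" and dR: "C bS = real d"
  shows "achieves \<omega> fw_body s step_time (st 11 R k
    (\<lambda>C'. (\<forall>x. x < bY \<or> bG \<le> x \<and> x \<noteq> bS + 2 \<longrightarrow> C' x = C x) \<and> arr d C' bY (fw_step d A Y)))"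
proof -
  have idx: "j * d + k < d * d" if "j < d" "k < d" for j k using index_less that .
  have sum_step: "j * d + j < d * d" if "j < d" for j using idx[OF that that] .
  \<comment> \<open>Memory snapshots: \<open>C1\<close> has the residual in place,
    \<open>C3 q\<close> also the sum of its first \<open>q\<close> absolute values, and
    \<open>C4 j\<close> the first \<open>j\<close> diagonal entries replaced.\<close>
  define f1 where "f1 q = C (bA + q) - C (bY + q)" for q
  define C1 where "C1 x = (if bM \<le> x \<and> x < bM + d * d then f1 (x - bM) else C x)" for x
  define C2 where "C2 = C1(bS + 2 := 0)"
  define C3 where "C3 q = C1(bS + 2 := (\<Sum>q'<q. \<bar>f1 q'\<bar>))" for q
  define C4 where "C4 j x = (if \<exists>i<j. x = bM + (i * d + i) then absdiff d A Y else C3 (d * d) x)" for j x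
  define M where "M = shifted d A Y"
  define P where "P = power_matrix d A Y"
  have f1: "f1 (j * d + k) = A j k - Y j k" if "j < d" "k < d" for j k
    using A Y that by (simp add: f1_def arr_def)
  have acc: "C3 (d * d) (bS + 2) = absdiff d A Y"
    using f1 by (simp add: C3_def sum_flat absdiff_def)
  have M: "arr d (C4 d) bM M"
    unfolding arr_def
  proof (intro allI impI)
    fix j k assume jk: "j < d" "k < d"
    have "(\<exists>i<d. j * d + k = i * d + i) \<longleftrightarrow> j = k"
    proof
      assume "\<exists>i<d. j * d + k = i * d + i"
      then obtain i where i: "i < d" "j * d + k = i * d + i" by auto
      have "(j * d + k) div d = j" "(j * d + k) mod d = k" "(i * d + i) div d = i" "(i * d + i) mod d = i"
        using jk i(1) by auto
      with i(2) show "j = k" by metis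
    qed (use jk in auto)
    moreover have "C3 (d * d) (bM + (j * d + k)) = A j k - Y j k"
      using idx[OF jk] f1[OF jk] by (simp add: C3_def C1_def bS_def bG_def bT_def)
    ultimately show "C4 d (bM + (j * d + k)) = M j k"
      using jk by (simp add: C4_def M_def shifted_def)
  qed
  have C4_out: "C4 d x = C x" if "x < bM \<or> bT \<le> x \<and> x \<noteq> bS + 2" for x
    using that sum_step by (auto simp: C4_def C3_def C1_def bS_def bG_def bT_def)
  have "achieves \<omega> fw_body s ((4 * (d * d) + 3) + (1 + ((d * d * (2 + 3) + 3) + ((d * (1 + 3) + 3) + ((2 * d * (square_time + 3) + 3)
      + (1 + ((d * (1 + 3) + 3) + (4 * (d * d) + 3)))))))) (st 11 R k
    (\<lambda>C'. (\<forall>x. x < bY \<or> bG \<le> x \<and> x \<noteq> bS + 2 \<longrightarrow> C' x = C x) \<and> arr d C' bY (fw_step d A Y)))"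
    unfolding fw_body_def
  proof (rule achieves_Seq[where P="st 11 R k (\<lambda>C'. C' = C1)"], goal_cases)
    case 1
    show ?case
      unfolding C1_def[abs_def]
      by (rule st_fill[OF s, where f=f1 and b=bM])
         (auto simp: frame_regs[OF R] f1_def bM_def bY_def)
  next
    case (2 s)
    then have s: "st 11 R k (\<lambda>C'. C' = C1) s" by (simp add: C1_def[abs_def])
    show ?case
    proof (rule achieves_Seq[where P="st 11 R k (\<lambda>C'. C' = C2)"], goal_cases)
      case 1
      show ?case
        by (rule st_SetCell[OF s, where Q="\<lambda>C'. C' = C2"]) (auto simp: st_def frame_regs[OF R] C2_def)
    next
      case (2 s)
      show ?case
      proof (rule achieves_Seq[where P="st 11 R k (\<lambda>C'. C' = C3 (d * d))"], goal_cases)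
        case 1
        show ?case
        proof (rule st_count_loop[where k="\<lambda>_. k" and P="\<lambda>q C'. C' = C3 q"])
          show "st 11 R k (\<lambda>C'. C' = C3 0) s" using 2 by (simp add: C2_def C3_def)
          fix q s assume q: "q < d * d" and s: "st (11 + 2) (R(11 := q, Suc 11 := 0)) k (\<lambda>C'. C' = C3 q) s"
          have r: "\<forall>r<11. reg s r = R r" "reg s 11 = q" and c: "cell s = C3 q" using s by (auto simp: st_def)
          have "C3 q (bM + q) = f1 q" using q by (simp add: C3_def C1_def bS_def bG_def bT_def)
          moreover have "C3 q (bS + 2) = (\<Sum>q'<q. \<bar>f1 q'\<bar>)" by (simp add: C3_def)
          ultimately have v: "rval s (RCell (IPlus (IReg 5) (IReg 11))) = f1 q"
              "rval s (RCell acc_cell) = (\<Sum>q'<q. \<bar>f1 q'\<bar>)"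
            by (simp_all add: frame_regs[OF R r(1)] r(2) c)
          have "achieves \<omega> add_abs
              s (Suc (max 1 1)) (st (11 + 2) (R(11 := q, Suc 11 := 0)) k (\<lambda>C'. C' = C3 (Suc q)))"
            unfolding add_abs_def
          proof (rule achieves_Cond)
            assume "holds s (RLess (RCell (IPlus (IReg 5) (IReg 11))) (RNum 0))"
            then have "f1 q < 0" by (simp only: holds.simps v rval.simps(1) of_int_0)
            then show "achieves \<omega> (SetCell acc_cell (RMinus (RCell acc_cell) (RCell (IPlus (IReg 5) (IReg 11)))))
              s 1 (st (11 + 2) (R(11 := q, Suc 11 := 0)) k (\<lambda>C'. C' = C3 (Suc q)))"
              using s by (intro achieves_SetCell, unfold rval.simps(4) v)
                (auto simp: st_def frame_regs[OF R r(1)] C3_def)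
          next
            assume "\<not> holds s (RLess (RCell (IPlus (IReg 5) (IReg 11))) (RNum 0))"
            then have "\<not> f1 q < 0" by (simp only: holds.simps v rval.simps(1) of_int_0 not_False_eq_True)
            then show "achieves \<omega> (SetCell acc_cell (RPlus (RCell acc_cell) (RCell (IPlus (IReg 5) (IReg 11)))))
              s 1 (st (11 + 2) (R(11 := q, Suc 11 := 0)) k (\<lambda>C'. C' = C3 (Suc q)))"
              using s by (intro achieves_SetCell, unfold rval.simps(3) v)
                (auto simp: st_def frame_regs[OF R r(1)] C3_def)
          qed
          then show "achieves \<omega> add_abs
              s 2 (st (11 + 2) (R(11 := q, Suc 11 := 0)) k (\<lambda>C'. C' = C3 (Suc q)))"
            by (simp add: numeral_2_eq_2)
        qed (auto simp: frame_regs[OF R])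
      next
        case (2 s)
        show ?case
        proof (rule achieves_Seq[where P="st 11 R k (\<lambda>C'. C' = C4 d)"], goal_cases)
          case 1
          show ?case
          proof (rule st_for_loop'[where k="\<lambda>_. k" and P="\<lambda>j C'. C' = C4 j" and a=0 and u=1 and a'=0 and u'="d + 1" and h=d])
            show "st 11 R k (\<lambda>C'. C' = C4 0) s" using 2 by (simp add: C4_def[abs_def])
            fix j s assume j: "j < d" and s: "st (11 + 2) (R(11 := 0 + j * 1, Suc 11 := 0 + j * (d + 1))) k (\<lambda>C'. C' = C4 j) s"
            have r: "\<forall>r<11. reg s r = R r" "reg s 12 = j * (d + 1)" and c: "cell s = C4 j" using s by (auto simp: st_def)
            have "C4 j (bS + 2) = absdiff d A Y" using acc by (simp add: C4_def)
            then show "achieves \<omega> (SetCell (IPlus (IReg 5) (IReg 12)) (RCell acc_cell)) s 1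
               (st (11 + 2) (R(11 := 0 + j * 1, Suc 11 := 0 + j * (d + 1))) k (\<lambda>C'. C' = C4 (Suc j)))"
              using s by (intro achieves_SetCell)
                (auto simp: st_def frame_regs[OF R r(1)] r(2) c C4_def less_Suc_eq fun_eq_iff algebra_simps)
          qed (auto simp: frame_regs[OF R])
        next
          case (2 s)
          \<comment> \<open>After \<open>l\<close> passes the work matrix holds \<open>2 * l\<close>
            squarings; the scratch matrix is left unspecified.\<close>
          define Q where "Q l C' \<longleftrightarrow> (\<forall>x. x < bM \<or> bG \<le> x \<longrightarrow> C' x = C4 d x) \<and> arr d C' bM ((gram d ^^ (2 * l)) M)" for l C'
          show ?case
          proof (rule achieves_Seq[where P="st 11 R k (Q (2 * d))"], goal_cases)
            case 1
            show ?case
            proof (rule st_count_loop[where k="\<lambda>_. k" and P=Q])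
              show "st 11 R k (Q 0) s" using 2 M by (simp add: Q_def st_def)
              fix l s assume l: "l < 2 * d" and s: "st (11 + 2) (R(11 := l, Suc 11 := 0)) k (Q l) s"
              note s' = conjunct1[OF st_exact[OF s]] and q = conjunct2[OF st_exact[OF s]]
              have fr: "frame 13 (R(11 := l, Suc 11 := 0))" using frame_ext[OF R, of l 0] by simp
              have t: "square_time = (4 * (d * d) + 3) + ((d * (d * (4 * d + 6) + 6) + 3) + ((4 * (d * d) + 3) + (d * (d * (4 * d + 6) + 6) + 3)))"
                by (simp add: square_time_def)
              have 13: "11 + 2 = (13::nat)" by simp
              have g2: "(gram d ^^ (2 * Suc l)) M = gram d (gram d ((gram d ^^ (2 * l)) M))" by simp
              have QS: "Q (Suc l) C'" if "\<forall>x. x < bM \<or> bG \<le> x \<longrightarrow> C' x = cell s x"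
                "arr d C' bM (gram d (gram d ((gram d ^^ (2 * l)) M)))" for C'
                unfolding Q_def g2 using that q by (simp add: Q_def)
              show "achieves \<omega> square_twice s square_time (st (11 + 2) (R(11 := l, Suc 11 := 0)) k (Q (Suc l)))"
                unfolding t 13
                by (rule achieves_mono[OF square_step[OF fr s'[unfolded 13] conjunct2[OF q[unfolded Q_def]]]])
                   (auto simp: st_def intro!: QS)
            qed (auto simp: frame_regs[OF R])
          next
            case (2 s)
            define C5 where "C5 = cell s"
            from 2 have s: "st 11 R k (\<lambda>C'. C' = C5) s" and Q5: "Q (2 * d) C5" by (auto simp: st_def C5_def)
            have P5: "arr d C5 bM P" using Q5 by (simp add: Q_def P_def power_matrix_def M_def)
            have C5_out: "C5 x = C x" if "x < bM \<or> bG \<le> x \<and> x \<noteq> bS + 2" for x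
            proof -
              have "C5 x = C4 d x" using that Q5 by (auto simp: Q_def)
              also have "\<dots> = C x" using that by (intro C4_out) (auto simp: bG_def)
              finally show ?thesis .
            qed
            define C6 where "C6 j = C5(bS + 2 := (\<Sum>i<j. P i i))" for j
            have M6: "C6 j (bM + q) = C5 (bM + q)" if "q < d * d" for j q
              using that by (simp add: C6_def bS_def bG_def bT_def)
            define f8 where "f8 q = C (bY + q) - C (bY + q) / real d + C5 (bM + q) / mtrace d P" for q
            define C8 where "C8 x = (if bY \<le> x \<and> x < bY + d * d then f8 (x - bY) else C6 d x)" for x
            have fin8: "(\<forall>x. x < bY \<or> bG \<le> x \<and> x \<noteq> bS + 2 \<longrightarrow> C8 x = C x) \<and> arr d C8 bY (fw_step d A Y)"
            proof (intro conjI allI impI)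
              fix x assume "x < bY \<or> bG \<le> x \<and> x \<noteq> bS + 2"
              then show "C8 x = C x" using C5_out[of x]
                by (auto simp: C8_def C6_def bG_def bT_def bM_def bS_def)
            next
              show "arr d C8 bY (fw_step d A Y)"
                by (rule arrI_flat[where f=f8])
                   (use P5 Y in \<open>auto simp: C8_def f8_def arr_def fw_step_def P_def\<close>)
            qed
            show ?case
            proof (rule achieves_Seq[where P="st 11 R k (\<lambda>C'. C' = C6 0)"], goal_cases)
              case 1
              show ?case
                by (rule st_SetCell[OF s, where Q="\<lambda>C'. C' = C6 0"]) (auto simp: st_def frame_regs[OF R] C6_def)
            next
              case (2 s)
              show ?case
              proof (rule achieves_Seq[where P="st 11 R k (\<lambda>C'. C' = C6 d)"], goal_cases)
                case 1
                show ?case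
                proof (rule st_for_loop'[where k="\<lambda>_. k" and P="\<lambda>j C'. C' = C6 j" and a=0 and u=1 and a'=0 and u'="d + 1" and h=d])
                  show "st 11 R k (\<lambda>C'. C' = C6 0) s" by fact
                  fix j s assume j: "j < d" and s: "st (11 + 2) (R(11 := 0 + j * 1, Suc 11 := 0 + j * (d + 1))) k (\<lambda>C'. C' = C6 j) s"
                  have r: "\<forall>r<11. reg s r = R r" "reg s 12 = j * d + j" and c: "cell s = C6 j" using s by (auto simp: st_def)
                  have "C6 j (bM + (j * d + j)) = P j j" using M6[OF sum_step[OF j]] P5 j by (simp add: arr_def)
                  moreover have "C6 j (bS + 2) = (\<Sum>i<j. P i i)" by (simp add: C6_def)
                  ultimately show "achieves \<omega> (SetCell acc_cell (RPlus (RCell acc_cell) (RCell (IPlus (IReg 5) (IReg 12))))) s 1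
                     (st (11 + 2) (R(11 := 0 + j * 1, Suc 11 := 0 + j * (d + 1))) k (\<lambda>C'. C' = C6 (Suc j)))"
                    using s by (intro achieves_SetCell)
                      (auto simp: st_def frame_regs[OF R r(1)] r(2) c C6_def[of "Suc j"] C6_def[of j])
                qed (auto simp: frame_regs[OF R])
              next
                case (2 s)
                show ?case
                proof (rule achieves_mono[OF st_fill[OF 2, where f=f8 and b=bY and m="d * d"]])
                  fix q and s :: state
                  assume q: "q < d * d" and r: "\<forall>r<11. reg s r = R r" "reg s 11 = q"
                    and c: "cell s = (\<lambda>x. if bY \<le> x \<and> x < bY + q then f8 (x - bY) else C6 d x)"
                  have "C6 d (bY + q) = C (bY + q)" using q C5_out[of "bY + q"]
                    by (simp add: C6_def bS_def bG_def bT_def bM_def)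
                  moreover have "C6 d (bM + q) = C5 (bM + q)" by (rule M6[OF q])
                  moreover have "C6 d bS = real d" using C5_out[of bS] dR by (simp add: C6_def bS_def)
                  moreover have "C6 d (bS + 2) = mtrace d P" by (simp add: C6_def mtrace_def)
                  ultimately show "rval s move_iterate = f8 q"
                    using q by (simp add: move_iterate_def frame_regs[OF R r(1)] r(2) c f8_def bS_def bG_def bT_def bM_def)
                next
                  fix s assume "st 11 R k (\<lambda>C'. C' = (\<lambda>x. if bY \<le> x \<and> x < bY + d * d then f8 (x - bY) else C6 d x)) s"
                  then show "st 11 R k (\<lambda>C'. (\<forall>x. x < bY \<or> bG \<le> x \<and> x \<noteq> bS + 2 \<longrightarrow> C' x = C x) \<and> arr d C' bY (fw_step d A Y)) s"
                    using fin8 by (simp add: st_def C8_def[abs_def])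
                qed (auto simp: frame_regs[OF R])
              qed
            qed
          qed
        qed
      qed
    qed
  qed
  then show ?thesis by (rule achieves_mono) (auto simp: step_time_def)
qed

end

text \<open>The products \<open>d * d\<close> and \<open>n * d\<close> are found by empty loops
  whose second counter advances by \<open>d\<close>.\<close>

definition prepare :: com where
  "prepare =
    Seq (for_loop 2 (INum 0) (IReg 0) (INum 1) (INum 0) (IReg 0) Nop)
   (Seq (SetReg 2 (IReg 3))
   (Seq (for_loop 3 (INum 0) (IReg 1) (INum 1) (INum 1) (IReg 0) Nop)
   (Seq (SetReg 3 (IPlus (IReg 4) (IReg 2)))
   (Seq (SetReg 4 (IPlus (IReg 3) (IReg 2)))
   (Seq (SetReg 5 (IPlus (IReg 4) (IReg 2)))
   (Seq (SetReg 6 (IPlus (IReg 5) (IReg 2)))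
   (Seq (SetReg 7 (IPlus (IReg 6) (IReg 2)))
        (SetReg 8 (IPlus (IPlus (IReg 7) (IPlus (IReg 2) (IReg 0))) (IPlus (IReg 2) (IReg 0)))))))))))"

text \<open>Half of the noise level \<open>2 d / (n \<epsilon>)\<close>: the program adds sums of
  \<open>g g^T\<close> without the factor \<open>1 / 2\<close> of the Wishart matrices.\<close>

definition noise_scale :: rexp where
  "noise_scale = RDivide (RCell (IReg 8)) (RTimes (RCell (IPlus (IReg 8) (INum 1))) (RCell (INum 0)))"

text \<open>There is no conversion from indices to reals, so \<open>d\<close> and \<open>n\<close>
  are rebuilt as real numbers by adding \<open>1\<close> repeatedly.\<close>

definition perturb :: com where
  "perturb =
    Seq (count_loop 9 (IReg 0) (SetCell (IReg 8) (RPlus (RCell (IReg 8)) (RNum 1))))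
   (Seq (count_loop 9 (IReg 1) (SetCell (IPlus (IReg 8) (INum 1)) (RPlus (RCell (IPlus (IReg 8) (INum 1))) (RNum 1))))
   (Seq (count_loop 9 (IMinus (IReg 8) (IReg 7)) (DrawNormal (IPlus (IReg 7) (IReg 9))))
   (Seq (add_gram 9 (INum 1) (IMinus (IReg 3) (IReg 2)) (IReg 3) (RDivide (RNum 1) (RCell (IPlus (IReg 8) (INum 1)))))
   (Seq (add_gram 9 (IReg 7) (IPlus (IReg 7) (IPlus (IReg 2) (IReg 0))) (IReg 3) noise_scale)
        (add_gram 9 (IPlus (IReg 7) (IPlus (IReg 2) (IReg 0))) (IReg 8) (IReg 3) (RMinus (RNum 0) noise_scale))))))"

definition postprocess :: com where
  "postprocess =
    Seq (Cond (RLess (RTimes (RCell (IPlus (IReg 8) (INum 1))) (RCell (INum 0))) (RTimes (RCell (IReg 8)) (RCell (IReg 8))))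
      (count_loop 9 (IReg 2) fw_body)
      (fill 9 (IReg 2) (IReg 4) (RCell (IPlus (IReg 3) (IReg 9)))))
    (fill 9 (IReg 2) (INum 0) (RCell (IPlus (IReg 4) (IReg 9))))"

definition marginal_program :: com where
  "marginal_program = Seq prepare (Seq perturb postprocess)"

text \<open>The noisy matrix in terms of tape positions: sample \<open>i * d + j\<close> is entry
  \<open>j\<close> of row \<open>i\<close>, the first \<open>d + 1\<close> rows giving
  \<open>W\<close> and the next \<open>d + 1\<close> giving \<open>W'\<close>.\<close>

definition noisy_gram :: "nat \<Rightarrow> nat \<Rightarrow> real \<Rightarrow> bool list list \<Rightarrow> (nat \<Rightarrow> real) \<Rightarrow> mat" where
  "noisy_gram d n \<epsilon> X h j k =
    (1 / real n) * (\<Sum>i<n. of_bool (X ! i ! j) * of_bool (X ! i ! k))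
    + (real d / (real n * \<epsilon>)) * (\<Sum>i<d + 1. h (i * d + j) * h (i * d + k))
    + (0 - real d / (real n * \<epsilon>)) * (\<Sum>i<d + 1. h ((d + 1 + i) * d + j) * h ((d + 1 + i) * d + k))"

text \<open>The threshold \<open>n \<epsilon> = d\<^sup>2\<close> is where the two error bounds
  coincide; below it the projection pays off.\<close>

definition denoise :: "nat \<Rightarrow> nat \<Rightarrow> real \<Rightarrow> mat \<Rightarrow> mat" where
  "denoise d n \<epsilon> A = (if real n * \<epsilon> < real d * real d then frank_wolfe d A else A)"

section \<open>Correctness and running time of the whole program\<close>

lemma gram_cells_out: "x < b \<or> b + d * d \<le> x \<Longrightarrow> gram_cells d m a b w C x = C x"
  by (auto simp: gram_cells_def)

context layout
begin

definition regs_at :: "nat \<Rightarrow> nat" where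
  "regs_at r = [d, n, d * d, bA, bY, bM, bT, bG, bS] ! r"

lemma frame_regs_at: "frame 9 regs_at"
  by (simp add: frame_def regs_at_def)

definition "prepare_time = 4 * d + 4 * n + 13"

lemma st_next:
  assumes "st N' R' k P s" "N \<le> N'" "\<And>i. i < N \<Longrightarrow> R' i = R i" "ival s a = R N"
  shows "achieves \<omega> (SetReg N a) s 1 (st (Suc N) R k P)"
  using assms by (intro achieves_SetReg) (auto simp: st_def less_Suc_eq)

lemma prepare:
  assumes s: "st 2 regs_at k P s"
  shows "achieves \<omega> prepare s prepare_time (st 9 regs_at k P)"
proof -
  have nop: "achieves \<omega> Nop s (Suc 0) Q" if "Q s" for s Q
    using that exec.Nop[of \<omega> s] unfolding achieves_def by auto
  have "achieves \<omega> prepare s ((d * (1 + 3) + 3) + (1 + ((n * (1 + 3) + 3) + (1 + (1 + (1 + (1 + (1 + 1)))))))) (st 9 regs_at k P)"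
    unfolding prepare_def
  proof (rule achieves_Seq[where P="st (2 + 2) (regs_at(2 := 0 + d * 1, Suc 2 := 0 + d * d)) k P"], goal_cases)
    case 1
    show ?case
      by (rule st_for_loop[where k="\<lambda>_. k" and P="\<lambda>_. P" and a=0 and u=1 and a'=0 and u'=d and h=d and m=d])
         (use s in \<open>auto simp: regs_at_def intro: nop\<close>)
  next
    case (2 s)
    show ?case
    proof (rule achieves_Seq[where P="st 3 regs_at k P"], goal_cases)
      case 1
      have "achieves \<omega> (SetReg 2 (IReg 3)) s 1 (st (Suc 2) regs_at k P)"
        by (rule st_next[OF 2]) (use 2 in \<open>auto simp: st_def regs_at_def\<close>)
      then show ?case by simp
    next
      case (2 s)
      show ?case
      proof (rule achieves_Seq[where P="st (3 + 2) (regs_at(3 := 0 + n * 1, Suc 3 := 1 + n * d)) k P"], goal_cases)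
        case 1
        show ?case
          by (rule st_for_loop[where k="\<lambda>_. k" and P="\<lambda>_. P" and a=0 and u=1 and a'=1 and u'=d and h=n and m=n])
             (use 2 in \<open>auto simp: regs_at_def intro: nop\<close>)
      next
        case (2 s)
        show ?case
        proof (rule achieves_Seq[where P="st 4 regs_at k P"], goal_cases)
          case 1
          have "achieves \<omega> (SetReg 3 (IPlus (IReg 4) (IReg 2))) s 1 (st (Suc 3) regs_at k P)"
            by (rule st_next[OF 2]) (use 2 in \<open>auto simp: st_def regs_at_def bA_def\<close>)
          then show ?case by simp
        next
          case (2 s)
          show ?case
          proof (rule achieves_Seq[where P="st 5 regs_at k P"], goal_cases)
            case 1
            have "achieves \<omega> (SetReg 4 (IPlus (IReg 3) (IReg 2))) s 1 (st (Suc 4) regs_at k P)"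
              by (rule st_next[OF 2]) (use 2 in \<open>auto simp: st_def regs_at_def bY_def\<close>)
            then show ?case by simp
          next
            case (2 s)
            show ?case
            proof (rule achieves_Seq[where P="st 6 regs_at k P"], goal_cases)
              case 1
              have "achieves \<omega> (SetReg 5 (IPlus (IReg 4) (IReg 2))) s 1 (st (Suc 5) regs_at k P)"
                by (rule st_next[OF 2]) (use 2 in \<open>auto simp: st_def regs_at_def bM_def\<close>)
              then show ?case by simp
            next
              case (2 s)
              show ?case
              proof (rule achieves_Seq[where P="st 7 regs_at k P"], goal_cases)
                case 1
                have "achieves \<omega> (SetReg 6 (IPlus (IReg 5) (IReg 2))) s 1 (st (Suc 6) regs_at k P)"
                  by (rule st_next[OF 2]) (use 2 in \<open>auto simp: st_def regs_at_def bT_def\<close>)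
                then show ?case by simp
              next
                case (2 s)
                show ?case
                proof (rule achieves_Seq[where P="st 8 regs_at k P"], goal_cases)
                  case 1
                  have "achieves \<omega> (SetReg 7 (IPlus (IReg 6) (IReg 2))) s 1 (st (Suc 7) regs_at k P)"
                    by (rule st_next[OF 2]) (use 2 in \<open>auto simp: st_def regs_at_def bG_def\<close>)
                  then show ?case by simp
                next
                  case (2 s)
                  have "achieves \<omega> (SetReg 8 (IPlus (IPlus (IReg 7) (IPlus (IReg 2) (IReg 0))) (IPlus (IReg 2) (IReg 0)))) s 1
                      (st (Suc 8) regs_at k P)"
                    by (rule st_next[OF 2]) (use 2 in \<open>auto simp: st_def regs_at_def bS_def\<close>)
                  then show ?case by simp
                qed
              qed
            qed
          qed
        qed
      qed
    qed
  qed
  then show ?thesis by (rule achieves_mono) (auto simp: prepare_time_def)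
qed

definition "gram_time m = m * (d * (4 * d + 6) + 6) + 3"

definition "perturb_time = (d * 4 + 3) + ((n * 4 + 3) + (((d * d + d + (d * d + d)) * 4 + 3)
  + (gram_time n + (gram_time (d + 1) + gram_time (d + 1)))))"

lemma perturb:
  assumes s: "st 9 regs_at 0 (\<lambda>C'. C' = C) s"
    and C: "C 0 = \<epsilon>" "\<And>i j. i < n \<Longrightarrow> j < d \<Longrightarrow> C (1 + i * d + j) = of_bool (X ! i ! j)"
      "\<And>x. x > n * d \<Longrightarrow> C x = 0"
  shows "achieves \<omega> perturb s perturb_time (st 9 regs_at (2 * (d * d + d))
    (\<lambda>C'. arr d C' bA (noisy_gram d n \<epsilon> X (snd \<omega>)) \<and> C' 0 = \<epsilon> \<and> C' bS = real d \<and> C' (bS + 1) = real n \<and>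
      (\<forall>x. bY \<le> x \<and> x < bM \<longrightarrow> C' x = 0)))"
proof -
  note R = frame_regs_at
  have idx: "j * d + k < d * d" if "j < d" "k < d" for j k using index_less that .
  define m where "m = d * d + d + (d * d + d)"
  define h where "h = snd \<omega>"
  define C1 where "C1 i = C(bS := real i)" for i
  define C2 where "C2 i = (C1 d)(bS + 1 := real i)" for i
  define C3 where "C3 i x = (if bG \<le> x \<and> x < bG + i then h (x - bG) else C2 n x)" for i x
  define w where "w = real d / (real n * \<epsilon>)"
  define C4 where "C4 = gram_cells d n 1 bA (1 / real n) (C3 m)"
  define C5 where "C5 = gram_cells d (d + 1) bG bA w C4"
  define C6 where "C6 = gram_cells d (d + 1) (bG + (d * d + d)) bA (0 - w) C5"
  have bSG: "bS = bG + m" by (simp add: bS_def m_def)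
  have big: "bS > n * d" "bS + 1 > n * d" "bS > 0" by (simp_all add: bases)
  have C123: "C3 m 0 = \<epsilon>" "C3 m bS = real d" "C3 m (bS + 1) = real n"
    using C(1) by (auto simp: C3_def C2_def C1_def bSG) (auto simp: bases)
  have C4_out: "C4 x = C3 m x" "C5 x = C3 m x" "C6 x = C3 m x" if "x < bA \<or> bY \<le> x" for x
    using that by (simp_all add: C4_def C5_def C6_def gram_cells_out bY_def)
  have out: "0 < bA" "bY \<le> bS" "bY \<le> bS + 1" by (simp_all add: bases)
  have row: "C3 m (bG + (i * d + j)) = h (i * d + j)" if "i < 2 * (d + 1)" "j < d" for i j
  proof -
    have "i * d + j < Suc i * d" using that by simp
    also have "\<dots> \<le> (2 * (d + 1)) * d" using that by (intro mult_right_mono) auto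
    also have "\<dots> = m" by (simp add: m_def algebra_simps)
    finally show ?thesis by (simp add: C3_def)
  qed
  have gout: "bY \<le> bG + x" for x by (simp add: bases)
  have bit: "C3 m (1 + i * d + j) = of_bool (X ! i ! j)" "1 + i * d + j < bA" if "i < n" "j < d" for i j
  proof -
    have "i * d + j < Suc i * d" using that by simp
    also have "\<dots> \<le> n * d" using that by (intro mult_right_mono) auto
    finally have "i * d + j < n * d" .
    then show "C3 m (1 + i * d + j) = of_bool (X ! i ! j)" "1 + i * d + j < bA"
      using C(2)[OF that] by (simp_all add: C3_def C2_def C1_def bases)
  qed
  have zero: "C3 m x = 0" if "bA \<le> x" "x < bG" for x
    using that C(3)[of x] by (auto simp: C3_def C2_def C1_def bases)
  have final: "arr d C6 bA (noisy_gram d n \<epsilon> X h)"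
    unfolding arr_def
  proof (intro allI impI)
    fix j k assume jk: "j < d" "k < d"
    note lt = idx[OF jk]
    have dm: "(bA + (j * d + k) - bA) div d = j" "(bA + (j * d + k) - bA) mod d = k" using jk by auto
    have e: "gram_cells d r a bA v B (bA + (j * d + k)) =
       B (bA + (j * d + k)) + v * (\<Sum>i<r. B (a + i * d + j) * B (a + i * d + k))" for r a v B
      using lt unfolding gram_cells_def dm by simp
    have "C6 (bA + (j * d + k)) = 0 + (1 / real n) * (\<Sum>i<n. C3 m (1 + i * d + j) * C3 m (1 + i * d + k))
      + w * (\<Sum>i<d + 1. C4 (bG + i * d + j) * C4 (bG + i * d + k))
      + (0 - w) * (\<Sum>i<d + 1. C5 (bG + (d * d + d) + i * d + j) * C5 (bG + (d * d + d) + i * d + k))"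
      unfolding C6_def e unfolding C5_def e unfolding C4_def e
      using zero[of "bA + (j * d + k)"] lt by (simp add: bases)
    also have "(\<Sum>i<n. C3 m (1 + i * d + j) * C3 m (1 + i * d + k)) = (\<Sum>i<n. of_bool (X ! i ! j) * of_bool (X ! i ! k))"
      using jk by (intro sum.cong refl) (simp only: bit lessThan_iff)
    also have "(\<Sum>i<d + 1. C4 (bG + i * d + j) * C4 (bG + i * d + k)) = (\<Sum>i<d + 1. h (i * d + j) * h (i * d + k))"
      using jk gout by (intro sum.cong refl) (simp add: C4_out row add.assoc)
    also have "(\<Sum>i<d + 1. C5 (bG + (d * d + d) + i * d + j) * C5 (bG + (d * d + d) + i * d + k))
       = (\<Sum>i<d + 1. h ((d + 1 + i) * d + j) * h ((d + 1 + i) * d + k))"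
    proof (intro sum.cong refl)
      fix i assume i: "i \<in> {..<d + 1}"
      have "C5 (bG + (d * d + d) + i * d + y) = h ((d + 1 + i) * d + y)" if "y < d" for y
      proof -
        have a: "bG + (d * d + d) + i * d + y = bG + ((d + 1 + i) * d + y)" by (simp add: algebra_simps)
        show ?thesis unfolding a C4_out(2)[OF disjI2[OF gout]] using i that by (intro row) auto
      qed
      then show "C5 (bG + (d * d + d) + i * d + j) * C5 (bG + (d * d + d) + i * d + k) = h ((d + 1 + i) * d + j) * h ((d + 1 + i) * d + k)"
        using jk by simp
    qed
    finally show "C6 (bA + (j * d + k)) = noisy_gram d n \<epsilon> X h j k"
      by (simp add: noisy_gram_def w_def)
  qed
  have "achieves \<omega> perturb s ((d * (1 + 3) + 3) + ((n * (1 + 3) + 3) + ((m * (1 + 3) + 3)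
      + (gram_time n + (gram_time (d + 1) + gram_time (d + 1))))))
    (st 9 regs_at m (\<lambda>C'. C' = C6))"
    unfolding perturb_def
  proof (rule achieves_Seq[where P="st 9 regs_at 0 (\<lambda>C'. C' = C1 d)"], goal_cases)
    case 1
    show ?case
    proof (rule st_count_loop[where k="\<lambda>_. 0" and P="\<lambda>i C'. C' = C1 i"])
      show "st 9 regs_at 0 (\<lambda>C'. C' = C1 0) s" using s C(3)[OF big(1)] by (auto simp: st_def C1_def fun_eq_iff)
      fix i s assume s: "st (9 + 2) (regs_at(9 := i, Suc 9 := 0)) 0 (\<lambda>C'. C' = C1 i) s"
      then have r: "\<forall>r<9. reg s r = regs_at r" by (auto simp: st_def)
      show "achieves \<omega> (SetCell (IReg 8) (RPlus (RCell (IReg 8)) (RNum 1))) s 1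
          (st (9 + 2) (regs_at(9 := i, Suc 9 := 0)) 0 (\<lambda>C'. C' = C1 (Suc i)))"
        using s by (intro achieves_SetCell) (auto simp: st_def frame_regs[OF R r] C1_def)
    qed (auto simp: frame_regs[OF R])
  next
    case (2 s)
    show ?case
    proof (rule achieves_Seq[where P="st 9 regs_at 0 (\<lambda>C'. C' = C2 n)"], goal_cases)
      case 1
      show ?case
      proof (rule st_count_loop[where k="\<lambda>_. 0" and P="\<lambda>i C'. C' = C2 i"])
        show "st 9 regs_at 0 (\<lambda>C'. C' = C2 0) s"
          using 2 C(3)[OF big(2)] by (auto simp: st_def C1_def C2_def fun_eq_iff)
        fix i s assume s: "st (9 + 2) (regs_at(9 := i, Suc 9 := 0)) 0 (\<lambda>C'. C' = C2 i) s"
        then have r: "\<forall>r<9. reg s r = regs_at r" by (auto simp: st_def)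
        show "achieves \<omega> (SetCell (IPlus (IReg 8) (INum 1)) (RPlus (RCell (IPlus (IReg 8) (INum 1))) (RNum 1))) s 1
            (st (9 + 2) (regs_at(9 := i, Suc 9 := 0)) 0 (\<lambda>C'. C' = C2 (Suc i)))"
          using s by (intro achieves_SetCell) (auto simp: st_def frame_regs[OF R r] C2_def)
      qed (auto simp: frame_regs[OF R])
    next
      case (2 s)
      show ?case
      proof (rule achieves_Seq[where P="st 9 regs_at m (\<lambda>C'. C' = C3 m)"], goal_cases)
        case 1
        show ?case
        proof (rule st_count_loop[where k="\<lambda>i. i" and P="\<lambda>i C'. C' = C3 i"])
          show "st 9 regs_at 0 (\<lambda>C'. C' = C3 0) s" using 2 by (auto simp: st_def C3_def fun_eq_iff)
          fix i s assume s: "st (9 + 2) (regs_at(9 := i, Suc 9 := 0)) i (\<lambda>C'. C' = C3 i) s"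
          then have r: "\<forall>r<9. reg s r = regs_at r" "reg s 9 = i" by (auto simp: st_def)
          show "achieves \<omega> (DrawNormal (IPlus (IReg 7) (IReg 9))) s 1
             (st (9 + 2) (regs_at(9 := i, Suc 9 := 0)) (Suc i) (\<lambda>C'. C' = C3 (Suc i)))"
            using s by (intro achieves_DrawNormal)
              (auto simp: st_def frame_regs[OF R r(1)] r(2) C3_def h_def fun_eq_iff)
        qed (auto simp: frame_regs[OF R] bSG)
      next
        case (2 s)
        show ?case
        proof (rule achieves_Seq[where P="st 9 regs_at m (\<lambda>C'. C' = C4)"], goal_cases)
          case 1
          show ?case
            unfolding C4_def gram_time_def
          proof (rule st_add_gram[OF 2])
            show "ival s (INum 1) = 1 \<and> ival s (IMinus (IReg 3) (IReg 2)) = 1 + n * d \<and> ival s (IReg 3) = bA"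
              if "\<forall>r<9. reg s r = regs_at r" for s
              by (simp add: frame_regs[OF R that]) (simp add: bases)
            show "1 + n * d \<le> bA \<or> bA + d * d \<le> 1" by (simp add: bases)
            show "rval s (RDivide (RNum 1) (RCell (IPlus (IReg 8) (INum 1)))) = 1 / real n"
              if "\<forall>r<9. reg s r = regs_at r" "\<And>x. x < bA \<or> bA + d * d \<le> x \<Longrightarrow> cell s x = C3 m x" for s
              using that(2)[of "bS + 1"] C123(3) out by (simp add: frame_regs[OF R that(1)] bY_def)
          qed (use d in \<open>auto simp: regs_at_def\<close>)
        next
          case (2 s)
          have scale: "rval s noise_scale = w"
            if "\<forall>r<9. reg s r = regs_at r" "\<And>x. x < bA \<or> bA + d * d \<le> x \<Longrightarrow> cell s x = D x"
              "\<And>x. x < bA \<or> bY \<le> x \<Longrightarrow> D x = C3 m x" for s D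
          proof -
            have "cell s x = C3 m x" if "x < bA \<or> bY \<le> x" for x
              using \<open>x < bA \<or> bY \<le> x\<close> that(1) \<open>\<And>x. x < bA \<or> bA + d * d \<le> x \<Longrightarrow> cell s x = D x\<close>
                \<open>\<And>x. x < bA \<or> bY \<le> x \<Longrightarrow> D x = C3 m x\<close> by (simp add: bY_def)
            then show ?thesis using out C123 by (simp add: noise_scale_def frame_regs[OF R that(1)] w_def)
          qed
          show ?case
          proof (rule achieves_Seq[where P="st 9 regs_at m (\<lambda>C'. C' = C5)"], goal_cases)
            case 1
            show ?case
              unfolding C5_def gram_time_def
            proof (rule st_add_gram[OF 2])
              show "ival s (IReg 7) = bG \<and> ival s (IPlus (IReg 7) (IPlus (IReg 2) (IReg 0))) = bG + (d + 1) * d \<and> ival s (IReg 3) = bA"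
                if "\<forall>r<9. reg s r = regs_at r" for s
                by (simp add: frame_regs[OF R that])
              show "bG + (d + 1) * d \<le> bA \<or> bA + d * d \<le> bG" by (simp add: bases)
              show "rval s noise_scale = w"
                if "\<forall>r<9. reg s r = regs_at r" "\<And>x. x < bA \<or> bA + d * d \<le> x \<Longrightarrow> cell s x = C4 x" for s
                by (rule scale[OF that C4_out(1)])
            qed (use d in \<open>auto simp: regs_at_def\<close>)
          next
            case (2 s)
            show ?case
              unfolding C6_def gram_time_def
            proof (rule st_add_gram[OF 2])
              show "ival s (IPlus (IReg 7) (IPlus (IReg 2) (IReg 0))) = bG + (d * d + d) \<and> ival s (IReg 8) = bG + (d * d + d) + (d + 1) * d \<and> ival s (IReg 3) = bA"
                if "\<forall>r<9. reg s r = regs_at r" for s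
                by (simp add: frame_regs[OF R that] bS_def)
              show "bG + (d * d + d) + (d + 1) * d \<le> bA \<or> bA + d * d \<le> bG + (d * d + d)" by (simp add: bases)
              show "rval s (RMinus (RNum 0) noise_scale) = 0 - w"
                if "\<forall>r<9. reg s r = regs_at r" "\<And>x. x < bA \<or> bA + d * d \<le> x \<Longrightarrow> cell s x = C5 x" for s
                using scale[OF that C4_out(2)] by simp
            qed (use d in \<open>auto simp: regs_at_def\<close>)
          qed
        qed
      qed
    qed
  qed
  then show ?thesis
  proof (rule achieves_mono)
    fix s assume s: "st 9 regs_at m (\<lambda>C'. C' = C6) s"
    have "C6 x = 0" if "bY \<le> x" "x < bM" for x
      using that C4_out(3)[of x] zero[of x] by (simp add: bases)
    then show "st 9 regs_at (2 * (d * d + d))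
      (\<lambda>C'. arr d C' bA (noisy_gram d n \<epsilon> X (snd \<omega>)) \<and> C' 0 = \<epsilon> \<and> C' bS = real d \<and> C' (bS + 1) = real n \<and>
      (\<forall>x. bY \<le> x \<and> x < bM \<longrightarrow> C' x = 0)) s"
      using s final C123 C4_out(3) out by (simp add: st_def h_def m_def)
  qed (simp add: perturb_time_def m_def)
qed

definition "postprocess_time = Suc (d * d * (step_time + 3) + 3 + (4 * (d * d) + 3)) + (4 * (d * d) + 3)"

lemma postprocess:
  assumes s: "st 9 regs_at k (\<lambda>C'. C' = C) s"
    and A: "arr d C bA A" and C: "C 0 = \<epsilon>" "C bS = real d" "C (bS + 1) = real n"
      "\<And>x. bY \<le> x \<Longrightarrow> x < bM \<Longrightarrow> C x = 0"
  shows "achieves \<omega> postprocess s postprocess_time (\<lambda>s. \<forall>j<d. \<forall>k<d. cell s (j * d + k) = denoise d n \<epsilon> A j k)"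
proof -
  note R = frame_regs_at
  have idx: "j * d + k < d * d" if "j < d" "k < d" for j k using index_less that .
  have rs: "\<forall>r<9. reg s r = regs_at r" and cs: "cell s = C" using s by (auto simp: st_def)
  let ?Q = "st 9 regs_at k (\<lambda>C'. arr d C' bY (denoise d n \<epsilon> A))"
  have "achieves \<omega> postprocess s (Suc (max (d * d * (step_time + 3) + 3) (4 * (d * d) + 3)) + (4 * (d * d) + 3))
     (\<lambda>s. \<forall>j<d. \<forall>k<d. cell s (j * d + k) = denoise d n \<epsilon> A j k)"
    unfolding postprocess_def
  proof (rule achieves_Seq[where P="?Q"], rule achieves_Cond, goal_cases)
    case 1
    then have lt: "real n * \<epsilon> < real d * real d" using C by (simp add: frame_regs[OF R rs] cs)
    define P where "P t C' \<longleftrightarrow> (\<forall>x. x < bY \<or> bG \<le> x \<and> x \<noteq> bS + 2 \<longrightarrow> C' x = C x) \<and>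
      arr d C' bY ((fw_step d A ^^ t) (\<lambda>_ _. 0))" for t C'
    have "achieves \<omega> (count_loop 9 (IReg 2) fw_body) s (d * d * (step_time + 3) + 3) (st 9 regs_at k (P (d * d)))"
    proof (rule st_count_loop[where k="\<lambda>_. k" and P=P])
      \<comment> \<open>The iteration starts at the zero matrix because memory beyond the input is
        zero and nothing has been written there.\<close>
      have "arr d C bY (\<lambda>_ _. 0)" using C(4) idx by (simp add: arr_def bM_def)
      then show "st 9 regs_at k (P 0) s" using s by (simp add: st_def P_def)
      fix t s assume t: "t < d * d" and s: "st (9 + 2) (regs_at(9 := t, Suc 9 := 0)) k (P t) s"
      note s' = conjunct1[OF st_exact[OF s]] and p = conjunct2[OF st_exact[OF s]]
      have eq: "9 + 2 = (11::nat)" by simp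
      have "arr d (cell s) bA A"
        using A p idx by (simp add: arr_def P_def bY_def)
      moreover have "cell s bS = real d" using p C(2) by (simp add: P_def bS_def)
      ultimately have "achieves \<omega> fw_body s step_time (st 11 (regs_at(9 := t, Suc 9 := 0)) k
         (\<lambda>C'. (\<forall>x. x < bY \<or> bG \<le> x \<and> x \<noteq> bS + 2 \<longrightarrow> C' x = cell s x) \<and> arr d C' bY (fw_step d A ((fw_step d A ^^ t) (\<lambda>_ _. 0)))))"
        using frame_ext[OF R, of t 0] s'[unfolded eq] p by (intro fw_body) (auto simp: P_def)
      then show "achieves \<omega> fw_body s step_time (st (9 + 2) (regs_at(9 := t, Suc 9 := 0)) k (P (Suc t)))"
        unfolding eq by (rule achieves_mono) (use p in \<open>auto simp: st_def P_def\<close>)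
    qed (auto simp: frame_regs[OF R])
    then show ?case
      by (rule achieves_mono) (auto simp: st_def P_def denoise_def lt frank_wolfe_def)
  next
    case 2
    then have ge: "\<not> real n * \<epsilon> < real d * real d" using C by (simp add: frame_regs[OF R rs] cs)
    have "achieves \<omega> (fill 9 (IReg 2) (IReg 4) (RCell (IPlus (IReg 3) (IReg 9)))) s (4 * (d * d) + 3)
      (st 9 regs_at k (\<lambda>C'. C' = (\<lambda>x. if bY \<le> x \<and> x < bY + d * d then C (bA + (x - bY)) else C x)))"
      by (rule st_fill[OF s, where f="\<lambda>q. C (bA + q)"]) (auto simp: frame_regs[OF R] bY_def)
    then show ?case
    proof (rule achieves_mono)
      fix s assume "st 9 regs_at k (\<lambda>C'. C' = (\<lambda>x. if bY \<le> x \<and> x < bY + d * d then C (bA + (x - bY)) else C x)) s"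
      then show "?Q s" using A idx by (auto simp: st_def arr_def denoise_def ge)
    qed simp
  next
    case (3 s)
    note s' = conjunct1[OF st_exact[OF 3]] and p = conjunct2[OF st_exact[OF 3]]
    have "achieves \<omega> (fill 9 (IReg 2) (INum 0) (RCell (IPlus (IReg 4) (IReg 9)))) s (4 * (d * d) + 3)
      (st 9 regs_at k (\<lambda>C'. C' = (\<lambda>x. if 0 \<le> x \<and> x < 0 + d * d then cell s (bY + (x - 0)) else cell s x)))"
      by (rule st_fill[OF s', where f="\<lambda>q. cell s (bY + q)"]) (auto simp: frame_regs[OF R] bY_def bA_def)
    then show ?case
      by (rule achieves_mono) (use p idx in \<open>auto simp: st_def arr_def\<close>)
  qed
  then show ?thesis by (rule achieves_mono) (auto simp: postprocess_time_def)
qed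

definition "total_time = prepare_time + (perturb_time + postprocess_time)"

lemma marginal_program:
  assumes X: "X \<in> datasets (cube d) n"
  shows "achieves \<omega> marginal_program (input_state d \<epsilon> X) total_time
    (\<lambda>s. \<forall>j<d. \<forall>k<d. cell s (j * d + k) = denoise d n \<epsilon> (noisy_gram d n \<epsilon> X (snd \<omega>)) j k)"
  unfolding marginal_program_def total_time_def
proof (rule achieves_Seq)
  define C where "C = cell (input_state d \<epsilon> X)"
  have len: "length X = n" using X by (simp add: datasets_def)
  have "st 2 regs_at 0 (\<lambda>C'. C' = C) (input_state d \<epsilon> X)"
    using len by (auto simp: st_def C_def input_state_def regs_at_def less_Suc_eq numeral_2_eq_2)
  then show "achieves \<omega> prepare (input_state d \<epsilon> X) prepare_time (st 9 regs_at 0 (\<lambda>C'. C' = C))"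
    by (rule prepare)
  have C: "C 0 = \<epsilon>" "\<And>x. x > n * d \<Longrightarrow> C x = 0"
    by (auto simp: C_def input_state_def len)
  have bit: "C (1 + i * d + j) = of_bool (X ! i ! j)" if "i < n" "j < d" for i j
  proof -
    have "i * d + j < Suc i * d" using that by simp
    also have "\<dots> \<le> n * d" using that by (intro mult_right_mono) auto
    finally show ?thesis using that by (simp add: C_def input_state_def len)
  qed
  fix s assume s: "st 9 regs_at 0 (\<lambda>C'. C' = C) s"
  show "achieves \<omega> (Seq perturb postprocess) s (perturb_time + postprocess_time)
    (\<lambda>s. \<forall>j<d. \<forall>k<d. cell s (j * d + k) = denoise d n \<epsilon> (noisy_gram d n \<epsilon> X (snd \<omega>)) j k)"
  proof (rule achieves_Seq[OF perturb[OF s C(1) bit C(2)]])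
    fix s
    assume "st 9 regs_at (2 * (d * d + d)) (\<lambda>C'. arr d C' bA (noisy_gram d n \<epsilon> X (snd \<omega>)) \<and> C' 0 = \<epsilon> \<and>
      C' bS = real d \<and> C' (bS + 1) = real n \<and> (\<forall>x. bY \<le> x \<and> x < bM \<longrightarrow> C' x = 0)) s"
    note e = conjunct1[OF st_exact[OF this]] conjunct2[OF st_exact[OF this]]
    show "achieves \<omega> postprocess s postprocess_time
      (\<lambda>s. \<forall>j<d. \<forall>k<d. cell s (j * d + k) = denoise d n \<epsilon> (noisy_gram d n \<epsilon> X (snd \<omega>)) j k)"
      by (rule postprocess[OF e(1)]) (use e(2) in auto)
  qed
qed

text \<open>The degree comes from \<open>d\<^sup>2\<close> Frank-Wolfe steps, each with
  \<open>4 d\<close> matrix products of order \<open>d\<^sup>3\<close>.\<close>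

lemma total_time_le: "total_time \<le> 1000 * (d + n) ^ 6"
proof -
  define x where "x = d + n"
  have x: "1 \<le> x" "d \<le> x" "n \<le> x" using d by (auto simp: x_def)
  have mono: "x ^ i \<le> x ^ 6" if "i \<le> 6" for i using x(1) that by (rule power_increasing[rotated])
  have dd: "d * d \<le> x * x" using x by (intro mult_mono) auto
  have in1: "d * (4 * d + 6) + 6 \<le> x * (4 * x + 6) + 6" using x by (intro add_mono mult_mono) auto
  have gr: "gram_time m \<le> m * (x * (4 * x + 6) + 6) + 3" for m
    unfolding gram_time_def using in1 by simp
  have sq: "square_time \<le> 2 * (4 * (x * x) + 3) + 2 * (x * (x * (4 * x + 6) + 6) + 3)" (is "_ \<le> ?sq")
    unfolding square_time_def using x dd in1 by (intro add_mono mult_mono) auto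
  have stp: "step_time \<le> (4 * (x * x) + 3) + (1 + ((x * x * 5 + 3) + ((x * 4 + 3) + ((2 * x * (?sq + 3) + 3)
      + (1 + ((x * 4 + 3) + (4 * (x * x) + 3)))))))" (is "_ \<le> ?st")
    unfolding step_time_def using x dd sq by (intro add_mono mult_mono) auto
  have po: "postprocess_time \<le> Suc (x * x * (?st + 3) + 3 + (4 * (x * x) + 3)) + (4 * (x * x) + 3)"
    unfolding postprocess_time_def using x dd stp by (intro add_mono mult_mono Suc_le_mono[THEN iffD2]) auto
  have pe: "perturb_time \<le> (x * 4 + 3) + ((x * 4 + 3) + (((x * x + x + (x * x + x)) * 4 + 3)
      + ((x * (x * (4 * x + 6) + 6) + 3) + (((x + 1) * (x * (4 * x + 6) + 6) + 3) + ((x + 1) * (x * (4 * x + 6) + 6) + 3)))))"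
    unfolding perturb_time_def using x dd by (intro add_mono mult_mono order_trans[OF gr]) auto
  have pr: "prepare_time \<le> 4 * x + 4 * x + 13" unfolding prepare_time_def using x by simp
  have po': "postprocess_time \<le> 10 + 31 * x ^ 2 + 38 * x ^ 3 + 37 * x ^ 4 + 40 * x ^ 5 + 16 * x ^ 6"
    by (rule order_trans[OF po]) (simp add: power_numeral_reduce algebra_simps)
  have pe': "perturb_time \<le> 30 + 46 * x + 34 * x ^ 2 + 12 * x ^ 3"
    by (rule order_trans[OF pe]) (simp add: power_numeral_reduce algebra_simps)
  have "1 \<le> x ^ 6" "x \<le> x ^ 6" using mono[of 0] mono[of 1] by auto
  moreover have "x ^ 2 \<le> x ^ 6" "x ^ 3 \<le> x ^ 6" "x ^ 4 \<le> x ^ 6" "x ^ 5 \<le> x ^ 6" by (rule mono, simp)+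
  ultimately have "total_time \<le> 1000 * x ^ 6"
    using po' pe' pr unfolding total_time_def by linarith
  then show ?thesis by (simp add: x_def)
qed

end


section \<open>The mechanism\<close>

text \<open>Program and abstract mechanism agree only on indices below \<open>d\<close>, so all
  matrix operations must be seen to depend on nothing else.\<close>

lemma fw_step_cong:
  assumes A: "\<And>j k. j < d \<Longrightarrow> k < d \<Longrightarrow> A j k = A' j k" and Y: "\<And>j k. j < d \<Longrightarrow> k < d \<Longrightarrow> Y j k = Y' j k"
    and jk: "j < d" "k < d"
  shows "fw_step d A Y j k = fw_step d A' Y' j k"
proof -
  have "absdiff d A Y = absdiff d A' Y'" using A Y by (simp add: absdiff_def)
  then have s: "shifted d A Y j k = shifted d A' Y' j k" if "j < d" "k < d" for j k
    using A Y that by (simp add: shifted_def)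
  have "(gram d ^^ L) (shifted d A Y) j k = (gram d ^^ L) (shifted d A' Y') j k" if "j < d" "k < d" for j k L
    using that by (induction L arbitrary: j k) (simp_all add: s gram_def)
  then have "power_matrix d A Y j k = power_matrix d A' Y' j k" if "j < d" "k < d" for j k
    using that by (simp add: power_matrix_def)
  then show ?thesis using Y jk by (simp add: fw_step_def mtrace_def)
qed

lemma denoise_cong:
  assumes A: "\<And>j k. j < d \<Longrightarrow> k < d \<Longrightarrow> A j k = A' j k" and jk: "j < d" "k < d"
  shows "denoise d n \<epsilon> A j k = denoise d n \<epsilon> A' j k"
proof -
  have "(fw_step d A ^^ t) (\<lambda>_ _. 0) j k = (fw_step d A' ^^ t) (\<lambda>_ _. 0) j k" if "j < d" "k < d" for j k t
    using that
  proof (induction t arbitrary: j k)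
    case (Suc t)
    then show ?case using fw_step_cong[OF A Suc.IH] by simp
  qed simp
  then show ?thesis using A jk by (simp add: denoise_def frank_wolfe_def)
qed

lemma measurable_fw_step:
  assumes A: "\<And>j k. j < d \<Longrightarrow> k < d \<Longrightarrow> (\<lambda>x. A x j k) \<in> borel_measurable M"
    and Y: "\<And>j k. j < d \<Longrightarrow> k < d \<Longrightarrow> (\<lambda>x. Y x j k) \<in> borel_measurable M"
    and jk: "j < d" "k < d"
  shows "(\<lambda>x. fw_step d (A x) (Y x) j k) \<in> borel_measurable M"
proof -
  have s: "(\<lambda>x. shifted d (A x) (Y x) j k) \<in> borel_measurable M" if "j < d" "k < d" for j k
    using A Y that unfolding shifted_def absdiff_def
    by (cases "j = k") (auto intro!: borel_measurable_sum borel_measurable_abs borel_measurable_diff)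
  have "(\<lambda>x. (gram d ^^ L) (shifted d (A x) (Y x)) j k) \<in> borel_measurable M" if "j < d" "k < d" for j k L
    using that
  proof (induction L arbitrary: j k)
    case (Suc L)
    then show ?case by (auto simp: gram_def intro!: borel_measurable_sum borel_measurable_times)
  qed (simp add: s)
  then have P: "(\<lambda>x. power_matrix d (A x) (Y x) j k) \<in> borel_measurable M" if "j < d" "k < d" for j k
    using that by (simp add: power_matrix_def)
  show ?thesis
    unfolding fw_step_def mtrace_def using Y jk P
    by (intro borel_measurable_add borel_measurable_diff borel_measurable_divide borel_measurable_sum borel_measurable_const) auto
qed

lemma measurable_denoise:
  assumes A: "\<And>j k. j < d \<Longrightarrow> k < d \<Longrightarrow> (\<lambda>x. A x j k) \<in> borel_measurable M" and jk: "j < d" "k < d"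
  shows "(\<lambda>x. denoise d n \<epsilon> (A x) j k) \<in> borel_measurable M"
proof -
  have "(\<lambda>x. (fw_step d (A x) ^^ t) (\<lambda>_ _. 0) j k) \<in> borel_measurable M" if "j < d" "k < d" for j k t
    using that
  proof (induction t arbitrary: j k)
    case (Suc t)
    then show ?case using measurable_fw_step[OF A Suc.IH] by simp
  qed simp
  then show ?thesis using A jk by (cases "real n * \<epsilon> < real d * real d") (simp_all add: denoise_def frank_wolfe_def)
qed

text \<open>Everything after the noise depends on the data only through the noisy matrix and
  \<open>n\<close>, which neighbours share. Privacy thus has to be shown only for the noisy
  matrix.\<close>

definition release :: "nat \<Rightarrow> nat \<Rightarrow> real \<Rightarrow> (nat \<times> nat \<Rightarrow> real) \<Rightarrow> nat \<times> nat \<Rightarrow> real" where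
  "release d n \<epsilon> A = (\<lambda>p\<in>pairs d. denoise d n \<epsilon> (\<lambda>j k. A (j, k)) (fst p) (snd p))"

lemma pairs_less: "p \<in> pairs d \<Longrightarrow> fst p < d \<and> snd p < d"
  by (auto simp: pairs_def)

lemma measurable_release: "release d n \<epsilon> \<in> measurable (matrix_space d) (answer_space (pairs d))"
  unfolding release_def
proof (rule measurable_restrict)
  fix p assume "p \<in> pairs d"
  then show "(\<lambda>A. denoise d n \<epsilon> (\<lambda>j k. A (j, k)) (fst p) (snd p)) \<in> borel_measurable (matrix_space d)"
    using pairs_less[of p d] by (intro measurable_denoise measurable_matrix_entry[OF measurable_ident_sets[OF refl]]) auto
qed

definition marginal_matrix :: "bool list list \<Rightarrow> mat" where
  "marginal_matrix X j k = (1 / real (length X)) * (\<Sum>i<length X. of_bool (X ! i ! j) * of_bool (X ! i ! k))"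

text \<open>Chosen such that a rank one matrix of trace \<open>d / n\<close> costs exactly
  \<open>\<epsilon> / 2\<close>.\<close>

definition noise_level :: "nat \<Rightarrow> nat \<Rightarrow> real \<Rightarrow> real" where
  "noise_level d n \<epsilon> = 2 * (real d / (real n * \<epsilon>))"

text \<open>Written as a union of two row sets so that \<open>noisy_rank_one\<close> applies
  literally.\<close>

definition index_set :: "nat \<Rightarrow> (nat \<times> nat) set" where
  "index_set d = ({..<d + 1} \<union> {d + 1..<2 * (d + 1)}) \<times> {..<d}"

abbreviation noisy_matrix :: "nat \<Rightarrow> nat \<Rightarrow> real \<Rightarrow> mat \<Rightarrow> (nat \<times> nat \<Rightarrow> real) \<Rightarrow> nat \<times> nat \<Rightarrow> real" where
  "noisy_matrix d n \<epsilon> \<equiv> noisy {..<d + 1} {d + 1..<2 * (d + 1)} d (noise_level d n \<epsilon>)"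

definition rows_of_tape :: "nat \<Rightarrow> tape \<Rightarrow> nat \<times> nat \<Rightarrow> real" where
  "rows_of_tape d \<omega> = (\<lambda>p\<in>index_set d. snd \<omega> (fst p * d + snd p))"

definition marginal_mechanism :: "nat \<Rightarrow> real \<Rightarrow> (bool list, nat \<times> nat) mechanism" where
  "marginal_mechanism d \<epsilon> X = distr tape_measure (answer_space (pairs d))
    (\<lambda>\<omega>. release d (length X) \<epsilon> (noisy_matrix d (length X) \<epsilon> (marginal_matrix X) (rows_of_tape d \<omega>)))"

section \<open>From tape samples to a Gaussian array\<close>

lemma prob_space_tape: "prob_space tape_measure"
proof -
  have u: "prob_space (PiM UNIV (\<lambda>_::nat. uniform_measure lborel {0..1::real}))"
    by (intro prob_space_PiM prob_space_uniform_measure) auto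
  have n: "prob_space (PiM UNIV (\<lambda>_::nat. std_normal))" by (rule prob_space_gauss)
  interpret pair_prob_space "PiM UNIV (\<lambda>_::nat. uniform_measure lborel {0..1::real})" "PiM UNIV (\<lambda>_::nat. std_normal)"
    using u n by (simp add: pair_prob_space_def pair_sigma_finite_def prob_space_imp_sigma_finite)
  show ?thesis unfolding tape_measure_def by unfold_locales
qed

text \<open>Row-major addressing is injective, so different entries read different, hence
  independent, samples.\<close>

lemma rows_of_tape_distr:
  assumes d: "d > 0"
  shows "rows_of_tape d \<in> measurable tape_measure (gauss (index_set d))"
    "distr tape_measure (gauss (index_set d)) (rows_of_tape d) = gauss (index_set d)"
proof -
  let ?U = "PiM UNIV (\<lambda>_::nat. uniform_measure lborel {0..1::real})" and ?N = "PiM UNIV (\<lambda>_::nat. std_normal)"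
  let ?r = "\<lambda>w. \<lambda>p\<in>index_set d. w (fst p * d + snd p)"
  interpret U: prob_space ?U by (intro prob_space_PiM prob_space_uniform_measure) auto
  have r: "?r \<in> measurable ?N (gauss (index_set d))"
    by (intro measurable_restrict measurable_component_singleton) simp
  have eq: "rows_of_tape d = ?r \<circ> snd" by (simp add: rows_of_tape_def fun_eq_iff)
  show "rows_of_tape d \<in> measurable tape_measure (gauss (index_set d))"
    unfolding eq tape_measure_def by (rule measurable_comp[OF measurable_snd r])
  have "distr (?U \<Otimes>\<^sub>M ?N) ?N snd = ?N"
  proof (rule measure_eqI)
    fix A assume "A \<in> sets (distr (?U \<Otimes>\<^sub>M ?N) ?N snd)"
    then have A: "A \<in> sets ?N" by simp
    have "snd -` A \<inter> space (?U \<Otimes>\<^sub>M ?N) = space ?U \<times> A"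
      using sets.sets_into_space[OF A] by (auto simp: space_pair_measure)
    then show "emeasure (distr (?U \<Otimes>\<^sub>M ?N) ?N snd) A = emeasure ?N A"
      using A by (simp add: emeasure_distr sigma_finite_measure.emeasure_pair_measure_Times[OF prob_space_imp_sigma_finite[OF prob_space_gauss]] U.emeasure_space_1)
  qed simp
  moreover have "distr ?N (gauss (index_set d)) ?r = gauss (index_set d)"
  proof (rule distr_PiM_reindex[where M="\<lambda>_. std_normal" and f="\<lambda>p. fst p * d + snd p"])
    show "inj_on (\<lambda>p. fst p * d + snd p) (index_set d)"
    proof (rule inj_onI)
      fix p q assume p: "p \<in> index_set d" "q \<in> index_set d" and e: "fst p * d + snd p = fst q * d + snd q"
      have "snd p < d" "snd q < d" using p by (auto simp: index_set_def)
      then have "(fst p * d + snd p) div d = fst p" "(fst p * d + snd p) mod d = snd p"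
        "(fst q * d + snd q) div d = fst q" "(fst q * d + snd q) mod d = snd q" using d by auto
      then show "p = q" using e by (simp add: prod_eq_iff)
    qed
  qed (auto simp: prob_space_std_normal)
  ultimately show "distr tape_measure (gauss (index_set d)) (rows_of_tape d) = gauss (index_set d)"
    unfolding eq tape_measure_def by (subst distr_distr[symmetric]) (auto intro: r)
qed

lemma noisy_matrix_tape:
  assumes "j < d" "k < d" "length X = n"
  shows "noisy_matrix d n \<epsilon> (marginal_matrix X) (rows_of_tape d \<omega>) (j, k) = noisy_gram d n \<epsilon> X (snd \<omega>) j k"
proof -
  have g: "rows_of_tape d \<omega> (i, l) = snd \<omega> (i * d + l)" if "i < 2 * (d + 1)" "l < d" for i l
    using that by (auto simp: rows_of_tape_def index_set_def)
  have "(\<Sum>i\<in>{d + 1..<2 * (d + 1)}. rows_of_tape d \<omega> (i, j) * rows_of_tape d \<omega> (i, k)) =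
    (\<Sum>i<d + 1. snd \<omega> ((d + 1 + i) * d + j) * snd \<omega> ((d + 1 + i) * d + k))"
    using assms g by (intro sum.reindex_bij_witness[of _ "\<lambda>i. d + 1 + i" "\<lambda>i. i - (d + 1)"]) auto
  moreover have "(\<Sum>i<d + 1. rows_of_tape d \<omega> (i, j) * rows_of_tape d \<omega> (i, k)) =
    (\<Sum>i<d + 1. snd \<omega> (i * d + j) * snd \<omega> (i * d + k))"
    using assms g by (intro sum.cong) auto
  ultimately show ?thesis
    using assms by (simp add: noisy_def wishart_def noisy_gram_def noise_level_def marginal_matrix_def algebra_simps del: sum.lessThan_Suc)
qed

lemma release_tape:
  assumes "length X = n"
  shows "release d n \<epsilon> (noisy_matrix d n \<epsilon> (marginal_matrix X) (rows_of_tape d \<omega>)) =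
    (\<lambda>p\<in>pairs d. denoise d n \<epsilon> (noisy_gram d n \<epsilon> X (snd \<omega>)) (fst p) (snd p))"
  unfolding release_def
  using pairs_less assms by (intro restrict_ext denoise_cong noisy_matrix_tape) auto

lemma measurable_noisy_matrix: "noisy_matrix d n \<epsilon> Q \<in> measurable (gauss (index_set d)) (matrix_space d)"
  by (rule measurable_noisy) (simp add: index_set_def)

lemma measurable_mechanism:
  assumes "d > 0"
  shows "(\<lambda>\<omega>. release d n \<epsilon> (noisy_matrix d n \<epsilon> Q (rows_of_tape d \<omega>))) \<in> measurable tape_measure (answer_space (pairs d))"
  by (rule measurable_compose[OF measurable_compose[OF rows_of_tape_distr(1)[OF assms] measurable_noisy_matrix] measurable_release])

lemma nn_integral_mechanism:
  assumes d: "d > 0" and f: "f \<in> borel_measurable (answer_space (pairs d))"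
  shows "integral\<^sup>N (marginal_mechanism d \<epsilon> X) f =
    (\<integral>\<^sup>+g. f (release d (length X) \<epsilon> (noisy_matrix d (length X) \<epsilon> (marginal_matrix X) g)) \<partial>gauss (index_set d))"
proof -
  note m = measurable_compose[OF measurable_compose[OF measurable_noisy_matrix measurable_release] f]
  have "integral\<^sup>N (marginal_mechanism d \<epsilon> X) f =
    (\<integral>\<^sup>+\<omega>. f (release d (length X) \<epsilon> (noisy_matrix d (length X) \<epsilon> (marginal_matrix X) (rows_of_tape d \<omega>))) \<partial>tape_measure)"
    unfolding marginal_mechanism_def
    by (rule nn_integral_distr) (use measurable_mechanism[OF d] f in auto)
  also have "\<dots> = (\<integral>\<^sup>+g. f (release d (length X) \<epsilon> (noisy_matrix d (length X) \<epsilon> (marginal_matrix X) g))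
      \<partial>distr tape_measure (gauss (index_set d)) (rows_of_tape d))"
    by (rule nn_integral_distr[symmetric]) (use rows_of_tape_distr(1)[OF d] m in auto)
  finally show ?thesis unfolding rows_of_tape_distr(2)[OF d] .
qed

lemma is_mechanism_marginal:
  assumes "d > 0"
  shows "is_mechanism (cube d) (pairs d) (marginal_mechanism d \<epsilon>)"
  unfolding is_mechanism_def marginal_mechanism_def
  using prob_space.prob_space_distr[OF prob_space_tape measurable_mechanism[OF assms]] by simp

section \<open>Privacy\<close>

text \<open>Replacing one element subtracts one rank one matrix and adds another; each costs \<open>\<epsilon> / 2\<close>.\<close>

lemma emeasure_le_replace:
  assumes d: "d > 0" and e: "\<epsilon> > 0" and n: "length X = n" "length Y = n" "i < n"
    and XY: "\<And>l. l < n \<Longrightarrow> l \<noteq> i \<Longrightarrow> X ! l = Y ! l"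
    and S: "S \<in> sets (answer_space (pairs d))"
  shows "emeasure (marginal_mechanism d \<epsilon> X) S \<le> ennreal (exp \<epsilon>) * emeasure (marginal_mechanism d \<epsilon> Y) S"
proof -
  define \<phi> where "\<phi> A = (indicator S (release d n \<epsilon> A) :: ennreal)" for A
  have ind: "indicator S \<in> borel_measurable (answer_space (pairs d))" using S by simp
  have \<phi>: "\<phi> \<in> borel_measurable (matrix_space d)"
    unfolding \<phi>_def by (rule measurable_compose[OF measurable_release ind])
  define I where "I Q = (\<integral>\<^sup>+g. \<phi> (noisy_matrix d n \<epsilon> Q g) \<partial>gauss (index_set d))" for Q
  have em: "emeasure (marginal_mechanism d \<epsilon> Z) S = I (marginal_matrix Z)" if "length Z = n" for Z
  proof -
    have "emeasure (marginal_mechanism d \<epsilon> Z) S = (\<integral>\<^sup>+y. indicator S y \<partial>marginal_mechanism d \<epsilon> Z)"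
      using S by (intro nn_integral_indicator[symmetric]) (simp add: marginal_mechanism_def)
    then show ?thesis using nn_integral_mechanism[OF d ind, of \<epsilon> Z] that by (simp add: I_def \<phi>_def)
  qed
  \<comment> \<open>The marginals without element \<open>i\<close>, still divided by
    \<open>n\<close>: the common point through which the comparison of the two datasets
    passes.\<close>
  define Q0 where "Q0 j k = (1 / real n) * (\<Sum>l\<in>{..<n} - {i}. of_bool (X ! l ! j) * of_bool (X ! l ! k))" for j k
  define b where "b Z j = (of_bool (Z ! i ! j) / sqrt (real n) :: real)" for Z :: "bool list list" and j
  have Q: "marginal_matrix Z = (\<lambda>j k. Q0 j k + b Z j * b Z k)"
    if "length Z = n" "\<And>l. l < n \<Longrightarrow> l \<noteq> i \<Longrightarrow> X ! l = Z ! l" for Z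
  proof (intro ext)
    fix j k
    have "(\<Sum>l<n. of_bool (Z ! l ! j) * of_bool (Z ! l ! k) :: real) = of_bool (Z ! i ! j) * of_bool (Z ! i ! k)
        + (\<Sum>l\<in>{..<n} - {i}. of_bool (Z ! l ! j) * of_bool (Z ! l ! k))"
      using n by (intro sum.remove) auto
    also have "(\<Sum>l\<in>{..<n} - {i}. of_bool (Z ! l ! j) * of_bool (Z ! l ! k) :: real) =
      (\<Sum>l\<in>{..<n} - {i}. of_bool (X ! l ! j) * of_bool (X ! l ! k))"
      using that(2) by (intro sum.cong) auto
    finally show "marginal_matrix Z j k = Q0 j k + b Z j * b Z k"
      using n by (simp add: marginal_matrix_def that(1) Q0_def b_def distrib_left)
  qed
  have QX: "marginal_matrix X = (\<lambda>j k. Q0 j k + b X j * b X k)" by (rule Q[OF n(1) refl])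
  have QY: "marginal_matrix Y = (\<lambda>j k. Q0 j k + b Y j * b Y k)" by (rule Q[OF n(2)]) (rule XY)
  have t: "noise_level d n \<epsilon> > 0" using d e n by (simp add: noise_level_def)
  have R: "finite {..<d + 1}" "card {..<d + 1} > d" "finite {d + 1..<2 * (d + 1)}" "card {d + 1..<2 * (d + 1)} > d"
    "{..<d + 1} \<inter> {d + 1..<2 * (d + 1)} = {}" by auto
  have ex: "ennreal (exp ((\<Sum>j<d. (b Z j)\<^sup>2) / noise_level d n \<epsilon>)) \<le> ennreal (exp (\<epsilon> / 2))" for Z
  proof (intro ennreal_leI exp_mono)
    have "(\<Sum>j<d. (b Z j)\<^sup>2) \<le> (\<Sum>j<d. 1 / real n)"
      using n by (intro sum_mono) (auto simp: b_def power_divide)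
    then have "(\<Sum>j<d. (b Z j)\<^sup>2) / noise_level d n \<epsilon> \<le> (real d / real n) / noise_level d n \<epsilon>"
      using t by (intro divide_right_mono) auto
    also have "\<dots> = \<epsilon> / 2" using d e n by (simp add: noise_level_def field_simps)
    finally show "(\<Sum>j<d. (b Z j)\<^sup>2) / noise_level d n \<epsilon> \<le> \<epsilon> / 2" .
  qed
  have "I (marginal_matrix X) \<le> ennreal (exp (\<epsilon> / 2)) * I Q0"
    unfolding QX I_def index_set_def
    by (rule order_trans[OF noisy_rank_one(1)[OF R d t \<phi>] mult_right_mono[OF ex]]) simp
  also have "I Q0 \<le> ennreal (exp (\<epsilon> / 2)) * I (marginal_matrix Y)"
    unfolding QY I_def index_set_def
    by (rule order_trans[OF noisy_rank_one(2)[OF R d t \<phi>] mult_right_mono[OF ex]]) simp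
  finally have "I (marginal_matrix X) \<le> (ennreal (exp (\<epsilon> / 2)) * ennreal (exp (\<epsilon> / 2))) * I (marginal_matrix Y)"
    by (simp add: mult_left_mono mult.assoc)
  also have "ennreal (exp (\<epsilon> / 2)) * ennreal (exp (\<epsilon> / 2)) = ennreal (exp \<epsilon>)"
    by (simp add: ennreal_mult[symmetric] flip: exp_add)
  finally show ?thesis using em n by simp
qed

lemma diff_private_marginal:
  assumes d: "d > 0" and e: "\<epsilon> > 0"
  shows "diff_private \<epsilon> (cube d) (pairs d) (marginal_mechanism d \<epsilon>)"
  unfolding diff_private_def
proof (intro allI ballI impI)
  fix n X Y S
  assume X: "X \<in> datasets (cube d) n" and Y: "Y \<in> datasets (cube d) n" and XY: "neighbours X Y"
    and S: "S \<in> sets (answer_space (pairs d))"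
  have len: "length X = n" "length Y = n" using X Y by (auto simp: datasets_def)
  define D where "D = {i. i < n \<and> X ! i \<noteq> Y ! i}"
  have D: "finite D" "card D \<le> 1" using XY len by (auto simp: neighbours_def D_def)
  show "emeasure (marginal_mechanism d \<epsilon> X) S \<le> ennreal (exp \<epsilon>) * emeasure (marginal_mechanism d \<epsilon> Y) S"
  proof (cases "D = {}")
    case True
    then have "X = Y" using len by (intro nth_equalityI) (auto simp: D_def)
    moreover have "1 * emeasure (marginal_mechanism d \<epsilon> Y) S \<le> ennreal (exp \<epsilon>) * emeasure (marginal_mechanism d \<epsilon> Y) S"
      using e ennreal_leI[of 1 "exp \<epsilon>"] by (intro mult_right_mono) auto
    ultimately show ?thesis by simp
  next
    case False
    then obtain i where i: "i \<in> D" by auto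
    then have uniq: "l = i" if "l \<in> D" for l using D that by (metis card_le_Suc0_iff_eq One_nat_def)
    show ?thesis
    proof (rule emeasure_le_replace[OF d e len _ _ S])
      show "i < n" using i by (simp add: D_def)
      show "X ! l = Y ! l" if "l < n" "l \<noteq> i" for l
        using uniq[of l] that unfolding D_def by blast
    qed
  qed
qed

section \<open>Error and sample complexity\<close>

lemma form_wishart: "form d (\<lambda>j k. wishart R d g (j, k)) v = wishart_form R d g v"
proof -
  have "form d (\<lambda>j k. wishart R d g (j, k)) v = (\<Sum>j<d. \<Sum>k<d. \<Sum>i\<in>R. (v j * g (i, j)) * (v k * g (i, k)) / 2)"
    by (auto simp: dot_def mvec_def wishart_def sum_distrib_left sum_distrib_right sum_divide_distrib algebra_simps intro!: sum.cong)
  also have "\<dots> = (\<Sum>j<d. \<Sum>i\<in>R. \<Sum>k<d. (v j * g (i, j)) * (v k * g (i, k)) / 2)"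
    by (intro sum.cong refl sum.swap)
  also have "\<dots> = (\<Sum>i\<in>R. \<Sum>j<d. \<Sum>k<d. (v j * g (i, j)) * (v k * g (i, k)) / 2)"
    by (rule sum.swap)
  also have "\<dots> = wishart_form R d g v"
    by (simp add: wishart_form_def power2_eq_square sum_product sum_divide_distrib)
  finally show ?thesis .
qed

lemma wishart_form_nonneg: "wishart_form R d g v \<ge> 0"
  by (simp add: wishart_form_def sum_nonneg)

text \<open>Both Wishart forms lie between \<open>0\<close> and their bounds, which controls their
  difference in either direction.\<close>

lemma noisy_form:
  assumes d: "d > 0" and t: "t \<ge> 0"
  shows "\<bar>form d (\<lambda>j k. noisy R R' d t Q g (j, k) - Q j k) v\<bar>
    \<le> t * (wishart_bound R d g + wishart_bound R' d g) * dot d v v"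
proof -
  have "form d (\<lambda>j k. noisy R R' d t Q g (j, k) - Q j k) v =
      t * (form d (\<lambda>j k. wishart R d g (j, k)) v - form d (\<lambda>j k. wishart R' d g (j, k)) v)"
    by (simp add: dot_def mvec_def noisy_def sum_subtractf[symmetric] sum_distrib_left algebra_simps)
  also have "\<dots> = t * (wishart_form R d g v - wishart_form R' d g v)" by (simp only: form_wishart)
  finally have e: "form d (\<lambda>j k. noisy R R' d t Q g (j, k) - Q j k) v = t * (wishart_form R d g v - wishart_form R' d g v)" .
  have "wishart_form R d g v \<le> wishart_bound R d g * dot d v v" "wishart_form R' d g v \<le> wishart_bound R' d g * dot d v v"
    using wishart_form_le_bound[OF d] by (simp_all add: dot_def power2_eq_square)
  then have "\<bar>wishart_form R d g v - wishart_form R' d g v\<bar> \<le> (wishart_bound R d g + wishart_bound R' d g) * dot d v v"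
    using wishart_form_nonneg[of R d g v] wishart_form_nonneg[of R' d g v] by (simp add: distrib_right)
  then show ?thesis unfolding e abs_mult using t by (simp add: mult_left_mono mult.assoc)
qed

text \<open>Diagonal entries are values of the form at unit vectors, so the diagonal part obeys the
  same bound and removing it at most doubles the constant.\<close>

lemma off_form_le:
  assumes E: "\<And>v. \<bar>form d E v\<bar> \<le> l * dot d v v"
  shows "\<bar>form d (off E) v\<bar> \<le> 2 * l * dot d v v"
proof -
  have "(\<Sum>k<d. off E j k * v k) = (\<Sum>k<d. E j k * v k) - E j j * v j" if "j < d" for j
  proof -
    have "(\<Sum>k<d. off E j k * v k) = (\<Sum>k<d. E j k * v k - (if k = j then E j j * v j else 0))"
      by (intro sum.cong) (auto simp: off_def)
    then show ?thesis using that by (simp add: sum_subtractf)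
  qed
  then have "form d (off E) v = (\<Sum>j<d. v j * (\<Sum>k<d. E j k * v k) - E j j * (v j * v j))"
    unfolding dot_def mvec_def by (intro sum.cong) (auto simp: right_diff_distrib)
  then have e: "form d (off E) v = form d E v - (\<Sum>j<d. E j j * (v j * v j))"
    by (simp add: dot_def mvec_def sum_subtractf)
  have "\<bar>\<Sum>j<d. E j j * (v j * v j)\<bar> \<le> (\<Sum>j<d. l * (v j * v j))"
  proof (rule order_trans[OF sum_abs], rule sum_mono)
    fix j assume "j \<in> {..<d}"
    then have "\<bar>E j j\<bar> \<le> l" using E[of "unit j"] by (simp add: dot_unit mvec_unit)
    then show "\<bar>E j j * (v j * v j)\<bar> \<le> l * (v j * v j)" by (simp add: abs_mult mult_right_mono)
  qed
  also have "\<dots> = l * dot d v v" by (simp add: dot_def sum_distrib_left)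
  finally show ?thesis using E[of v] unfolding e by linarith
qed

text \<open>Polarisation at the sum of two unit vectors, of squared length \<open>2\<close>.\<close>

lemma entry_form_le:
  assumes E: "\<And>v. \<bar>form d E v\<bar> \<le> l * dot d v v" and s: "symm d E" and jk: "j < d" "k < d" and l: "l \<ge> 0"
  shows "\<bar>E j k\<bar> \<le> 2 * l"
proof (cases "j = k")
  case True
  then show ?thesis using E[of "unit k"] jk l by (simp add: dot_unit mvec_unit)
next
  case False
  let ?v = "\<lambda>i. unit j i + 1 * unit k i"
  have "form d E ?v = E j j + E k j + E j k + E k k"
    unfolding mvec_add dot_add using jk by (simp add: dot_unit mvec_unit)
  moreover have "dot d ?v ?v = 2"
    unfolding dot_add using jk False by (simp add: dot_unit)
  moreover have "E k j = E j k" using s jk by (simp add: symm_def)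
  ultimately have "\<bar>E j j + 2 * E j k + E k k\<bar> \<le> 2 * l" using E[of ?v] by simp
  moreover have "\<bar>E j j\<bar> \<le> l" "\<bar>E k k\<bar> \<le> l" using E[of "unit j"] E[of "unit k"] jk by (simp_all add: dot_unit mvec_unit)
  ultimately show ?thesis by linarith
qed

text \<open>Each element divided by \<open>sqrt n\<close> has squared length at most
  \<open>d / n\<close>, and there are \<open>n\<close> of them.\<close>

lemma in_cone_marginal:
  assumes n: "length X = n" "n > 0"
  shows "in_cone d (marginal_matrix X) (real d)"
proof -
  define B where "B i j = (of_bool (X ! i ! j) / sqrt (real n) :: real)" for i j
  have Q: "marginal_matrix X = (\<lambda>j k. \<Sum>i<n. B i j * B i k)"
    unfolding marginal_matrix_def n(1) sum_distrib_left by (intro ext sum.cong refl) (simp add: B_def)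
  have "(\<Sum>i<n. dot d (B i) (B i)) \<le> (\<Sum>i<n. real d / real n)"
  proof (rule sum_mono)
    fix i
    have "dot d (B i) (B i) \<le> (\<Sum>j<d. 1 / real n)"
      unfolding dot_def using n by (intro sum_mono) (auto simp: B_def)
    then show "dot d (B i) (B i) \<le> real d / real n" by simp
  qed
  then have "(\<Sum>i<n. dot d (B i) (B i)) \<le> real d" using n by simp
  then show ?thesis using in_cone_mono[OF in_cone_gram[of d B "{..<n}"]] by (simp add: Q)
qed

lemma symm_noisy:
  assumes "symm d Q"
  shows "symm d (\<lambda>j k. noisy R R' d t Q g (j, k))"
  using assms by (simp add: symm_def noisy_def wishart_def mult.commute)

text \<open>Both cases use the constant \<open>2 * \<Lambda>\<close>, the doubling being the price
  for discarding the diagonal.\<close>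

lemma denoise_error:
  fixes g and R R' :: "nat set"
  assumes d: "d > 0" and n: "length X = n" "n > 0" and t: "t \<ge> 0"
  defines "\<Lambda> \<equiv> t * (wishart_bound R d g + wishart_bound R' d g)"
  shows "offnorm2 d (\<lambda>j k. denoise d n \<epsilon> (\<lambda>j k. noisy R R' d t (marginal_matrix X) g (j, k)) j k - marginal_matrix X j k)
    \<le> (if real n * \<epsilon> < real d * real d then 13 * real d + 20 * real d * \<Lambda> else real d * (2 * \<Lambda>)\<^sup>2)"
proof -
  define Q where "Q = marginal_matrix X"
  define A where "A = (\<lambda>j k. noisy R R' d t Q g (j, k))"
  have L: "\<Lambda> \<ge> 0" unfolding \<Lambda>_def using t by (intro mult_nonneg_nonneg add_nonneg_nonneg wishart_bound_nonneg)
  have sQ: "symm d Q" by (simp add: Q_def symm_def marginal_matrix_def mult.commute)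
  have sA: "symm d A" unfolding A_def by (rule symm_noisy[OF sQ])
  have sE: "symm d (\<lambda>j k. A j k - Q j k)" using sA sQ by (simp add: symm_def)
  have f: "\<bar>form d (\<lambda>j k. A j k - Q j k) v\<bar> \<le> \<Lambda> * dot d v v" for v
    unfolding A_def \<Lambda>_def by (rule noisy_form[OF d t])
  have fo: "\<bar>form d (off (\<lambda>j k. A j k - Q j k)) v\<bar> \<le> (2 * \<Lambda>) * dot d v v" for v
    by (rule off_form_le[OF f])
  show ?thesis
  proof (cases "real n * \<epsilon> < real d * real d")
    case True
    interpret frank_wolfe_setup d A Q "2 * \<Lambda>"
      using d sA in_cone_marginal[OF n] fo L entry_form_le[OF f sE _ _ L] by unfold_locales (auto simp: Q_def)
    show ?thesis using frank_wolfe_error True by (simp add: denoise_def A_def Q_def)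
  next
    case False
    have "symm d (off (\<lambda>j k. A j k - Q j k))" using sE by (auto simp: symm_def off_def)
    from symm_form_norm[OF this fo] L False show ?thesis
      by (simp add: denoise_def A_def Q_def offnorm2_def)
  qed
qed

lemma answer_marginal: "answer (marginal p) X = marginal_matrix X (fst p) (snd p)"
proof -
  have "(\<Sum>x\<leftarrow>X. marginal p x) = (\<Sum>i<length X. marginal p (X ! i))"
    by (simp add: sum_list_sum_nth atLeast0LessThan)
  then show ?thesis by (simp only: answer_def marginal_matrix_def marginal_def)
qed

lemma sum_pairs_le_offnorm2: "(\<Sum>p\<in>pairs d. (D (fst p) (snd p))\<^sup>2) \<le> offnorm2 d D"
proof -
  have "(\<Sum>p\<in>pairs d. (D (fst p) (snd p))\<^sup>2) = (\<Sum>p\<in>pairs d. off D (fst p) (snd p) * off D (fst p) (snd p))"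
    by (intro sum.cong) (auto simp: pairs_def off_def power2_eq_square)
  also have "\<dots> \<le> (\<Sum>p\<in>{..<d} \<times> {..<d}. off D (fst p) (snd p) * off D (fst p) (snd p))"
    by (intro sum_mono2) (auto simp: pairs_def)
  also have "\<dots> = offnorm2 d D"
    by (simp add: offnorm2_def minner_def sum.cartesian_product case_prod_unfold)
  finally show ?thesis .
qed

text \<open>For \<open>d \<ge> 2\<close> the number of pairs is at least
  \<open>d\<^sup>2 / 4\<close>. For \<open>d = 1\<close> there are no pairs and the left side is
  \<open>0\<close>.\<close>

lemma normalised_error_le:
  assumes d: "d > 0" and O: "(\<Sum>p\<in>pairs d. (D p)\<^sup>2) \<le> z"
  shows "(1 / sqrt (real (card (pairs d)))) * sqrt (\<Sum>p\<in>pairs d. (D p)\<^sup>2) \<le> (2 / real d) * sqrt z"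
proof (cases "d = 1")
  case True
  then have "pairs d = {}" by (auto simp: pairs_def)
  then show ?thesis using O True by simp
next
  case False
  then have d2: "d \<ge> 2" using d by simp
  have "even (d * (d - 1))" by (cases "even d") auto
  then have "2 * (d choose 2) = d * (d - 1)" unfolding choose_two by (rule dvd_mult_div_cancel)
  then have "2 * real (card (pairs d)) = real d * real (d - 1)"
    unfolding card_pairs by (metis of_nat_mult of_nat_numeral)
  moreover have "real d * real d \<le> 2 * (real d * real (d - 1))"
    using d2 by (simp add: of_nat_diff algebra_simps mult_le_cancel_left)
  ultimately have "(real d / 2)\<^sup>2 \<le> real (card (pairs d))" by (simp add: power2_eq_square)
  then have k: "real d / 2 \<le> sqrt (real (card (pairs d)))" by (rule real_le_rsqrt)
  have "1 / sqrt (real (card (pairs d))) \<le> 1 / (real d / 2)"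
    using k d by (intro divide_left_mono mult_pos_pos less_le_trans[OF _ k]) auto
  then show ?thesis using O by (intro mult_mono) (auto simp: sum_nonneg)
qed

text \<open>In terms of \<open>x\<close> the two error bounds are \<open>sqrt d * x\<^sup>2\<close>
  and \<open>x\<close>. The constant is \<open>13 + 1 + 40 * 144\<close> from the projected case;
  the other case needs only \<open>8 * 144\<close>.\<close>

lemma err_marginal_le:
  assumes d: "d > 0" and e: "\<epsilon> > 0" and n: "n > 0"
  defines "x \<equiv> sqrt (real d / (real n * \<epsilon>))"
  shows "err (cube d) (pairs d) marginal (marginal_mechanism d \<epsilon>) n
    \<le> ennreal (5774 * min (sqrt (real d) * x\<^sup>2) x)"
  unfolding err_def
proof (rule SUP_least)
  fix X assume "X \<in> datasets (cube d) n"
  then have len: "length X = n" by (simp add: datasets_def)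
  let ?R = "{..<d + 1}" and ?R' = "{d + 1..<2 * (d + 1)}"
  let ?\<gamma> = "gauss (index_set d)"
  define t where "t = noise_level d n \<epsilon>"
  define \<nu> where "\<nu> = real n * \<epsilon>"
  have \<nu>: "\<nu> > 0" using e n by (simp add: \<nu>_def)
  have x: "x > 0" "x\<^sup>2 = real d / \<nu>" using d \<nu> by (simp_all add: x_def flip: \<nu>_def)
  have t: "t = 2 * x\<^sup>2" "t \<ge> 0" by (simp_all add: t_def noise_level_def x flip: \<nu>_def) (use \<nu> in simp)
  define l where "l g = wishart_bound ?R d g + wishart_bound ?R' d g" for g
  define V where "V y = (1 / sqrt (real (card (pairs d)))) * sqrt (\<Sum>p\<in>pairs d. (y p - answer (marginal p) X)\<^sup>2)"
    for y :: "nat \<times> nat \<Rightarrow> real"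
  define rel where "rel g = release d n \<epsilon> (noisy_matrix d n \<epsilon> (marginal_matrix X) g)" for g
  \<comment> \<open>An error affine in the operator norm bound \<open>l\<close> can be integrated
    directly, as \<open>l\<close> has mean at most \<open>2 * 72 * d\<close>.\<close>
  have mean: "(\<integral>\<^sup>+g. ennreal (V (rel g)) \<partial>?\<gamma>) \<le> ennreal (c0 + c1 * (144 * real d))"
    if c: "c0 \<ge> 0" "c1 \<ge> 0" and le: "\<And>g. V (rel g) \<le> c0 + c1 * l g" for c0 c1
  proof -
    have m: "wishart_bound ?R d \<in> borel_measurable ?\<gamma>" "wishart_bound ?R' d \<in> borel_measurable ?\<gamma>"
      by (rule measurable_wishart_bound, force simp: index_set_def)+
    have wb: "(\<integral>\<^sup>+g. ennreal (wishart_bound ?R d g) \<partial>?\<gamma>) \<le> ennreal (72 * real d)"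
      "(\<integral>\<^sup>+g. ennreal (wishart_bound ?R' d g) \<partial>?\<gamma>) \<le> ennreal (72 * real d)"
      by (rule wishart_bound_mean, use d in \<open>auto simp: index_set_def\<close>)+
    have "(\<integral>\<^sup>+g. ennreal (V (rel g)) \<partial>?\<gamma>) \<le> (\<integral>\<^sup>+g. ennreal c0 + ennreal c1 * (ennreal (wishart_bound ?R d g) + ennreal (wishart_bound ?R' d g)) \<partial>?\<gamma>)"
    proof (rule nn_integral_mono)
      fix g
      have "ennreal (V (rel g)) \<le> ennreal (c0 + c1 * l g)" by (rule ennreal_leI[OF le])
      also have "\<dots> = ennreal c0 + ennreal c1 * (ennreal (wishart_bound ?R d g) + ennreal (wishart_bound ?R' d g))"
        using c wishart_bound_nonneg by (simp add: l_def ennreal_mult)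
      finally show "ennreal (V (rel g)) \<le> ennreal c0 + ennreal c1 * (ennreal (wishart_bound ?R d g) + ennreal (wishart_bound ?R' d g))" .
    qed
    also have "\<dots> = ennreal c0 + ennreal c1 * ((\<integral>\<^sup>+g. ennreal (wishart_bound ?R d g) \<partial>?\<gamma>) + (\<integral>\<^sup>+g. ennreal (wishart_bound ?R' d g) \<partial>?\<gamma>))"
      using m prob_space.emeasure_space_1[OF prob_space_gauss[of "index_set d"]]
      by (simp add: nn_integral_add nn_integral_cmult)
    also have "\<dots> \<le> ennreal c0 + ennreal c1 * (ennreal (72 * real d) + ennreal (72 * real d))"
      by (intro add_left_mono mult_left_mono add_mono wb) simp
    also have "\<dots> = ennreal (c0 + c1 * (144 * real d))"
      using c by (simp add: ennreal_mult[symmetric] ennreal_plus[symmetric] del: ennreal_plus)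
    finally show ?thesis .
  qed
  have V: "V (rel g) \<le> (2 / real d) * sqrt (if \<nu> < real d * real d then 13 * real d + 20 * real d * (t * l g) else real d * (2 * (t * l g))\<^sup>2)"
    for g
    unfolding V_def
  proof (rule normalised_error_le[OF d])
    define D where "D j k = denoise d n \<epsilon> (\<lambda>j k. noisy_matrix d n \<epsilon> (marginal_matrix X) g (j, k)) j k - marginal_matrix X j k" for j k
    have "(\<Sum>p\<in>pairs d. (rel g p - answer (marginal p) X)\<^sup>2) = (\<Sum>p\<in>pairs d. (D (fst p) (snd p))\<^sup>2)"
      using len by (intro sum.cong) (auto simp: rel_def release_def D_def answer_marginal)
    also have "\<dots> \<le> offnorm2 d D" by (rule sum_pairs_le_offnorm2)
    also have "\<dots> \<le> (if \<nu> < real d * real d then 13 * real d + 20 * real d * (t * l g) else real d * (2 * (t * l g))\<^sup>2)"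
      using denoise_error[OF d len n t(2), where \<epsilon>=\<epsilon> and R="?R" and R'="?R'" and g=g] unfolding D_def[abs_def] t_def \<nu>_def l_def .
    finally show "(\<Sum>p\<in>pairs d. (rel g p - answer (marginal p) X)\<^sup>2) \<le>
      (if \<nu> < real d * real d then 13 * real d + 20 * real d * (t * l g) else real d * (2 * (t * l g))\<^sup>2)" .
  qed
  have lnn: "l g \<ge> 0" for g by (simp add: l_def wishart_bound_nonneg)
  have sd: "sqrt (real d) > 0" "sqrt (real d) * sqrt (real d) = real d" using d by auto
  have "(\<integral>\<^sup>+g. ennreal (V (rel g)) \<partial>?\<gamma>) \<le> ennreal (5774 * min (sqrt (real d) * x\<^sup>2) x)"
  proof (cases "\<nu> < real d * real d")
    case True
    have dx: "1 \<le> (sqrt (real d) * x)\<^sup>2"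
    proof -
      have "(sqrt (real d) * x)\<^sup>2 = real d * real d / \<nu>" by (simp add: power_mult_distrib x)
      then show ?thesis using True \<nu> by simp
    qed
    then have "1 \<le> sqrt (real d) * x" using x(1) power2_le_imp_le[of 1 "sqrt (real d) * x"] by simp
    then have "1 * x \<le> sqrt (real d) * x * x" using x(1) by (intro mult_right_mono) auto
    then have min: "min (sqrt (real d) * x\<^sup>2) x = x" by (simp add: power2_eq_square)
    define a where "a = real d * x"
    have a: "a > 0" using d x by (simp add: a_def)
    have "V (rel g) \<le> (13 / a + x) + (40 * x / real d) * l g" for g
    proof -
      define z where "z = 13 * real d + 20 * real d * (t * l g)"
      have z: "z \<ge> 0" using t(2) lnn[of g] by (simp add: z_def)
      \<comment> \<open>The arithmetic-geometric mean inequality makes the square root affine in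
        \<open>l\<close>; \<open>a = d * x\<close> is the expected order of
        \<open>sqrt z\<close>.\<close>
      have "sqrt z \<le> (z / a + a) / 2"
      proof -
        have "0 \<le> (sqrt z - a)\<^sup>2" by simp
        then have "2 * (a * sqrt z) \<le> z + a * a" using z by (simp add: power2_eq_square algebra_simps)
        then have "2 * (a * sqrt z) / a \<le> (z + a * a) / a" using a by (intro divide_right_mono) auto
        then show ?thesis using a by (simp add: add_divide_distrib)
      qed
      then have "(2 / real d) * sqrt z \<le> (2 / real d) * ((z / a + a) / 2)" by (intro mult_left_mono) auto
      also have "\<dots> = z / (real d * a) + a / real d" using d by (simp add: add_divide_distrib algebra_simps)
      also have "z / (real d * a) = 13 / a + 20 * (t * l g) / a" using d by (simp add: z_def add_divide_distrib)
      also have "20 * (t * l g) / a = (40 * x / real d) * l g" using x(1) d by (simp add: t(1) a_def power2_eq_square)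
      also have "a / real d = x" using d by (simp add: a_def)
      finally show ?thesis using V[of g] True by (simp add: z_def)
    qed
    then have "(\<integral>\<^sup>+g. ennreal (V (rel g)) \<partial>?\<gamma>) \<le> ennreal ((13 / a + x) + (40 * x / real d) * (144 * real d))"
      using a x(1) by (intro mean) auto
    also have "\<dots> \<le> ennreal (5774 * x)"
    proof (rule ennreal_leI)
      have "13 \<le> 13 * (sqrt (real d) * x)\<^sup>2" using dx by simp
      also have "\<dots> = 13 * x * a" by (simp add: a_def power_mult_distrib power2_eq_square)
      finally have "13 / a \<le> 13 * x" using a by (simp add: pos_divide_le_eq)
      moreover have "(40 * x / real d) * (144 * real d) = 5760 * x" using d by simp
      ultimately show "(13 / a + x) + (40 * x / real d) * (144 * real d) \<le> 5774 * x" by simp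
    qed
    finally show ?thesis by (simp add: min)
  next
    case False
    have dx: "(sqrt (real d) * x)\<^sup>2 \<le> 1\<^sup>2"
    proof -
      have "(sqrt (real d) * x)\<^sup>2 = real d * real d / \<nu>" by (simp add: power_mult_distrib x)
      then show ?thesis using False \<nu> by simp
    qed
    then have "sqrt (real d) * x \<le> 1" by (rule power2_le_imp_le) simp
    then have "sqrt (real d) * x * x \<le> 1 * x" using x(1) by (intro mult_right_mono) auto
    then have min: "min (sqrt (real d) * x\<^sup>2) x = sqrt (real d) * x\<^sup>2" by (simp add: power2_eq_square)
    have "V (rel g) \<le> 0 + (8 * x\<^sup>2 / sqrt (real d)) * l g" for g
    proof -
      have "sqrt (real d * (2 * (t * l g))\<^sup>2) = sqrt (real d) * (2 * (t * l g))"
        using t(2) lnn[of g] by (simp add: real_sqrt_mult)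
      then have "V (rel g) \<le> (2 / real d) * (sqrt (real d) * (2 * (t * l g)))" using V[of g] False by simp
      also have "\<dots> = (8 * x\<^sup>2 / sqrt (real d)) * l g"
        using sd by (simp add: t(1) field_simps)
      finally show ?thesis by simp
    qed
    then have "(\<integral>\<^sup>+g. ennreal (V (rel g)) \<partial>?\<gamma>) \<le> ennreal (0 + (8 * x\<^sup>2 / sqrt (real d)) * (144 * real d))"
      by (intro mean) auto
    also have "\<dots> \<le> ennreal (5774 * (sqrt (real d) * x\<^sup>2))"
    proof (rule ennreal_leI)
      have "(8 * x\<^sup>2 / sqrt (real d)) * (144 * real d) = 1152 * (sqrt (real d) * x\<^sup>2)"
        using sd by (simp add: field_simps)
      then show "0 + (8 * x\<^sup>2 / sqrt (real d)) * (144 * real d) \<le> 5774 * (sqrt (real d) * x\<^sup>2)"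
        using sd x(1) by simp
    qed
    finally show ?thesis by (simp add: min)
  qed
  moreover have "(\<lambda>y. ennreal (V y)) \<in> borel_measurable (answer_space (pairs d))"
    unfolding V_def by measurable
  ultimately show "(\<integral>\<^sup>+y. ennreal ((1 / sqrt (real (card (pairs d)))) * sqrt (\<Sum>i\<in>pairs d. (y i - answer (marginal i) X)\<^sup>2))
      \<partial>marginal_mechanism d \<epsilon> X) \<le> ennreal (5774 * min (sqrt (real d) * x\<^sup>2) x)"
    using nn_integral_mechanism[OF d, of "\<lambda>y. ennreal (V y)" \<epsilon> X] by (simp add: V_def len rel_def)
qed

lemma sample_complexity_marginal_le:
  assumes d: "d > 0" and e: "\<epsilon> > 0" and a: "\<alpha> > 0"
  shows "sample_complexity (cube d) (pairs d) marginal (marginal_mechanism d \<epsilon>) \<alpha>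
    \<le> ennreal (max 1 (2 * 5774\<^sup>2 * min (real d powr (3/2) / (\<alpha> * \<epsilon>)) (real d / (\<alpha>\<^sup>2 * \<epsilon>))))"
proof -
  define C :: real where "C = 5774"
  define m where "m = min (real d powr (3/2) / (\<alpha> * \<epsilon>)) (real d / (\<alpha>\<^sup>2 * \<epsilon>))"
  define B where "B = max 1 (2 * C\<^sup>2 * m)"
  \<comment> \<open>Since \<open>B \<ge> 1\<close>, rounding down loses less than a factor
    \<open>2\<close>; this is the factor \<open>2\<close> in \<open>B\<close>.\<close>
  define n where "n = nat \<lfloor>B\<rfloor>"
  have B: "B \<ge> 1" by (simp add: B_def)
  then have n1: "n \<ge> 1" "real n \<le> B" by (auto simp: n_def le_nat_floor)
  have "B < real n + 1" using B by (simp add: n_def)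
  then have n2: "C\<^sup>2 * m \<le> real n" using n1 by (simp add: B_def)
  define x where "x = sqrt (real d / (real n * \<epsilon>))"
  have x: "x\<^sup>2 = real d / (real n * \<epsilon>)" "x > 0" using d e n1 by (simp_all add: x_def)
  have pw: "real d powr (3/2) = sqrt (real d) * real d"
  proof -
    have "real d powr (3/2) = real d powr (1/2 + 1)" by simp
    also have "\<dots> = real d powr (1/2) * real d powr 1" by (rule powr_add)
    finally show ?thesis using d by (simp add: powr_half_sqrt)
  qed
  have "C * min (sqrt (real d) * x\<^sup>2) x \<le> \<alpha>"
  proof (cases "m = real d / (\<alpha>\<^sup>2 * \<epsilon>)")
    case True
    have "C\<^sup>2 * real d \<le> real n * (\<alpha>\<^sup>2 * \<epsilon>)" using n2 a e by (simp add: True pos_divide_le_eq)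
    then have "C\<^sup>2 * x\<^sup>2 \<le> \<alpha>\<^sup>2" using e n1 by (simp add: x(1) pos_divide_le_eq algebra_simps)
    then have "(C * x)\<^sup>2 \<le> \<alpha>\<^sup>2" by (simp add: power_mult_distrib)
    then have "C * x \<le> \<alpha>" by (rule power2_le_imp_le) (use a in simp)
    moreover have "C * min (sqrt (real d) * x\<^sup>2) x \<le> C * x" by (simp add: C_def)
    ultimately show ?thesis by linarith
  next
    case False
    then have m: "m = sqrt (real d) * real d / (\<alpha> * \<epsilon>)" by (auto simp: m_def min_def pw split: if_splits)
    have "C\<^sup>2 * (sqrt (real d) * real d) \<le> real n * (\<alpha> * \<epsilon>)" using n2 a e by (simp add: m pos_divide_le_eq)
    \<comment> \<open>This bound is linear in the error and asks for \<open>C\<close> only;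
      \<open>C\<^sup>2\<close> is what the quadratic one requires.\<close>
    moreover have "C * (sqrt (real d) * real d) \<le> C\<^sup>2 * (sqrt (real d) * real d)"
      by (intro mult_right_mono) (auto simp: C_def)
    ultimately have "C * (sqrt (real d) * real d) \<le> \<alpha> * (real n * \<epsilon>)" by (simp add: algebra_simps)
    then have "C * (sqrt (real d) * x\<^sup>2) \<le> \<alpha>" using e n1 by (simp add: x(1) pos_divide_le_eq)
    moreover have "C * min (sqrt (real d) * x\<^sup>2) x \<le> C * (sqrt (real d) * x\<^sup>2)" by (simp add: C_def)
    ultimately show ?thesis by linarith
  qed
  then have "err (cube d) (pairs d) marginal (marginal_mechanism d \<epsilon>) n \<le> ennreal \<alpha>"
    using err_marginal_le[OF d e, of n] n1 by (auto simp: C_def x_def intro: order_trans ennreal_leI)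
  then have "sample_complexity (cube d) (pairs d) marginal (marginal_mechanism d \<epsilon>) \<alpha> \<le> of_nat n"
    unfolding sample_complexity_def using n1 by (intro INF_lower2[of n]) auto
  also have "\<dots> = ennreal (real n)" by (simp add: ennreal_of_nat_eq_real_of_nat)
  also have "\<dots> \<le> ennreal B" by (rule ennreal_leI[OF n1(2)])
  finally show ?thesis by (simp add: B_def m_def C_def)
qed

lemma marginal_program_computes:
  assumes d: "d > 0" and e: "\<epsilon> > 0"
  shows "computes_within marginal_program d \<epsilon> (marginal_mechanism d \<epsilon>)
    (\<lambda>n. 1000 * (real d + real n + 1 / \<epsilon>) ^ 6)"
  unfolding computes_within_def
proof (intro allI ballI)
  fix n X assume X: "X \<in> datasets (cube d) n"
  then have len: "length X = n" by (simp add: datasets_def)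
  interpret layout d n by unfold_locales (rule d)
  let ?D = "\<lambda>\<omega>. denoise d n \<epsilon> (noisy_gram d n \<epsilon> X (snd \<omega>))"
  have "\<forall>\<omega>. \<exists>s. (\<exists>t. exec \<omega> marginal_program (input_state d \<epsilon> X) t s \<and> t \<le> total_time) \<and>
      (\<forall>j<d. \<forall>k<d. cell s (j * d + k) = ?D \<omega> j k)"
    using marginal_program[OF X] unfolding achieves_def by blast
  \<comment> \<open>A halting state is chosen for each tape. Measurability is then shown for the
    output alone, through its explicit formula.\<close>
  then obtain F where F: "\<And>\<omega>. \<exists>t. exec \<omega> marginal_program (input_state d \<epsilon> X) t (F \<omega>) \<and> t \<le> total_time"
    "\<And>\<omega> j k. j < d \<Longrightarrow> k < d \<Longrightarrow> cell (F \<omega>) (j * d + k) = ?D \<omega> j k"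
    by metis
  have out: "output_vector d (F \<omega>) = release d n \<epsilon> (noisy_matrix d n \<epsilon> (marginal_matrix X) (rows_of_tape d \<omega>))" for \<omega>
    unfolding release_tape[OF len] output_vector_def using pairs_less by (intro restrict_ext) (auto simp: F(2))
  have time: "real t \<le> 1000 * (real d + real n + 1 / \<epsilon>) ^ 6" if "t \<le> total_time" for t
  proof -
    have "real t \<le> real (1000 * (d + n) ^ 6)" using that total_time_le by (simp only: of_nat_le_iff)
    also have "\<dots> = 1000 * (real d + real n) ^ 6" by simp
    also have "\<dots> \<le> 1000 * (real d + real n + 1 / \<epsilon>) ^ 6"
      using e by (intro mult_left_mono power_mono) auto
    finally show ?thesis .
  qed
  show "\<exists>F. (\<forall>\<omega>. \<exists>t. exec \<omega> marginal_program (input_state d \<epsilon> X) t (F \<omega>) \<and>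
          real t \<le> 1000 * (real d + real n + 1 / \<epsilon>) ^ 6) \<and>
        (\<lambda>\<omega>. output_vector d (F \<omega>)) \<in> measurable tape_measure (answer_space (pairs d)) \<and>
        marginal_mechanism d \<epsilon> X = distr tape_measure (answer_space (pairs d)) (\<lambda>\<omega>. output_vector d (F \<omega>))"
  proof (intro exI[of _ F] conjI allI)
    show "\<exists>t. exec \<omega> marginal_program (input_state d \<epsilon> X) t (F \<omega>) \<and>
          real t \<le> 1000 * (real d + real n + 1 / \<epsilon>) ^ 6" for \<omega>
      using F(1)[of \<omega>] time by blast
  qed (simp_all only: out marginal_mechanism_def len measurable_mechanism[OF d])
qed

theorem theorem7:
  shows "\<exists>(C::real) (c::com) (K::real) (e::nat). C > 0 \<and>
    (\<forall>(d::nat) (\<epsilon>::real). d \<ge> 1 \<longrightarrow> \<epsilon> > 0 \<longrightarrow>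
      (\<exists>M :: (bool list, nat \<times> nat) mechanism.
         is_mechanism (cube d) (pairs d) M \<and>
         diff_private \<epsilon> (cube d) (pairs d) M \<and>
         (\<forall>\<alpha>::real. \<alpha> > 0 \<longrightarrow>
            sample_complexity (cube d) (pairs d) marginal M \<alpha>
              \<le> ennreal (max 1 (C * min (real d powr (3/2) / (\<alpha> * \<epsilon>)) (real d / (\<alpha>\<^sup>2 * \<epsilon>))))) \<and>
         computes_within c d \<epsilon> M (\<lambda>n. K * (real d + real n + 1 / \<epsilon>) ^ e)))"
proof (intro exI conjI allI impI)
  show "(0::real) < 2 * 5774\<^sup>2" by simp
  fix d :: nat and \<epsilon> :: real assume "1 \<le> d" and e: "0 < \<epsilon>"
  then have d: "d > 0" by simp
  show "is_mechanism (cube d) (pairs d) (marginal_mechanism d \<epsilon>)" by (rule is_mechanism_marginal[OF d])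
  show "diff_private \<epsilon> (cube d) (pairs d) (marginal_mechanism d \<epsilon>)" by (rule diff_private_marginal[OF d e])
  show "computes_within marginal_program d \<epsilon> (marginal_mechanism d \<epsilon>) (\<lambda>n. 1000 * (real d + real n + 1 / \<epsilon>) ^ 6)"
    by (rule marginal_program_computes[OF d e])
  fix \<alpha> :: real assume "0 < \<alpha>"
  then show "sample_complexity (cube d) (pairs d) marginal (marginal_mechanism d \<epsilon>) \<alpha>
    \<le> ennreal (max 1 (2 * 5774\<^sup>2 * min (real d powr (3/2) / (\<alpha> * \<epsilon>)) (real d / (\<alpha>\<^sup>2 * \<epsilon>))))"
    by (rule sample_complexity_marginal_le[OF d e])
qed

end
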